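(* Let $k\in\frac12\mathbb Z$, $N\in\mathbb N$ (with $4\mid N$ if $k\in\frac12+\mathbb Z$), $\chi$ a Dirichlet character modulo $N$, and $f$ a harmonic Maass form of weight $k$ and character $\chi$ on $\Gamma_0(N)$ with expansion $$f(z)=\sum_{n\ge-n_0}c^+(n)q^n+\sum_{n\ge1}c^-(n)\Gamma(1-k,4\pi ny)q^{-n},$$ and let $g=f|_kw_N$ have expansion $g(z)=\sum_{n\ge-n_0}d^+(n)q^n+\sum_{n\ge1}d^-(n)\Gamma(1-k,4\pi ny)q^{-n}$ ($n_0\in\mathbb N_0$ chosen for both). Assume $c^+(n),d^+(n)=O(e^{C_f\sqrt n})$ as $n\to\infty$ for some $C_f>0$, fix $C>\max\big(C_f^2\sqrt N/(8\pi),\,2\pi n_0/\sqrt N\big)$ and set $D_n:=C+2\pi n/\sqrt N$. Suppose $k$ is a non-positive integer. Then for all $X>0$, \begin{multline*} \sum_{n\ge-n_0}c^+(n)K_0\Big(2\sqrt{D_n(C+\sqrt NX)}\Big)+\sum_{\ell=0}^{|k|}\frac{|k|!}{\ell!}\Big(\frac{4\pi\sqrt C}{\sqrt N}\sqrt{1+\frac{\sqrt NX}{C}}\Big)^{\ell}\sum_{n>0}c^-(n)\Big(\frac{n}{\sqrt{D_n}}\Big)^{\ell}K_\ell\Big(2\sqrt{D_n(C+\sqrt NX)}\Big)\\ =i^kC^{\frac k2}\sum_{n\ge-n_0}d^+(n)\big(\sqrt NX+D_n\big)^{-\frac k2}K_k\Big(2\sqrt{C(D_n+\sqrt NX)}\Big)\\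 +i^kC^{\frac k2}\sum_{\ell=0}^{|k|}\frac{|k|!}{\ell!}\Big(\frac{4\pi\sqrt C}{\sqrt N}\Big)^{\ell}\sum_{n>0}d^-(n)n^\ell\big(D_n+\sqrt NX\big)^{-\frac{\ell+k}{2}}K_{\ell+k}\Big(2\sqrt{C(D_n+\sqrt NX)}\Big). \end{multline*} Moreover, if $f$ is weakly holomorphic (so all $c^-(n)$ and $d^-(n)$ vanish), the identity holds for all $k\in\frac12\mathbb Z$, i.e. for all $X>0$ $$\sum_{n\ge-n_0}c^+(n)K_0\Big(2\sqrt{D_n(C+\sqrt NX)}\Big)=i^kC^{\frac k2}\sum_{n\ge-n_0}d^+(n)\big(\sqrt NX+D_n\big)^{-\frac k2}K_k\Big(2\sqrt{C(D_n+\sqrt NX)}\Big).$$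
   Context: Notation: $z=x+iy\in\mathbb H$, $q=e^{2\pi iz}$; principal branches of square roots and powers (in particular $i^k$) are used. $K_\nu$ is the modified Bessel function of the second kind and $\Gamma(s,x)$ the incomplete gamma function. Slash operator: $(f|_k\gamma)(z)=(cz+d)^{-k}f(\gamma z)$ for $k\in\mathbb Z$, and $(f|_k\gamma)(z)=\left(\frac cd\right)\varepsilon_d^{2k}(cz+d)^{-k}f(\gamma z)$ for $k\in\frac12+\mathbb Z$, $\gamma=\begin{pmatrix}a&b\\c&d\end{pmatrix}\in\Gamma_0(4)$, with Kronecker symbol $\left(\frac cd\right)$ and $\varepsilon_d=1$ or $i$ according as $d\equiv1$ or $3\pmod 4$. A harmonic Maass form of weight $k$, character $\chi$ on $\Gamma_0(N)$: smooth $f$ on $\mathbb H$ with $f|_k\gamma=\chi(d)f$ for all $\gamma\in\Gamma_0(N)$, $\Delta_kf=0$ with $\Delta_k=-y^2(\partial_x^2+\partial_y^2)+iky(\partial_x+i\partial_y)$, and for each $\sigma\in SL_2(\mathbb Z)$ a polynomial $P_\sigma$ with $(f|_k\sigma)(z)-P_\sigma(q^{-1})=O(e^{-\varepsilon_\sigma y})$ as $y\to\infty$ for some $\varepsilon_\sigma>0$. Such forms have expansions as in the claim (and analogous ones at all cusps); $f$ is weakly holomorphic if $c^-(n)=0$ for all $n$ at all cusps. The Fricke involution: $(f|_kw_N)(z)=N^{k/2}(Nz)^{-k}f(-1/(Nz))$; $g$ is again a harmonic Maass form of weight $k$ on $\Gamma_0(N)$. *)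

theory Defs
  imports "HOL-Analysis.Analysis" "HOL-Number_Theory.Number_Theory"
    "HOL-Library.Landau_Symbols" "HOL-Library.Going_To_Filter"
begin

section \<open>Special functions\<close>

text \<open>The integral \<open>K\<^sub>\<nu>(x) = \<integral>\<^sub>0\<^sup>\<infinity> exp(-x cosh t) cosh(\<nu> t) dt\<close> for the modified Bessel function of the
  second kind, used only for real order and \<open>x > 0\<close>.\<close>
definition bessel_K :: "real \<Rightarrow> real \<Rightarrow> real" where
  "bessel_K \<nu> x = integral {0..} (\<lambda>t. exp (- x * cosh t) * cosh (\<nu> * t))"

text \<open>Only used for \<open>x > 0\<close>, where the integral converges for every real \<open>s\<close>.\<close>
definition inc_Gamma :: "real \<Rightarrow> real \<Rightarrow> real" where
  "inc_Gamma s x = integral {x..} (\<lambda>t. t powr (s - 1) * exp (- t))"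

section \<open>Characters\<close>

definition dirichlet_character :: "nat \<Rightarrow> (int \<Rightarrow> complex) \<Rightarrow> bool" where
  "dirichlet_character N chi \<longleftrightarrow>
     (\<forall>a. chi (a + int N) = chi a) \<and>
     (\<forall>a b. chi (a * b) = chi a * chi b) \<and>
     (\<forall>a. chi a \<noteq> 0 \<longleftrightarrow> coprime a (int N))"

definition kronecker_prime :: "int \<Rightarrow> int \<Rightarrow> int" where
  "kronecker_prime a p =
     (if p = 2 then (if even a then 0 else if a mod 8 \<in> {1, 7} then 1 else -1)
      else Legendre a p)"

text \<open>The Kronecker symbol \<open>(a/n)\<close>. The sign in front is \<open>(a/u)\<close> for the unit \<open>u = sgn n\<close>;
  \<open>prime_factors n\<close> consists of the positive prime divisors.\<close>
definition kronecker :: "int \<Rightarrow> int \<Rightarrow> int" where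
  "kronecker a n =
     (if n = 0 then (if \<bar>a\<bar> = 1 then 1 else 0)
      else (if n < 0 \<and> a < 0 then -1 else 1) *
           (\<Prod>p\<in>prime_factors n. kronecker_prime a p ^ multiplicity p n))"

definition theta_eps :: "int \<Rightarrow> complex" where
  "theta_eps d = (if d mod 4 = 3 then \<i> else 1)"

section \<open>Group actions\<close>

definition upper_half_plane :: "complex set" where
  "upper_half_plane = {z. Im z > 0}"

definition SL2Z :: "(int ^ 2 ^ 2) set" where
  "SL2Z = {\<gamma>. det \<gamma> = 1}"

definition Gamma0 :: "nat \<Rightarrow> (int ^ 2 ^ 2) set" where
  "Gamma0 N = {\<gamma> \<in> SL2Z. int N dvd \<gamma> $ 2 $ 1}"

definition moebius :: "int ^ 2 ^ 2 \<Rightarrow> complex \<Rightarrow> complex" where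
  "moebius \<gamma> z =
     (of_int (\<gamma> $ 1 $ 1) * z + of_int (\<gamma> $ 1 $ 2)) / (of_int (\<gamma> $ 2 $ 1) * z + of_int (\<gamma> $ 2 $ 2))"

text \<open>For \<open>k \<notin> \<int>\<close> the theta multiplier is only meaningful on \<open>\<Gamma>\<^sub>0(4)\<close>. Outside \<open>\<Gamma>\<^sub>0(4)\<close> the slash
  operator is needed only for conditions at the cusps, which are insensitive to a
  factor of modulus 1, so that factor is taken to be 1 there.\<close>
definition multiplier :: "real \<Rightarrow> int ^ 2 ^ 2 \<Rightarrow> complex" where
  "multiplier k \<gamma> =
     (if k \<notin> \<int> \<and> \<gamma> \<in> Gamma0 4
      then of_int (kronecker (\<gamma> $ 2 $ 1) (\<gamma> $ 2 $ 2)) * theta_eps (\<gamma> $ 2 $ 2) powr of_real (2 * k)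
      else 1)"

definition slash :: "real \<Rightarrow> int ^ 2 ^ 2 \<Rightarrow> (complex \<Rightarrow> complex) \<Rightarrow> complex \<Rightarrow> complex" where
  "slash k \<gamma> f z =
     multiplier k \<gamma> * (of_int (\<gamma> $ 2 $ 1) * z + of_int (\<gamma> $ 2 $ 2)) powr (- of_real k) *
     f (moebius \<gamma> z)"

definition fricke :: "real \<Rightarrow> nat \<Rightarrow> (complex \<Rightarrow> complex) \<Rightarrow> complex \<Rightarrow> complex" where
  "fricke k N f z =
     of_real (real N powr (k / 2)) * (of_nat N * z) powr (- of_real k) * f (- 1 / (of_nat N * z))"

section \<open>Harmonic Maass forms\<close>

definition partial_x :: "(complex \<Rightarrow> complex) \<Rightarrow> complex \<Rightarrow> complex" where
  "partial_x F z = vector_derivative (\<lambda>t. F (Complex t (Im z))) (at (Re z))"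

definition partial_y :: "(complex \<Rightarrow> complex) \<Rightarrow> complex \<Rightarrow> complex" where
  "partial_y F z = vector_derivative (\<lambda>t. F (Complex (Re z) t)) (at (Im z))"

text \<open>Smoothness in the real sense: all iterated partial derivatives are (totally) real
  differentiable.\<close>
definition smooth_on_upper_half_plane :: "(complex \<Rightarrow> complex) \<Rightarrow> bool" where
  "smooth_on_upper_half_plane f \<longleftrightarrow>
     (\<forall>ds. set ds \<subseteq> {partial_x, partial_y} \<longrightarrow>
        fold (\<lambda>d. d) ds f differentiable_on upper_half_plane)"

definition hyperbolic_laplacian :: "real \<Rightarrow> (complex \<Rightarrow> complex) \<Rightarrow> complex \<Rightarrow> complex" where
  "hyperbolic_laplacian k f z =
     - of_real ((Im z)\<^sup>2) * (partial_x (partial_x f) z + partial_y (partial_y f) z)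
     + \<i> * of_real (k * Im z) * (partial_x f z + \<i> * partial_y f z)"

text \<open>\<open>qpow r z\<close> is \<open>q\<^sup>r\<close>, where \<open>q = exp(2\<pi>iz)\<close>.\<close>
definition qpow :: "real \<Rightarrow> complex \<Rightarrow> complex" where
  "qpow r z = exp (2 * of_real pi * \<i> * of_real r * z)"

text \<open>For \<open>\<sigma> \<in> SL\<^sub>2(\<int>)\<close> the function \<open>f|\<^sub>k\<sigma>\<close> has period \<open>N\<close> but in general not period 1, so the
  principal part at the corresponding cusp is a polynomial in \<open>q\<^sup>-\<^sup>1\<^sup>/\<^sup>N\<close>; polynomials in \<open>q\<^sup>-\<^sup>1\<close> are
  the special case in which only multiples of \<open>N\<close> occur as exponents. The filter
  \<open>Im going_to at_top\<close> makes the error bound uniform in the real part.\<close>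
definition harmonic_maass_form ::
    "real \<Rightarrow> nat \<Rightarrow> (int \<Rightarrow> complex) \<Rightarrow> (complex \<Rightarrow> complex) \<Rightarrow> bool" where
  "harmonic_maass_form k N chi f \<longleftrightarrow>
     smooth_on_upper_half_plane f \<and>
     (\<forall>\<gamma>\<in>Gamma0 N. \<forall>z\<in>upper_half_plane. slash k \<gamma> f z = chi (\<gamma> $ 2 $ 2) * f z) \<and>
     (\<forall>z\<in>upper_half_plane. hyperbolic_laplacian k f z = 0) \<and>
     (\<forall>\<sigma>\<in>SL2Z. \<exists>(P :: complex poly) \<epsilon>. \<epsilon> > 0 \<and>
        (\<lambda>z. norm (slash k \<sigma> f z - poly P (qpow (- 1 / real N) z)))
          \<in> O[Im going_to at_top](\<lambda>z. exp (- \<epsilon> * Im z)))"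

text \<open>\<open>F(z) = \<Sum>\<^bsub>n\<ge>-m\<^esub> a(n) q\<^bsup>n/h\<^esup> + \<Sum>\<^bsub>n\<ge>1\<^esub> b(n) \<Gamma>(1-k, 4\<pi>ny/h) q\<^bsup>-n/h\<^esup>\<close> with both series convergent;
  \<open>h = 1\<close> at the cusp \<open>\<infinity>\<close>.\<close>
definition has_maass_expansion ::
    "real \<Rightarrow> nat \<Rightarrow> nat \<Rightarrow> (int \<Rightarrow> complex) \<Rightarrow> (int \<Rightarrow> complex) \<Rightarrow> (complex \<Rightarrow> complex) \<Rightarrow> bool" where
  "has_maass_expansion k h m a b F \<longleftrightarrow>
     (\<forall>z\<in>upper_half_plane.
        (\<lambda>n. a n * qpow (of_int n / real h) z) summable_on {- int m..} \<and>
        (\<lambda>n. b n * of_real (inc_Gamma (1 - k) (4 * pi * of_int n * Im z / real h)) *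
             qpow (- of_int n / real h) z) summable_on {1..} \<and>
        F z = (\<Sum>\<^sub>\<infinity>n\<in>{- int m..}. a n * qpow (of_int n / real h) z) +
              (\<Sum>\<^sub>\<infinity>n\<in>{1..}. b n * of_real (inc_Gamma (1 - k) (4 * pi * of_int n * Im z / real h)) *
                 qpow (- of_int n / real h) z))"

text \<open>All coefficients \<open>c\<^sup>-(n)\<close> vanish in the expansions at all cusps.\<close>
definition weakly_holomorphic_form ::
    "real \<Rightarrow> nat \<Rightarrow> (int \<Rightarrow> complex) \<Rightarrow> (complex \<Rightarrow> complex) \<Rightarrow> bool" where
  "weakly_holomorphic_form k N chi f \<longleftrightarrow>
     harmonic_maass_form k N chi f \<and>
     (\<forall>\<sigma>\<in>SL2Z. \<exists>m a. has_maass_expansion k N m a (\<lambda>_. 0) (slash k \<sigma> f))"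

end

theory Submission
  imports Defs "HOL-Complex_Analysis.Complex_Analysis" "HOL-Real_Asymp.Real_Asymp"
begin

text \<open>
  With \<open>s = \<surd>N\<close>, the Fricke involution relates \<open>f(i/(st))\<close> to \<open>i\<^sup>k t\<^sup>k g(it/s)\<close>. Integrating this against
  \<open>exp(-C/t - (C + sX)t) dt/t\<close> and expanding both sides termwise gives the identity, because
  \<open>\<integral>\<^sub>0\<^sup>\<infinity> t\<^bsup>\<nu>-1\<^esup> exp(-a/t - bt) dt = 2 (a/b)\<^bsup>\<nu>/2\<^esup> K\<^sub>\<nu>(2\<surd>(ab))\<close> and \<open>\<Gamma>(m+1,x)\<close> is \<open>e\<^bsup>-x\<^esup>\<close> times a polynomial.
  The substitution \<open>t = e\<^sup>u\<close> makes all integrals run over the real line.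

  Termwise integration needs a growth bound for \<open>c\<^sup>-(n)\<close> and \<open>d\<^sup>-(n)\<close> that is not among the hypotheses.
  It is the bound for the coefficients of the cusp form attached to \<open>f\<close>: by reduction theory and the cusp
  conditions, near every point \<open>f\<close> differs from a holomorphic function by at most \<open>B y\<^bsup>m/2\<^esup>\<close>
  (weight \<open>-m\<close>), and the average of \<open>f\<close> against \<open>e\<^bsup>i\<theta>\<^esup>\<close> over small circles annihilates the holomorphic
  part while its linear term in the radius is the value of that cusp form at the centre.
\<close>

section \<open>Bessel integrals\<close>

text \<open>Near the real line \<open>f\<close> itself admits no useful growth bound: a pole at one
  cusp makes it exponentially large near every equivalent rational. A function holomorphic on the
  half plane can absorb the pole, and it may depend on the point, because the quantity to be
  estimated, the antiholomorphic derivative of \<open>f\<close>, does not see it. In weight -m that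
  derivative is, up to a constant, y^m times the conjugate of a form of weight m + 2, so Hecke's
  argument for cusp forms applies.

  The lower bound on \<open>C\<close> has two tasks. The part with \<open>n\<^sub>0\<close> makes
  every \<open>D n\<close> positive, so that each single integral converges. The other part compares
  growth: the Bessel function in the n-th integral decays like exp(-2 sqrt(2 pi A n / s)), with A =
  C + sX on the side of \<open>f\<close> and A = C on the side of the Fricke image, and this beats
  exp(C_f sqrt n) when C_f^2 < 8 pi A / s. The nonholomorphic coefficients turn out to be bounded,
  so they satisfy the same growth condition.\<close>

definition bessel_kernel :: "real \<Rightarrow> real \<Rightarrow> real \<Rightarrow> real \<Rightarrow> real" where
  "bessel_kernel \<nu> a b u = exp (\<nu> * u - a * exp (- u) - b * exp u)"

lemma bessel_kernel_measurable [measurable]: "bessel_kernel \<nu> a b \<in> borel_measurable borel"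
  unfolding bessel_kernel_def by measurable

lemma bessel_kernel_pos: "bessel_kernel \<nu> a b u > 0"
  by (simp add: bessel_kernel_def)

text \<open>In the variable t = exp u this is t -> 1/t, the action of the Fricke involution on the
  imaginary axis.\<close>

lemma bessel_kernel_reflect: "bessel_kernel \<nu> a b (- u) = bessel_kernel (- \<nu>) b a u"
  by (simp add: bessel_kernel_def)

lemma integrable_exp_minus_abs: "integrable lborel (\<lambda>u::real. exp (- \<bar>u\<bar>))"
proof -
  define g where "g = (\<lambda>u::real. indicator {0..} u *\<^sub>R exp (- 1 * u))"
  have "(\<lambda>u::real. exp (- 1 * u)) integrable_on {0..}"
    by (rule integrable_on_exp_minus_to_infinity) simp
  then have "set_integrable lebesgue {0..} (\<lambda>u::real. exp (- 1 * u))"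
    by (rule nonnegative_absolutely_integrable_1) auto
  then have "integrable lebesgue g"
    by (simp add: set_integrable_def g_def)
  then have g: "integrable lborel g"
    by (subst (asm) integrable_completion) (auto simp: g_def)
  have g': "integrable lborel (\<lambda>u. g (0 + (-1) * u))"
    by (rule lborel_integrable_real_affine[OF g]) simp
  show ?thesis
    by (rule Bochner_Integration.integrable_bound[OF Bochner_Integration.integrable_add[OF g g']])
       (auto simp: g_def indicator_def)
qed

text \<open>One of the two exponentials is always at least \<open>c * exp \<bar>u\<bar>\<close>,
  hence at least c u^2 / 2. Completing the square against (|\<nu>| + 1) |u| leaves the constant
  \<open>K\<close>, and the spare |u| gives an integrable majorant.\<close>

lemma integrable_bessel_kernel:
  assumes "a > 0" "b > 0"
  shows "integrable lborel (bessel_kernel \<nu> a b)"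
proof -
  define c where "c = min a b"
  have c: "c > 0" "c \<le> a" "c \<le> b" using assms by (auto simp: c_def)
  define K where "K = (\<bar>\<nu>\<bar> + 1)\<^sup>2 / (2 * c)"
  have bound: "bessel_kernel \<nu> a b u \<le> exp K * exp (- \<bar>u\<bar>)" for u
  proof -
    have "c * (\<bar>u\<bar>\<^sup>2 / 2) \<le> c * exp \<bar>u\<bar>"
      using exp_lower_Taylor_quadratic[of "\<bar>u\<bar>"] c by (intro mult_left_mono; linarith)
    also have "c * exp \<bar>u\<bar> \<le> a * exp (- u) + b * exp u"
    proof (cases "u \<ge> 0")
      case True
      have "c * exp u \<le> b * exp u" using c(3) by (intro mult_right_mono) auto
      moreover have "0 \<le> a * exp (-u)" using assms by simp
      ultimately show ?thesis using True by (simp only: abs_of_nonneg)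
    next
      case False
      have "c * exp (-u) \<le> a * exp (-u)" using c(2) by (intro mult_right_mono) auto
      moreover have "0 \<le> b * exp u" using assms by simp
      ultimately show ?thesis using False by (simp only: abs_of_neg not_le)
    qed
    finally have 1: "c * (\<bar>u\<bar>\<^sup>2 / 2) \<le> a * exp (- u) + b * exp u" .
    have "0 \<le> (c * \<bar>u\<bar> - (\<bar>\<nu>\<bar> + 1))\<^sup>2 / (2 * c)" using c by simp
    also have "\<dots> = c * (\<bar>u\<bar>\<^sup>2 / 2) - (\<bar>\<nu>\<bar> + 1) * \<bar>u\<bar> + K"
      using c by (simp add: K_def power2_eq_square field_simps)
    finally have 2: "(\<bar>\<nu>\<bar> + 1) * \<bar>u\<bar> \<le> c * (\<bar>u\<bar>\<^sup>2 / 2) + K" by simp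
    have "\<nu> * u \<le> \<bar>\<nu>\<bar> * \<bar>u\<bar>" by (metis abs_ge_self abs_mult)
    with 1 2 have "\<nu> * u - a * exp (- u) - b * exp u \<le> K - \<bar>u\<bar>"
      by (simp add: algebra_simps)
    then show ?thesis by (simp add: bessel_kernel_def flip: exp_add)
  qed
  show ?thesis
    by (rule Bochner_Integration.integrable_bound[OF integrable_mult_right[OF integrable_exp_minus_abs, of "exp K"]])
       (use bound in \<open>auto intro!: AE_I2 simp: less_imp_le[OF bessel_kernel_pos]\<close>)
qed

lemma lborel_integral_reflect:
  fixes f :: "real \<Rightarrow> 'a :: {banach, second_countable_topology}"
  shows "(\<integral>u. f (- u) \<partial>lborel) = (\<integral>u. f u \<partial>lborel)"
  using lborel_integral_real_affine[of "-1" f 0] by simp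

lemma integral_even:
  fixes h :: "real \<Rightarrow> real"
  assumes h: "integrable lborel h" and even: "\<And>u. h (- u) = h u"
  shows "(\<integral>u. h u \<partial>lborel) = 2 * integral {0..} h"
proof -
  have sets: "set_integrable lborel A h" if "A \<in> sets lborel" for A
    unfolding set_integrable_def using integrable_mult_indicator[OF that h] .
  have "(\<integral>u. h u \<partial>lborel) = (\<integral>u. indicator {0..} u *\<^sub>R h u + indicator {..<0} u *\<^sub>R h u \<partial>lborel)"
    by (rule Bochner_Integration.integral_cong) (auto simp: indicator_def)
  also have "\<dots> = (\<integral>u. indicator {0..} u *\<^sub>R h u \<partial>lborel) + (\<integral>u. indicator {..<0} u *\<^sub>R h u \<partial>lborel)"
    using sets[of "{0..}"] sets[of "{..<0}"] unfolding set_integrable_def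
    by (intro Bochner_Integration.integral_add) auto
  also have "(\<integral>u. indicator {..<0} u *\<^sub>R h u \<partial>lborel) = (\<integral>u. indicator {0<..} u *\<^sub>R h u \<partial>lborel)"
    using even by (subst lborel_integral_reflect[symmetric])
                  (auto intro!: Bochner_Integration.integral_cong simp: indicator_def)
  also have "\<dots> = (\<integral>u. indicator {0..} u *\<^sub>R h u \<partial>lborel)"
  proof (rule integral_cong_AE)
    have "AE u in lborel. u \<noteq> (0::real)" by (rule AE_lborel_singleton)
    then show "AE u in lborel. indicator {0<..} u *\<^sub>R h u = indicator {0..} u *\<^sub>R h u"
      by eventually_elim (auto simp: indicator_def)
  qed (use borel_measurable_integrable[OF h] in measurable)
  also have "(\<integral>u. indicator {0..} u *\<^sub>R h u \<partial>lborel) = integral {0..} h"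
    using set_borel_integral_eq_integral(2)[OF sets[of "{0..}"]]
    by (simp add: set_lebesgue_integral_def)
  finally show ?thesis by simp
qed

lemma bessel_kernel_cosh:
  fixes x u \<nu> :: real
  shows "exp (- x * cosh u) * cosh (\<nu> * u) = (bessel_kernel \<nu> (x/2) (x/2) u + bessel_kernel \<nu> (x/2) (x/2) (- u)) / 2"
proof -
  have e: "x * cosh u = x / 2 * exp (- u) + x / 2 * exp u"
    by (simp add: cosh_def field_simps)
  have "bessel_kernel \<nu> (x/2) (x/2) u = exp (- x * cosh u) * exp (\<nu> * u)"
    "bessel_kernel \<nu> (x/2) (x/2) (- u) = exp (- x * cosh u) * exp (- (\<nu> * u))"
    by (simp_all add: bessel_kernel_def e algebra_simps flip: exp_add)
  then show ?thesis by (simp add: cosh_def[of "\<nu> * u"] algebra_simps)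
qed

lemma integrable_bessel_K_integrand:
  fixes x \<nu> :: real
  assumes "x > 0"
  shows "integrable lborel (\<lambda>u. exp (- x * cosh u) * cosh (\<nu> * u))"
proof -
  have "integrable lborel (bessel_kernel \<nu> (x/2) (x/2))" "integrable lborel (\<lambda>u. bessel_kernel \<nu> (x/2) (x/2) (- u))"
    using assms by (auto intro!: integrable_bessel_kernel simp: bessel_kernel_reflect)
  then show ?thesis unfolding bessel_kernel_cosh by auto
qed

lemma bessel_K_integrable_on:
  fixes x \<nu> :: real
  assumes "x > 0"
  shows "(\<lambda>u. exp (- x * cosh u) * cosh (\<nu> * u)) integrable_on {0..}"
proof -
  have "set_integrable lborel {0..} (\<lambda>u. exp (- x * cosh u) * cosh (\<nu> * u))"
    unfolding set_integrable_def
    by (rule integrable_mult_indicator[OF _ integrable_bessel_K_integrand[OF assms]]) simp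
  then show ?thesis by (rule set_borel_integral_eq_integral(1))
qed

text \<open>The translation by \<open>c\<close> balances the kernel: both exponentials get the
  coefficient \<open>x / 2\<close>, and the factor \<open>exp (\<nu> * c)\<close> is the power of
  \<open>a / b\<close>. The balanced integral may be symmetrized in u, which produces the cosh in
  \<open>bessel_K\<close>.\<close>

lemma integral_bessel_kernel:
  assumes "a > 0" "b > 0"
  shows "(\<integral>u. bessel_kernel \<nu> a b u \<partial>lborel) = 2 * (a / b) powr (\<nu> / 2) * bessel_K \<nu> (2 * sqrt (a * b))"
proof -
  define c where "c = ln (a / b) / 2"
  define x where "x = 2 * sqrt (a * b)"
  have x: "x > 0" using assms by (simp add: x_def)
  have ec: "exp c = sqrt (a / b)"
  proof -
    have "exp c = (a / b) powr (1/2)" using assms by (simp add: c_def powr_def)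
    then show ?thesis using assms by (simp add: powr_half_sqrt)
  qed
  have a: "a * exp (- c) = x / 2" "b * exp c = x / 2"
    using assms by (auto simp: exp_minus ec x_def real_sqrt_divide real_sqrt_mult field_simps)
  have shift: "bessel_kernel \<nu> a b (c + 1 * u) = exp (\<nu> * c) * bessel_kernel \<nu> (x/2) (x/2) u" for u
  proof -
    have "a * exp (- (c + u)) = a * exp (- c) * exp (- u)" "b * exp (c + u) = b * exp c * exp u"
      by (simp_all add: exp_add exp_diff exp_minus field_simps)
    note this[unfolded a]
    then show ?thesis by (simp add: bessel_kernel_def distrib_left flip: exp_add)
  qed
  have int: "integrable lborel (bessel_kernel \<nu> (x/2) (x/2))" 
            "integrable lborel (\<lambda>u. bessel_kernel \<nu> (x/2) (x/2) (- u))"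
    using x by (auto intro!: integrable_bessel_kernel simp: bessel_kernel_reflect)
  have "(\<integral>u. bessel_kernel \<nu> a b u \<partial>lborel) = exp (\<nu> * c) * (\<integral>u. bessel_kernel \<nu> (x/2) (x/2) u \<partial>lborel)"
    by (subst lborel_integral_real_affine[of 1 _ c]) (auto simp: shift[simplified])
  also have "(\<integral>u. bessel_kernel \<nu> (x/2) (x/2) u \<partial>lborel) =
      (\<integral>u. exp (- x * cosh u) * cosh (\<nu> * u) \<partial>lborel)"
    unfolding bessel_kernel_cosh using int lborel_integral_reflect[of "bessel_kernel \<nu> (x/2) (x/2)"] by simp
  also have "\<dots> = 2 * bessel_K \<nu> x"
    unfolding bessel_K_def by (rule integral_even[OF integrable_bessel_K_integrand[OF x]]) simp
  also have "exp (\<nu> * c) = (a / b) powr (\<nu> / 2)"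
    using assms by (simp add: c_def powr_def)
  finally show ?thesis by (simp add: x_def)
qed

lemma bessel_K_nonneg: "x > 0 \<Longrightarrow> bessel_K \<nu> x \<ge> 0"
  unfolding bessel_K_def by (intro Henstock_Kurzweil_Integration.integral_nonneg bessel_K_integrable_on) auto

text \<open>Since cosh t is at least 1, replacing \<open>x0\<close> by \<open>x\<close> gains at
  least the factor \<open>exp (x0 - x)\<close> under the integral. This rate, uniform for x \<ge>
  x0, decides the convergence of all series of Bessel functions below.\<close>

lemma bessel_K_le:
  assumes "0 < x0" "x0 \<le> x"
  shows "bessel_K \<nu> x \<le> exp x0 * bessel_K \<nu> x0 * exp (- x)"
proof -
  have le: "exp (- x * cosh t) * cosh (\<nu> * t) \<le> exp (x0 - x) * (exp (- x0 * cosh t) * cosh (\<nu> * t))" for t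
  proof -
    have "0 \<le> (x - x0) * (cosh t - 1)"
      using assms cosh_real_ge_1[of t] by simp
    then have "- x * cosh t \<le> (x0 - x) + - x0 * cosh t" by (simp add: algebra_simps)
    then have "exp (- x * cosh t) \<le> exp (x0 - x) * exp (- x0 * cosh t)" by (simp flip: exp_add)
    from mult_right_mono[OF this, of "cosh (\<nu> * t)"] show ?thesis by (simp add: mult.assoc)
  qed
  have "bessel_K \<nu> x \<le> integral {0..} (\<lambda>t. exp (x0 - x) * (exp (- x0 * cosh t) * cosh (\<nu> * t)))"
    unfolding bessel_K_def
    by (rule integral_le, rule bessel_K_integrable_on, use assms in simp,
        rule integrable_on_mult_right, rule bessel_K_integrable_on, use assms le in auto)
  also have "\<dots> = exp (x0 - x) * bessel_K \<nu> x0"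
    unfolding bessel_K_def by simp
  finally show ?thesis by (simp add: exp_diff exp_minus field_simps)
qed

section \<open>Series, Fourier coefficients and the incomplete gamma function\<close>

lemma bij_betw_int_atLeast: "bij_betw (\<lambda>n. c + int n) UNIV {c..}"
  by (rule bij_betw_byWitness[where f' = "\<lambda>i. nat (i - c)"]) auto

lemma summable_on_int_atLeast_iff:
  fixes a :: "int \<Rightarrow> complex"
  shows "a summable_on {c..} \<longleftrightarrow> summable (\<lambda>n. norm (a (c + int n)))"
proof -
  have "a summable_on {c..} \<longleftrightarrow> (\<lambda>n. a (c + int n)) summable_on UNIV"
    using summable_on_reindex_bij_betw[OF bij_betw_int_atLeast, of a c] by simp
  also have "\<dots> \<longleftrightarrow> (\<lambda>n. norm (a (c + int n))) summable_on UNIV"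
    by (rule summable_on_iff_abs_summable_on_complex)
  also have "\<dots> \<longleftrightarrow> summable (\<lambda>n. norm (a (c + int n)))"
    by (rule summable_on_UNIV_nonneg_real_iff) auto
  finally show ?thesis .
qed

lemma infsum_int_atLeast:
  fixes a :: "int \<Rightarrow> complex"
  assumes "summable (\<lambda>n. norm (a (c + int n)))"
  shows "(\<Sum>\<^sub>\<infinity>i\<in>{c..}. a i) = (\<Sum>n. a (c + int n))"
proof -
  have "((\<lambda>n. a (c + int n)) has_sum (\<Sum>n. a (c + int n))) UNIV"
    by (rule norm_summable_imp_has_sum[OF assms summable_sums[OF summable_norm_cancel[OF assms]]])
  then show ?thesis
    using infsum_reindex_bij_betw[OF bij_betw_int_atLeast, of a c] by (simp add: infsumI)
qed

text \<open>For real nonnegative \<open>\<phi> j\<close> the L1 norms are the integrals themselves,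
  so the Fubini condition becomes a condition on the integrals that will be evaluated
  anyway.\<close>

lemma integral_suminf_mult:
  fixes a :: "nat \<Rightarrow> complex" and \<phi> :: "nat \<Rightarrow> real \<Rightarrow> real"
  assumes int: "\<And>j. integrable lborel (\<phi> j)" and nonneg: "\<And>j u. \<phi> j u \<ge> 0"
    and pw: "\<And>u. summable (\<lambda>j. norm (a j) * \<phi> j u)"
    and sums: "summable (\<lambda>j. norm (a j) * (\<integral>u. \<phi> j u \<partial>lborel))"
  shows "integrable lborel (\<lambda>u. \<Sum>j. a j * of_real (\<phi> j u))"
    and "(\<integral>u. (\<Sum>j. a j * of_real (\<phi> j u)) \<partial>lborel) = (\<Sum>j. a j * of_real (\<integral>u. \<phi> j u \<partial>lborel))"
proof -
  have i: "integrable lborel (\<lambda>u. a j * of_real (\<phi> j u))" for j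
    using int[of j] by auto
  have p: "AE u in lborel. summable (\<lambda>j. norm (a j * of_real (\<phi> j u)))"
    using pw nonneg by (simp add: norm_mult)
  have s: "summable (\<lambda>j. \<integral>u. norm (a j * of_real (\<phi> j u)) \<partial>lborel)"
    using sums nonneg int by (simp add: norm_mult)
  show "integrable lborel (\<lambda>u. \<Sum>j. a j * of_real (\<phi> j u))"
    by (rule integrable_suminf[OF i p s])
  show "(\<integral>u. (\<Sum>j. a j * of_real (\<phi> j u)) \<partial>lborel) = (\<Sum>j. a j * of_real (\<integral>u. \<phi> j u \<partial>lborel))"
    using integral_suminf[OF i p s] int by simp
qed

section \<open>Fourier coefficients of absolutely convergent trigonometric series\<close>

definition cis2pi :: "int \<Rightarrow> real \<Rightarrow> complex" where
  "cis2pi k x = exp (2 * of_real pi * \<i> * of_int k * of_real x)"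

lemma norm_cis2pi [simp]: "norm (cis2pi k x) = 1"
  by (simp add: cis2pi_def)

lemma cis2pi_add: "cis2pi (j + k) x = cis2pi j x * cis2pi k x"
  by (simp add: cis2pi_def algebra_simps exp_add)

lemma continuous_on_cis2pi [continuous_intros]: "continuous_on A (cis2pi k)"
  unfolding cis2pi_def by (intro continuous_intros)

lemma cis2pi_measurable [measurable]: "cis2pi k \<in> borel_measurable borel"
  by (intro borel_measurable_continuous_onI continuous_intros)

lemma integral_cis2pi:
  "(\<integral>x. indicator {0..1} x *\<^sub>R cis2pi k x \<partial>lborel) = (if k = 0 then 1 else 0)"
proof (cases "k = 0")
  case True
  then show ?thesis by (simp add: cis2pi_def)
next
  case False
  let ?c = "2 * of_real pi * \<i> * of_int k :: complex"
  have c: "?c \<noteq> 0" using False by simp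
  have "(\<integral>x. indicator {0..1} x *\<^sub>R cis2pi k x \<partial>lborel) = cis2pi k 1 / ?c - cis2pi k 0 / ?c"
  proof (rule integral_FTC_atLeastAtMost)
    fix x :: real
    have "((\<lambda>x. exp (?c * of_real x) / ?c) has_vector_derivative exp (?c * of_real x) * ?c / ?c) (at x within {0..1})"
      by (rule derivative_eq_intros has_vector_derivative_real_field refl | simp)+
    then show "((\<lambda>x. cis2pi k x / ?c) has_vector_derivative cis2pi k x) (at x within {0..1})"
      using c by (simp add: cis2pi_def)
  qed (auto intro: continuous_intros)
  also have "cis2pi k 1 = 1"
    by (simp add: cis2pi_def exp_eq_1)
  finally show ?thesis using False by (simp add: cis2pi_def)
qed

definition fourier_coeff :: "int \<Rightarrow> (real \<Rightarrow> complex) \<Rightarrow> complex" where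
  "fourier_coeff k h = (\<integral>x. indicator {0..1} x *\<^sub>R (h x * cis2pi (- k) x) \<partial>lborel)"

text \<open>Orthogonality may be applied termwise because the norms of the terms are constant on the
  period and summable. The frequencies may repeat, so the value remains a series;
  \<open>suminf_if_inj\<close> collapses it when they are distinct.\<close>

lemma fourier_coeff_suminf:
  fixes a :: "nat \<Rightarrow> complex" and \<omega> :: "nat \<Rightarrow> int"
  assumes "summable (\<lambda>n. norm (a n))"
  shows "integrable lborel (\<lambda>x. indicator {0..1} x *\<^sub>R ((\<Sum>n. a n * cis2pi (\<omega> n) x) * cis2pi (- k) x))"
    and "fourier_coeff k (\<lambda>x. \<Sum>n. a n * cis2pi (\<omega> n) x) = (\<Sum>n. if \<omega> n = k then a n else 0)"
proof -
  let ?f = "\<lambda>n x. indicator {0..1} x *\<^sub>R (a n * cis2pi (\<omega> n - k) x)"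
  have i: "integrable lborel (?f n)" for n
    using borel_integrable_atLeastAtMost'[of 0 1 "\<lambda>x. a n * cis2pi (\<omega> n - k) x"]
    by (simp add: set_integrable_def continuous_intros)
  have nrm: "norm (?f n x) = indicator {0..1} x * norm (a n)" for n x
    by (simp add: norm_mult)
  have p: "AE x in lborel. summable (\<lambda>n. norm (?f n x))"
    unfolding nrm using assms by (intro AE_I2 summable_mult)
  have s: "summable (\<lambda>n. \<integral>x. norm (?f n x) \<partial>lborel)"
    unfolding nrm using assms by simp
  have eq: "indicator {0..1} x *\<^sub>R ((\<Sum>n. a n * cis2pi (\<omega> n) x) * cis2pi (- k) x) = (\<Sum>n. ?f n x)" for x
  proof -
    have "summable (\<lambda>n. norm (a n * cis2pi (\<omega> n) x))" using assms by (simp add: norm_mult)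
    then have "summable (\<lambda>n. a n * cis2pi (\<omega> n) x)" by (rule summable_norm_cancel)
    from suminf_mult2[OF this, of "cis2pi (- k) x"]
    show ?thesis by (simp add: indicator_def cis2pi_add[of _ "- k", simplified] mult.assoc)
  qed
  show "integrable lborel (\<lambda>x. indicator {0..1} x *\<^sub>R ((\<Sum>n. a n * cis2pi (\<omega> n) x) * cis2pi (- k) x))"
    unfolding eq by (rule integrable_suminf[OF i p s])
  have sum_eq: "fourier_coeff k (\<lambda>x. \<Sum>n. a n * cis2pi (\<omega> n) x) = (\<Sum>n. \<integral>x. ?f n x \<partial>lborel)"
    unfolding fourier_coeff_def eq by (rule integral_suminf[OF i p s])
  have "(\<integral>x. ?f n x \<partial>lborel) = (if \<omega> n = k then a n else 0)" for n
  proof -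
    have "(\<integral>x. ?f n x \<partial>lborel) = (\<integral>x. a n * (indicator {0..1} x *\<^sub>R cis2pi (\<omega> n - k) x) \<partial>lborel)"
      by (intro Bochner_Integration.integral_cong) auto
    also have "\<dots> = a n * (if \<omega> n - k = 0 then 1 else 0)"
      by (simp only: integral_mult_right_zero integral_cis2pi)
    finally show ?thesis by simp
  qed
  with sum_eq show "fourier_coeff k (\<lambda>x. \<Sum>n. a n * cis2pi (\<omega> n) x) = (\<Sum>n. if \<omega> n = k then a n else 0)"
    by simp
qed

lemma suminf_if_inj:
  fixes a :: "nat \<Rightarrow> complex"
  assumes "inj \<omega>"
  shows "(\<Sum>n. if \<omega> n = \<omega> m then a n else 0) = a m"
proof -
  have "(\<Sum>n. if \<omega> n = \<omega> m then a n else 0) = (\<Sum>n. if n = m then a n else 0)"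
    using assms by (intro arg_cong[where f = suminf] ext) (auto dest: injD)
  also have "\<dots> = a m"
    using sums_single[of m a] by (rule sums_unique[symmetric])
  finally show ?thesis .
qed

lemma norm_fourier_coeff_le:
  assumes "\<And>x. norm (h x) \<le> B"
  shows "norm (fourier_coeff k h) \<le> B"
proof -
  have B: "B \<ge> 0" using assms[of 0] norm_ge_zero order_trans by blast
  have "norm (fourier_coeff k h) \<le> (\<integral>x. norm (indicator {0..1} x *\<^sub>R (h x * cis2pi (- k) x)) \<partial>lborel)"
    unfolding fourier_coeff_def by (rule integral_norm_bound)
  also have "\<dots> \<le> (\<integral>x. indicator {0..1} x *\<^sub>R B \<partial>(lborel::real measure))"
  proof (rule integral_mono_AE')
    show "integrable lborel (\<lambda>x::real. indicator {0..1} x *\<^sub>R B)" by simp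
  qed (use assms B in \<open>auto simp: norm_mult indicator_def\<close>)
  finally show ?thesis by simp
qed

section \<open>The incomplete gamma function: convergence, strict monotonicity, closed form at
  positive integers\<close>

lemma inc_Gamma_integrand_integrable:
  fixes s x :: real
  assumes "x > 0"
  shows "(\<lambda>t. t powr (s - 1) * exp (- t)) integrable_on {x..}"
proof -
  \<comment> \<open>Half of the exponential decay is spent on the power of t, leaving the integrable
    majorant \<open>M * exp (- (1/2) * t)\<close>. Below \<open>T\<close> the constant comes from
    compactness, which needs x > 0.\<close>
  have "((\<lambda>t::real. t powr (s - 1) * exp (- t / 2)) \<longlongrightarrow> 0) at_top" by real_asymp
  then have "eventually (\<lambda>t::real. t powr (s - 1) * exp (- t / 2) < 1) at_top"
    by (rule order_tendstoD) simp
  then obtain T where T: "\<And>t. t \<ge> T \<Longrightarrow> t powr (s - 1) * exp (- t / 2) < 1"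
    by (auto simp: eventually_at_top_linorder)
  have "compact ((\<lambda>t. t powr (s - 1) * exp (- t / 2)) ` {x..T})"
    using assms by (intro compact_continuous_image continuous_intros) auto
  then have "bounded ((\<lambda>t. t powr (s - 1) * exp (- t / 2)) ` {x..T})" by (rule compact_imp_bounded)
  then obtain M0 where M0: "\<And>t. t \<in> {x..T} \<Longrightarrow> norm (t powr (s - 1) * exp (- t / 2)) \<le> M0"
    unfolding bounded_iff by blast
  define M where "M = max M0 1"
  have M: "t powr (s - 1) * exp (- t / 2) \<le> M" if "t \<ge> x" for t
    using T[of t] M0[of t] that by (cases "t \<ge> T") (auto simp: M_def)
  have bound: "t powr (s - 1) * exp (- t) \<le> M * exp (- (1/2) * t)" if "t \<ge> x" for t
  proof -
    have "t powr (s - 1) * exp (- t / 2) * exp (- (1/2) * t) \<le> M * exp (- (1/2) * t)"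
      using M[OF that] by (intro mult_right_mono) auto
    moreover have "exp (- t / 2) * exp (- (1/2) * t) = exp (- t)" by (simp flip: exp_add)
    ultimately show ?thesis by (simp only: mult.assoc)
  qed
  have "(\<lambda>t. exp (- (1/2) * t)) integrable_on {x..}"
    by (rule integrable_on_exp_minus_to_infinity) simp
  from integrable_on_mult_right[OF this, of M]
  have g: "(\<lambda>t. M * exp (- (1/2) * t)) integrable_on {x..}" by simp
  show ?thesis
  proof (rule measurable_bounded_by_integrable_imp_integrable[OF _ g])
    show "(\<lambda>t. t powr (s - 1) * exp (- t)) \<in> borel_measurable (lebesgue_on {x..})"
      using assms by (intro continuous_imp_measurable_on_sets_lebesgue continuous_intros) auto
  qed (use bound in auto)
qed

text \<open>What matters later is that the function separates two heights: it distinguishes a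
  Fourier coefficient with an incomplete gamma factor from one that is constant in y.\<close>

lemma inc_Gamma_strict_antimono:
  assumes "0 < x" "x < y"
  shows "inc_Gamma s y < inc_Gamma s x"
proof -
  let ?f = "\<lambda>t. t powr (s - 1) * exp (- t)"
  have cont: "continuous_on {x..y} ?f" using assms by (intro continuous_intros) auto
  have "(?f has_integral inc_Gamma s y) {y..}"
    using inc_Gamma_integrand_integrable[of y s] assms by (simp add: inc_Gamma_def integrable_integral)
  moreover have "(?f has_integral integral {x..y} ?f) {x..y}"
    using integrable_continuous_interval[OF cont] by (rule integrable_integral)
  moreover have "negligible ({x..y} \<inter> {y..})"
    by (rule negligible_subset[of "{y}"]) auto
  ultimately have "(?f has_integral (integral {x..y} ?f + inc_Gamma s y)) ({x..y} \<union> {y..})"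
    by (intro has_integral_Un)
  moreover have "{x..y} \<union> {y..} = {x..}" using assms by auto
  ultimately have eq: "inc_Gamma s x = integral {x..y} ?f + inc_Gamma s y"
    unfolding inc_Gamma_def by (auto intro: integral_unique)
  have "integral {x..y} ?f \<noteq> 0"
    using integral_eq_0_iff[OF cont] assms by (auto intro!: bexI[of _ x])
  moreover have "integral {x..y} ?f \<ge> 0"
    by (rule Henstock_Kurzweil_Integration.integral_nonneg) (use integrable_continuous_interval[OF cont] in auto)
  ultimately show ?thesis using eq by linarith
qed

text \<open>The derivative of t^l / l! cancels the contribution of the term l - 1, so only the top
  term survives.\<close>

lemma DERIV_exp_partial_sum:
  "((\<lambda>t::real. exp (- t) * (\<Sum>l\<le>m. t ^ l / fact l)) has_real_derivative (- (t ^ m / fact m * exp (- t)))) (at t)"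
proof (induction m)
  case 0
  show ?case by (auto intro!: derivative_eq_intros)
next
  case (Suc m)
  have e: "((\<lambda>t::real. exp (- t)) has_real_derivative - exp (- t)) (at t)"
    by (auto intro!: derivative_eq_intros)
  have "((\<lambda>t::real. t ^ Suc m / fact (Suc m)) has_real_derivative
      (real (Suc m) * t ^ m / fact (Suc m))) (at t)"
    using DERIV_cdivide[OF DERIV_pow[of "Suc m" t UNIV], of "fact (Suc m)"] by (simp only: diff_Suc_Suc diff_zero)
  also have "real (Suc m) * t ^ m / fact (Suc m) = t ^ m / fact m"
    by (simp del: of_nat_Suc)
  finally have "((\<lambda>t::real. exp (- t) * (t ^ Suc m / fact (Suc m))) has_real_derivative
      (- exp (- t) * (t ^ Suc m / fact (Suc m)) + t ^ m / fact m * exp (- t))) (at t)"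
    by (rule DERIV_mult[OF e])
  from DERIV_add[OF Suc this] show ?case by (simp add: distrib_left mult.commute[of "exp (- t)" "t ^ Suc m"] del: power_Suc fact_Suc)
qed

lemma inc_Gamma_Suc:
  assumes "x > 0"
  shows "inc_Gamma (real m + 1) x = fact m * (exp (- x) * (\<Sum>l\<le>m. x ^ l / fact l))"
proof -
  let ?f = "\<lambda>t::real. t powr (real m + 1 - 1) * exp (- t)"
  \<comment> \<open>The antiderivative normalized to vanish at infinity, so that the integral over
    \<open>{x..}\<close> is \<open>0 - ?F x\<close>.\<close>
  let ?F = "\<lambda>t::real. - fact m * (exp (- t) * (\<Sum>l\<le>m. t ^ l / fact l))"
  have "(?f has_integral inc_Gamma (real m + 1) x) {x..}"
    using inc_Gamma_integrand_integrable[OF assms] unfolding inc_Gamma_def by (rule integrable_integral)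
  then have "(\<integral>\<^sup>+t. ennreal (?f t) * indicator {x..} t \<partial>lborel) = ennreal (inc_Gamma (real m + 1) x)"
    by (intro nn_integral_has_integral_lebesgue') auto
  moreover have "(\<integral>\<^sup>+t. ennreal (?f t) * indicator {x..} t \<partial>lborel) = ennreal (0 - ?F x)"
  proof (rule nn_integral_FTC_atLeast)
    fix t assume "x \<le> t"
    then have "t powr (real m + 1 - 1) = t ^ m" using assms by (simp add: powr_realpow)
    moreover have "(?F has_real_derivative - fact m * (- (t ^ m / fact m * exp (- t)))) (at t)"
      by (intro DERIV_cmult DERIV_exp_partial_sum)
    ultimately show "(?F has_real_derivative ?f t) (at t)" by simp
  next
    have "((\<lambda>t::real. t ^ l / exp t) \<longlongrightarrow> 0) at_top" for l
      by (rule tendsto_power_div_exp_0)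
    then have "((\<lambda>t::real. - fact m * (\<Sum>l\<le>m. t ^ l / exp t / fact l)) \<longlongrightarrow> - fact m * (\<Sum>l\<le>m. 0 / fact l)) at_top"
      by (intro tendsto_intros) auto
    moreover have "exp (- t) * (\<Sum>l\<le>m. t ^ l / fact l) = (\<Sum>l\<le>m. t ^ l / exp t / fact l)" for t :: real
      unfolding sum_distrib_left by (intro sum.cong refl) (simp add: exp_minus divide_inverse mult_ac)
    ultimately show "(?F \<longlongrightarrow> 0) at_top" by simp
  qed auto
  moreover have "inc_Gamma (real m + 1) x \<ge> 0"
    unfolding inc_Gamma_def
    by (rule Henstock_Kurzweil_Integration.integral_nonneg) (use inc_Gamma_integrand_integrable[OF assms, of "real m + 1"] in auto)
  moreover have "0 - ?F x \<ge> 0" using assms by (simp add: sum_nonneg)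
  ultimately show ?thesis by (simp add: ennreal_inj)
qed

section \<open>Circle averages\<close>

text \<open>On the circle \<open>A\<close> has only frequencies n \<ge> 0 and its conjugate only
  frequencies n \<le> 0. Multiplication by (z - z0)^j shifts the latter by j, so frequency -1 picks
  out the Taylor coefficient of order j + 1, and the radius enters as r^j times r^(j+1).\<close>

lemma fourier_coeff_powser_circle:
  assumes hol: "A holomorphic_on ball z0 R" and r: "0 < r" "r < R"
  shows "integrable lborel (\<lambda>x. indicator {0..1} x *\<^sub>R (A (z0 + of_real r * cis2pi 1 x) * cis2pi (- k) x))"
    and "k < 0 \<Longrightarrow> fourier_coeff k (\<lambda>x. A (z0 + of_real r * cis2pi 1 x)) = 0"
    and "integrable lborel (\<lambda>x. indicator {0..1} x *\<^sub>R
           ((of_real r * cis2pi 1 x) ^ j * cnj (A (z0 + of_real r * cis2pi 1 x)) * cis2pi (- k) x))"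
    and "fourier_coeff (-1) (\<lambda>x. (of_real r * cis2pi 1 x) ^ j * cnj (A (z0 + of_real r * cis2pi 1 x))) =
           cnj ((deriv ^^ (j + 1)) A z0 / fact (j + 1)) * of_real r ^ (2 * j + 1)"
proof -
  define a where "a n = (deriv ^^ n) A z0 / fact n" for n
  have powser: "(\<lambda>n. a n * (w - z0) ^ n) sums A w" if "w \<in> ball z0 R" for w
    using holomorphic_power_series[OF hol that] by (simp add: a_def)
  \<comment> \<open>Convergence at a radius strictly beyond \<open>r\<close> yields absolute
    convergence at \<open>r\<close>.\<close>
  define r' where "r' = (r + R) / 2"
  have r': "r < r'" "r' < R" "0 < r'" using r by (auto simp: r'_def)
  have "summable (\<lambda>n. a n * of_real r' ^ n)"
    using powser[of "z0 + of_real r'"] r' by (auto simp: dist_norm sums_iff)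
  then have abs: "summable (\<lambda>n. norm (a n * of_real r ^ n))"
    by (rule powser_insidea) (use r r' in auto)
  have pow: "cis2pi 1 x ^ n = cis2pi (int n) x" for x n
    by (induction n) (auto simp: cis2pi_add[symmetric] cis2pi_def[of 0] algebra_simps)
  have cnj_e: "cnj (cis2pi n x) = cis2pi (- n) x" for n x
    by (simp add: cis2pi_def exp_cnj)
  have A: "(\<lambda>n. a n * of_real r ^ n * cis2pi (int n) x) sums A (z0 + of_real r * cis2pi 1 x)" for x
  proof -
    have "norm (of_real r * cis2pi 1 x) < R" using r by (simp add: norm_mult)
    then show ?thesis
      using powser[of "z0 + of_real r * cis2pi 1 x"] by (simp add: dist_norm power_mult_distrib pow mult.assoc)
  qed
  have A': "A (z0 + of_real r * cis2pi 1 x) = (\<Sum>n. a n * of_real r ^ n * cis2pi (int n) x)" for x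
    using A[of x] by (simp add: sums_iff)
  show "integrable lborel (\<lambda>x. indicator {0..1} x *\<^sub>R (A (z0 + of_real r * cis2pi 1 x) * cis2pi (- k) x))"
    unfolding A' by (rule fourier_coeff_suminf(1)[OF abs])
  show "fourier_coeff k (\<lambda>x. A (z0 + of_real r * cis2pi 1 x)) = 0" if "k < 0"
  proof -
    have "int n \<noteq> k" for n using that by auto
    then show ?thesis unfolding A' by (subst fourier_coeff_suminf(2)[OF abs]) auto
  qed
  define b where "b n = cnj (a n) * of_real r ^ (n + j)" for n
  have B: "(of_real r * cis2pi 1 x) ^ j * cnj (A (z0 + of_real r * cis2pi 1 x)) =
      (\<Sum>n. b n * cis2pi (int j - int n) x)" for x
  proof -
    have "(\<lambda>n. cnj (a n * of_real r ^ n * cis2pi (int n) x)) sums cnj (A (z0 + of_real r * cis2pi 1 x))"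
      using A[of x] by (simp only: sums_cnj)
    from sums_mult[OF this, of "(of_real r * cis2pi 1 x) ^ j"]
    have "(\<lambda>n. (of_real r * cis2pi 1 x) ^ j * cnj (a n * of_real r ^ n * cis2pi (int n) x)) sums
      ((of_real r * cis2pi 1 x) ^ j * cnj (A (z0 + of_real r * cis2pi 1 x)))" .
    also have "(\<lambda>n. (of_real r * cis2pi 1 x) ^ j * cnj (a n * of_real r ^ n * cis2pi (int n) x)) =
       (\<lambda>n. b n * cis2pi (int j - int n) x)"
      using cis2pi_add[of "int j" "- int n" x for n]
      by (intro ext) (simp add: b_def power_mult_distrib pow cnj_e power_add)
    finally show ?thesis by (simp add: sums_iff)
  qed
  have absb: "summable (\<lambda>n. norm (b n))"
    using summable_mult[OF abs, of "r ^ j"] r by (simp add: b_def norm_mult norm_power power_add mult_ac)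
  show "integrable lborel (\<lambda>x. indicator {0..1} x *\<^sub>R
           ((of_real r * cis2pi 1 x) ^ j * cnj (A (z0 + of_real r * cis2pi 1 x)) * cis2pi (- k) x))"
    unfolding B by (rule fourier_coeff_suminf(1)[OF absb])
  have "fourier_coeff (int j - int (j + 1)) (\<lambda>x. \<Sum>n. b n * cis2pi (int j - int n) x) = b (j + 1)"
    unfolding fourier_coeff_suminf(2)[OF absb]
    by (rule suminf_if_inj[where \<omega> = "\<lambda>n. int j - int n"]) (auto simp: inj_def)
  then show "fourier_coeff (-1) (\<lambda>x. (of_real r * cis2pi 1 x) ^ j * cnj (A (z0 + of_real r * cis2pi 1 x))) =
           cnj ((deriv ^^ (j + 1)) A z0 / fact (j + 1)) * of_real r ^ (2 * j + 1)"
    unfolding B by (simp add: b_def a_def mult_2 del: funpow.simps fact_Suc)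
qed

text \<open>On the circle \<open>(z - z0) * cnj (z - z0) = r\<^sup>2\<close>, so a mixed monomial only contributes through the
  difference of its exponents.\<close>
lemma fourier_coeff_circle_sum:
  assumes h: "h holomorphic_on ball z0 R" and A: "\<And>j. j \<le> m \<Longrightarrow> A j holomorphic_on ball z0 R"
    and r: "0 < r" "r < R"
    and F: "\<And>z. z \<in> ball z0 R \<Longrightarrow> F z = h z + (\<Sum>j\<le>m. (z - z0) ^ j * cnj (A j z))"
  shows "fourier_coeff (-1) (\<lambda>x. F (z0 + of_real r * cis2pi 1 x)) =
    (\<Sum>j\<le>m. cnj ((deriv ^^ (j + 1)) (A j) z0 / fact (j + 1)) * of_real r ^ (2 * j + 1))"
proof -
  let ?z = "\<lambda>x. z0 + of_real r * cis2pi 1 x"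
  have Fz: "F (?z x) = h (?z x) + (\<Sum>j\<le>m. (of_real r * cis2pi 1 x) ^ j * cnj (A j (?z x)))" for x
  proof -
    have "?z x \<in> ball z0 R" using r by (simp add: dist_norm norm_mult)
    from F[OF this] show ?thesis by simp
  qed
  have eq: "indicator {0..1} x *\<^sub>R (F (?z x) * cis2pi (- (- 1)) x) =
      indicator {0..1} x *\<^sub>R (h (?z x) * cis2pi (- (- 1)) x) +
      (\<Sum>j\<le>m. indicator {0..1} x *\<^sub>R ((of_real r * cis2pi 1 x) ^ j * cnj (A j (?z x)) * cis2pi (- (- 1)) x))" for x
    unfolding Fz by (simp add: scaleR_sum_right sum_distrib_right distrib_right scaleR_add_right del: minus_minus)
  have "fourier_coeff (-1) (\<lambda>x. F (?z x)) = fourier_coeff (-1) (\<lambda>x. h (?z x)) +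
     (\<Sum>j\<le>m. fourier_coeff (-1) (\<lambda>x. (of_real r * cis2pi 1 x) ^ j * cnj (A j (?z x))))"
    unfolding fourier_coeff_def eq
    by (subst Bochner_Integration.integral_add, rule fourier_coeff_powser_circle(1)[OF h r],
        rule Bochner_Integration.integrable_sum, rule fourier_coeff_powser_circle(3)[OF A r], simp,
        subst Bochner_Integration.integral_sum, rule fourier_coeff_powser_circle(3)[OF A r], simp, rule refl)
  also have "fourier_coeff (-1) (\<lambda>x. h (?z x)) = 0"
    by (rule fourier_coeff_powser_circle(2)[OF h r]) simp
  also have "(\<Sum>j\<le>m. fourier_coeff (-1) (\<lambda>x. (of_real r * cis2pi 1 x) ^ j * cnj (A j (?z x)))) =
     (\<Sum>j\<le>m. cnj ((deriv ^^ (j + 1)) (A j) z0 / fact (j + 1)) * of_real r ^ (2 * j + 1))"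
    by (intro sum.cong refl fourier_coeff_powser_circle(4)[OF A r]) simp
  finally show ?thesis by simp
qed

text \<open>If \<open>p\<close> has degree \<open>2m + 3\<close>, then \<open>p(r) - 2\<^bsup>2m+3\<^esup> p(r/2)\<close> has smaller degree and its linear coefficient
  is at least that of \<open>p\<close> in modulus.\<close>
lemma odd_poly_linear_coeff_bound:
  "\<exists>K\<ge>0. \<forall>(b :: nat \<Rightarrow> complex) R S. R > 0 \<longrightarrow>
     (\<forall>r. 0 < r \<and> r \<le> R \<longrightarrow> norm (\<Sum>j\<le>m. b j * of_real r ^ (2 * j + 1)) \<le> S) \<longrightarrow> norm (b 0) * R \<le> K * S"
proof (induction m)
  case 0
  show ?case
  proof (intro exI[of _ 1] conjI allI impI)
    fix b :: "nat \<Rightarrow> complex" and R S :: real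
    assume "R > 0" and *: "\<forall>r. 0 < r \<and> r \<le> R \<longrightarrow> norm (\<Sum>j\<le>0. b j * of_real r ^ (2 * j + 1)) \<le> S"
    then show "norm (b 0) * R \<le> 1 * S" using *[rule_format, of R] by (simp add: norm_mult)
  qed simp
next
  case (Suc m)
  then obtain K where K: "K \<ge> 0" and IH: "\<And>(b :: nat \<Rightarrow> complex) R S. R > 0 \<Longrightarrow>
     (\<And>r. 0 < r \<Longrightarrow> r \<le> R \<Longrightarrow> norm (\<Sum>j\<le>m. b j * of_real r ^ (2 * j + 1)) \<le> S) \<Longrightarrow> norm (b 0) * R \<le> K * S"
    by blast
  let ?c = "2 ^ (2 * Suc m + 1) :: real"
  show ?case
  proof (intro exI[of _ "K * (1 + ?c)"] conjI allI impI)
    show "K * (1 + ?c) \<ge> 0" using K by simp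
    fix b :: "nat \<Rightarrow> complex" and R S :: real
    assume R: "R > 0" and *: "\<forall>r. 0 < r \<and> r \<le> R \<longrightarrow> norm (\<Sum>j\<le>Suc m. b j * of_real r ^ (2 * j + 1)) \<le> S"
    \<comment> \<open>Coefficients of p(r) - c p(r/2). The factor vanishes at j = Suc m, so the
      induction hypothesis for \<open>m\<close> applies; the new bound S + c S comes from using the
      old one at r and at r / 2.\<close>
    define b' where "b' j = b j * (1 - of_real ?c / 2 ^ (2 * j + 1))" for j
    have "norm (b' 0) * R \<le> K * (S + ?c * S)"
    proof (rule IH[OF R])
      fix r assume r: "0 < r" "r \<le> R"
      have "(\<Sum>j\<le>m. b' j * of_real r ^ (2 * j + 1)) = (\<Sum>j\<le>Suc m. b' j * of_real r ^ (2 * j + 1))"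
        by (simp add: b'_def)
      also have "\<dots> = (\<Sum>j\<le>Suc m. b j * of_real r ^ (2 * j + 1) -
           of_real ?c * (b j * of_real (r / 2) ^ (2 * j + 1)))"
      proof (intro sum.cong refl)
        fix j
        have "(of_real (r / 2) :: complex) ^ (2 * j + 1) = of_real r ^ (2 * j + 1) / 2 ^ (2 * j + 1)"
          by (simp add: power_divide)
        then show "b' j * of_real r ^ (2 * j + 1) = b j * of_real r ^ (2 * j + 1) -
           of_real ?c * (b j * of_real (r / 2) ^ (2 * j + 1))"
          unfolding b'_def by (simp only: algebra_simps times_divide_eq_left times_divide_eq_right mult_1)
      qed
      also have "\<dots> = (\<Sum>j\<le>Suc m. b j * of_real r ^ (2 * j + 1)) -
           of_real ?c * (\<Sum>j\<le>Suc m. b j * of_real (r / 2) ^ (2 * j + 1))"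
        by (simp only: sum_subtractf sum_distrib_left)
      also have "norm \<dots> \<le> norm (\<Sum>j\<le>Suc m. b j * of_real r ^ (2 * j + 1)) +
           norm (of_real ?c * (\<Sum>j\<le>Suc m. b j * of_real (r / 2) ^ (2 * j + 1)))"
        by (rule norm_triangle_ineq4)
      also have "\<dots> \<le> S + ?c * S"
      proof (rule add_mono)
        show "norm (\<Sum>j\<le>Suc m. b j * of_real r ^ (2 * j + 1)) \<le> S" using *[rule_format, of r] r by blast
        have "norm (\<Sum>j\<le>Suc m. b j * of_real (r / 2) ^ (2 * j + 1)) \<le> S"
          using *[rule_format, of "r / 2"] r by simp
        then have "?c * norm (\<Sum>j\<le>Suc m. b j * of_real (r / 2) ^ (2 * j + 1)) \<le> ?c * S"
          by (intro mult_left_mono) auto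
        moreover have "\<bar>?c\<bar> = ?c" by (rule abs_of_nonneg) simp
        ultimately show "norm (of_real ?c * (\<Sum>j\<le>Suc m. b j * of_real (r / 2) ^ (2 * j + 1))) \<le> ?c * S"
          by (simp only: norm_mult norm_of_real)
      qed
      finally show "norm (\<Sum>j\<le>m. b' j * of_real r ^ (2 * j + 1)) \<le> S + ?c * S" .
    qed
    moreover have "norm (b 0) * 1 \<le> norm (b' 0)"
    proof -
      have "1 - of_real ?c / 2 ^ (2 * 0 + 1) = (of_real (1 - ?c / 2) :: complex)" by simp
      then have "norm (b' 0) = norm (b 0) * \<bar>1 - ?c / 2\<bar>"
        unfolding b'_def norm_mult by (simp only: norm_of_real)
      moreover have "?c / 2 = 4 * 4 ^ m" "(1::real) \<le> 4 ^ m" by (simp_all add: power_mult)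
      then have "\<bar>1 - ?c / 2\<bar> \<ge> 1" by linarith
      ultimately show ?thesis by (simp add: mult_left_mono del: mult_1_right)
    qed
    then have "norm (b 0) * R \<le> norm (b' 0) * R" using R by (intro mult_right_mono) auto
    ultimately show "norm (b 0) * R \<le> K * (1 + ?c) * S" by (simp add: algebra_simps)
  qed
qed

section \<open>The non-holomorphic part as a finite sum of antiholomorphic q-series\<close>

lemma qpow_nat: "qpow (real n) z = qpow 1 z ^ n"
  by (simp add: qpow_def exp_of_nat_mult[symmetric] mult_ac)

lemma norm_qpow: "norm (qpow r z) = exp (- 2 * pi * r * Im z)"
  by (simp add: qpow_def norm_exp_eq_Re)

text \<open>Radius of convergence at least 1, in the form that an expansion supplies directly:
  absolute convergence at r = |q| for a point of the half plane.\<close>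

definition unit_disc_series :: "(nat \<Rightarrow> complex) \<Rightarrow> bool" where
  "unit_disc_series c \<longleftrightarrow> (\<forall>r. 0 < r \<and> r < 1 \<longrightarrow> summable (\<lambda>n. norm (c n) * r ^ n))"

lemma unit_disc_seriesD:
  assumes "unit_disc_series c" "norm x < 1"
  shows "summable (\<lambda>n. norm (c n * x ^ n))"
proof -
  define r where "r = (norm x + 1) / 2"
  have r: "0 < r" "r < 1" "norm x < r" using assms by (auto simp: r_def add_nonneg_pos)
  then have "summable (\<lambda>n. norm (c n) * r ^ n)" using assms by (auto simp: unit_disc_series_def)
  then have "summable (\<lambda>n. norm (c n * of_real r ^ n))" using r by (simp add: norm_mult norm_power)
  from powser_insidea[OF summable_norm_cancel[OF this]] show ?thesis using r by simp
qed

text \<open>Multiplying the coefficients by n is x d/dx, and termwise differentiation preserves the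
  disc of convergence. It is applied to the series of norms, so that plain summability gives
  absolute summability.\<close>

lemma unit_disc_series_diff:
  assumes "unit_disc_series c"
  shows "unit_disc_series (\<lambda>n. of_nat n * c n)"
  unfolding unit_disc_series_def
proof (intro allI impI)
  fix r :: real assume r: "0 < r \<and> r < 1"
  have sm: "summable (\<lambda>n. of_real (norm (c n)) * x ^ n)" if "norm x < 1" for x :: complex
    using unit_disc_seriesD[OF assms that]
    by (intro summable_norm_cancel[of "\<lambda>n. of_real (norm (c n)) * x ^ n"]) (simp add: norm_mult)
  have "summable (\<lambda>n. diffs (\<lambda>n. of_real (norm (c n)) :: complex) n * of_real r ^ n)"
    by (rule termdiff_converges[where K = 1]) (use r sm in auto)
  then have "summable (\<lambda>n. of_real (real (Suc n) * norm (c (Suc n)) * r ^ n) :: complex)"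
    by (simp add: diffs_def)
  then have "summable (\<lambda>n. real (Suc n) * norm (c (Suc n)) * r ^ n)"
    by (simp only: summable_of_real_iff)
  from summable_mult[OF this, of r]
  have "summable (\<lambda>n. norm (of_nat (Suc n) * c (Suc n)) * r ^ Suc n)"
    by (simp add: norm_mult mult_ac del: of_nat_Suc)
  then show "summable (\<lambda>n. norm (of_nat n * c n) * r ^ n)"
    by (subst (asm) summable_Suc_iff)
qed

lemma unit_disc_series_power:
  "unit_disc_series c \<Longrightarrow> unit_disc_series (\<lambda>n. of_nat n ^ l * c n)"
  by (induction l) (auto dest: unit_disc_series_diff simp: mult.assoc)

definition qseries :: "(nat \<Rightarrow> complex) \<Rightarrow> complex \<Rightarrow> complex" where
  "qseries c z = (\<Sum>n. c n * qpow 1 z ^ n)"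

lemma norm_qpow_1_less: "Im z > 0 \<Longrightarrow> norm (qpow 1 z) < 1"
  by (simp add: norm_qpow)

lemma qpow_has_field_derivative: "(qpow r has_field_derivative 2 * of_real pi * \<i> * of_real r * qpow r z) (at z)"
  unfolding qpow_def by (auto intro!: derivative_eq_intros)

text \<open>Chain rule for x = \<open>qpow 1 z\<close>: the factor x in dx/dz = 2 pi i x shifts the
  formal derivative \<open>diffs c\<close> back to the coefficients n * c n.\<close>

lemma qseries_has_field_derivative:
  assumes c: "unit_disc_series c" and z: "Im z > 0"
  shows "(qseries c has_field_derivative 2 * of_real pi * \<i> * qseries (\<lambda>n. of_nat n * c n) z) (at z)"
proof -
  define x where "x = qpow 1 z"
  have x: "norm x < 1" using norm_qpow_1_less[OF z] by (simp add: x_def)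
  define K where "K = (norm x + 1) / 2"
  have K: "norm x < K" "K < 1" "0 < K" using x by (auto simp: K_def add_nonneg_pos)
  have "summable (\<lambda>n. c n * of_real K ^ n)"
    by (rule summable_norm_cancel, rule unit_disc_seriesD[OF c]) (use K in auto)
  from termdiffs_strong[OF this] K
  have D: "((\<lambda>x. \<Sum>n. c n * x ^ n) has_field_derivative (\<Sum>n. diffs c n * x ^ n)) (at x)" by simp
  have "(qseries c has_field_derivative (\<Sum>n. diffs c n * x ^ n) * (2 * of_real pi * \<i> * x)) (at z)"
    using DERIV_chain2[OF D[unfolded x_def] qpow_has_field_derivative[of 1 z]]
    by (simp add: qseries_def[abs_def] x_def)
  moreover have "(\<Sum>n. diffs c n * x ^ n) * x = qseries (\<lambda>n. of_nat n * c n) z"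
  proof -
    have s: "summable (\<lambda>n. of_nat n * c n * x ^ n)"
      by (rule summable_norm_cancel, rule unit_disc_seriesD[OF unit_disc_series_diff[OF c] x])
    have s': "summable (\<lambda>n. diffs c n * x ^ n)"
      by (rule termdiff_converges[where K = 1, OF x summable_norm_cancel]) (rule unit_disc_seriesD[OF c])
    have "(\<Sum>n. of_nat n * c n * x ^ n) = (\<Sum>n. of_nat (Suc n) * c (Suc n) * x ^ Suc n)"
      using suminf_split_head[OF s] by simp
    also have "\<dots> = (\<Sum>n. diffs c n * x ^ n * x)"
      by (simp add: diffs_def mult_ac)
    also have "\<dots> = (\<Sum>n. diffs c n * x ^ n) * x"
      by (rule suminf_mult2[OF s', symmetric])
    finally show ?thesis by (simp add: qseries_def x_def)
  qed
  moreover have "(\<Sum>n. diffs c n * x ^ n) * (2 * of_real pi * \<i> * x) =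
      2 * of_real pi * \<i> * ((\<Sum>n. diffs c n * x ^ n) * x)" by (simp only: mult_ac)
  ultimately show ?thesis by simp
qed

lemma qseries_holomorphic:
  assumes "unit_disc_series c"
  shows "qseries c holomorphic_on upper_half_plane"
proof (rule holomorphic_onI)
  fix z assume "z \<in> upper_half_plane"
  then have "Im z > 0" by (simp add: upper_half_plane_def)
  from qseries_has_field_derivative[OF assms this]
  show "qseries c field_differentiable at z within upper_half_plane"
    unfolding field_differentiable_def by (blast intro: has_field_derivative_at_within)
qed

lemma cnj_qpow: "cnj (qpow r z) = qpow (- r) (cnj z)"
  by (simp add: qpow_def exp_cnj)

text \<open>The exponential contained in the incomplete gamma function is exactly what replaces z by
  its conjugate in the exponent. Hence each nonholomorphic term is antiholomorphic up to powers of
  Im z.\<close>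

lemma exp_qpow_minus: "of_real (exp (- (4 * pi * r * Im z))) * qpow (- r) z = cnj (qpow r z)"
proof -
  have "of_real (- (4 * pi * r * Im z)) + 2 * of_real pi * \<i> * of_real (- r) * z =
      2 * of_real pi * \<i> * of_real (- r) * cnj z"
    by (simp add: complex_eq_iff)
  then show ?thesis
    unfolding cnj_qpow unfolding qpow_def exp_of_real[symmetric] exp_add[symmetric] by simp
qed

lemma inc_Gamma_Suc_qpow:
  assumes "r > 0" "Im z > 0"
  shows "of_real (inc_Gamma (real m + 1) (4 * pi * r * Im z)) * qpow (- r) z =
    (\<Sum>l\<le>m. of_real (fact m / fact l * (4 * pi * Im z) ^ l) * (of_real r ^ l * cnj (qpow r z)))"
proof -
  have "4 * pi * r * Im z > 0" using assms by simp
  then have "of_real (inc_Gamma (real m + 1) (4 * pi * r * Im z)) * qpow (- r) z =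
      of_real (fact m * (\<Sum>l\<le>m. (4 * pi * r * Im z) ^ l / fact l)) *
      (of_real (exp (- (4 * pi * r * Im z))) * qpow (- r) z)"
    by (simp add: inc_Gamma_Suc)
  also have "of_real (fact m * (\<Sum>l\<le>m. (4 * pi * r * Im z) ^ l / fact l)) =
      (\<Sum>l\<le>m. of_real (fact m / fact l * (4 * pi * Im z) ^ l) * of_real r ^ l :: complex)"
    by (simp add: sum_distrib_left power_mult_distrib mult_ac)
  finally show ?thesis unfolding exp_qpow_minus sum_distrib_right by (simp only: mult.assoc)
qed

text \<open>The coefficients \<open>c\<close> are conjugated so that the nonholomorphic part is
  built from conjugates of genuine q-series; \<open>c 0 = 0\<close> because that part starts at n =
  1. The shift by \<open>n0\<close> in \<open>c'\<close> puts the pole at infinity into the factor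
  \<open>qpow (- real n0) z\<close>.\<close>

lemma has_maass_expansion_nat_weight:
  fixes cm cp :: "int \<Rightarrow> complex"
  assumes "has_maass_expansion (- real m) 1 n0 cp cm f"
  defines "c \<equiv> \<lambda>n. if n = 0 then 0 else cnj (cm (int n))"
    and "c' \<equiv> \<lambda>n. cp (- int n0 + int n)"
  shows "unit_disc_series c" "unit_disc_series c'"
    and "Im z > 0 \<Longrightarrow> f z = qpow (- real n0) z * qseries c' z +
      (\<Sum>l\<le>m. of_real (fact m / fact l * (4 * pi * Im z) ^ l) * cnj (qseries (\<lambda>n. of_nat n ^ l * c n) z))"
proof -
  note E = assms(1)[unfolded has_maass_expansion_def, rule_format]
  have s1: "summable (\<lambda>n. norm (cp (- int n0 + int n) * qpow (of_int (- int n0 + int n)) z))" if "Im z > 0" for z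
    using E[of z] that by (simp add: upper_half_plane_def summable_on_int_atLeast_iff)
  let ?t = "\<lambda>z n. cm n * of_real (inc_Gamma (real m + 1) (4 * pi * of_int n * Im z)) * qpow (- of_int n) z"
  have s2: "?t z summable_on {1..}" if "Im z > 0" for z
    using E[of z] that by (simp add: upper_half_plane_def add.commute)
  note s2' = s2[unfolded summable_on_int_atLeast_iff]
  have fz: "f z = (\<Sum>n. cp (- int n0 + int n) * qpow (of_int (- int n0 + int n)) z) + (\<Sum>n. ?t z (1 + int n))"
    if "Im z > 0" for z
  proof -
    have "f z = (\<Sum>\<^sub>\<infinity>n\<in>{- int n0..}. cp n * qpow (of_int n) z) + (\<Sum>\<^sub>\<infinity>n\<in>{1..}. ?t z n)"
      using E[of z] that by (simp add: upper_half_plane_def add.commute)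
    then show ?thesis
      using infsum_int_atLeast[OF s1[OF that]] infsum_int_atLeast[OF s2'[OF that]] by simp
  qed
  have qsplit: "qpow (of_int (- int n0 + int n)) z = qpow (- real n0) z * qpow 1 z ^ n" for n z
    unfolding qpow_nat[symmetric] by (simp add: qpow_def algebra_simps flip: exp_add)
  \<comment> \<open>Every radius in (0, 1) is |q| at some point of the half plane, so pointwise
    convergence of the expansion covers the whole disc.\<close>
  have rz: "\<exists>z. Im z > 0 \<and> norm (qpow 1 z) = r" if "0 < r" "r < 1" for r
    using that by (intro exI[of _ "Complex 0 (- ln r / (2 * pi))"]) (simp add: norm_qpow divide_neg_pos)
  show c': "unit_disc_series c'"
    unfolding unit_disc_series_def
  proof (intro allI impI)
    fix r :: real assume "0 < r \<and> r < 1"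
    then obtain z where z: "Im z > 0" "norm (qpow 1 z) = r" using rz by blast
    have "summable (\<lambda>n. norm (qpow (- real n0) z) * (norm (c' n) * r ^ n))"
      using s1[OF z(1), unfolded qsplit norm_mult norm_power z(2)] unfolding c'_def by (simp only: mult_ac)
    moreover have "norm (qpow (- real n0) z) \<noteq> 0" by (simp add: norm_qpow)
    ultimately show "summable (\<lambda>n. norm (c' n) * r ^ n)" by (auto simp only: summable_cmult_iff)
  qed
  have t: "?t z (1 + int n) =
      (\<Sum>l\<le>m. of_real (fact m / fact l * (4 * pi * Im z) ^ l) * cnj (of_nat (Suc n) ^ l * c (Suc n) * qpow 1 z ^ Suc n))"
    if "Im z > 0" for z n
  proof -
    have "?t z (1 + int n) = cm (int (Suc n)) *
       (of_real (inc_Gamma (real m + 1) (4 * pi * real (Suc n) * Im z)) * qpow (- real (Suc n)) z)"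
      by (simp add: mult.assoc)
    also have "\<dots> = cm (int (Suc n)) * (\<Sum>l\<le>m. of_real (fact m / fact l * (4 * pi * Im z) ^ l) *
       (of_real (real (Suc n)) ^ l * cnj (qpow (real (Suc n)) z)))"
      by (subst inc_Gamma_Suc_qpow) (use that in auto)
    also have "\<dots> = (\<Sum>l\<le>m. of_real (fact m / fact l * (4 * pi * Im z) ^ l) * cnj (of_nat (Suc n) ^ l * c (Suc n) * qpow 1 z ^ Suc n))"
      unfolding sum_distrib_left qpow_nat by (intro sum.cong refl) (simp add: c_def mult_ac del: of_nat_Suc power_Suc)
    finally show ?thesis .
  qed
  show c: "unit_disc_series c"
    unfolding unit_disc_series_def
  proof (intro allI impI)
    fix r :: real assume "0 < r \<and> r < 1"
    then obtain z where z: "Im z > 0" "norm (qpow 1 z) = r" using rz by blast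
    have "norm (c (Suc n)) * r ^ Suc n \<le> norm (?t z (1 + int n))" for n
    proof -
      define x where "x = 4 * pi * real (Suc n) * Im z"
      have x: "x > 0" using z by (simp add: x_def)
      \<comment> \<open>Keeping only l = 0 in the closed form gives \<Gamma>(m+1, x) \<ge> exp(-x),
        so the terms of the expansion dominate |c(n)| r^n.\<close>
      have "1 * exp (- x) \<le> fact m * (exp (- x) * 1)"
        using fact_ge_1[of m, where 'a = real] by simp
      also have "\<dots> \<le> fact m * (exp (- x) * (\<Sum>l\<le>m. x ^ l / fact l))"
      proof (intro mult_left_mono)
        have "(\<Sum>l\<in>{0}. x ^ l / fact l) \<le> (\<Sum>l\<le>m. x ^ l / fact l)"
          using x by (intro sum_mono2) auto
        then show "1 \<le> (\<Sum>l\<le>m. x ^ l / fact l)" by simp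
      qed auto
      finally have G: "exp (- x) \<le> inc_Gamma (real m + 1) x" using x by (simp add: inc_Gamma_Suc)
      have "norm (c (Suc n)) * r ^ Suc n = norm (cm (int (Suc n))) * (exp (- x) * norm (qpow (- real (Suc n)) z))"
      proof -
        have "r ^ Suc n = exp (real (Suc n) * (- 2 * pi * 1 * Im z))"
          by (simp only: z(2)[symmetric] norm_qpow exp_of_nat_mult)
        also have "\<dots> = exp (- x) * norm (qpow (- real (Suc n)) z)"
          by (simp only: norm_qpow exp_add[symmetric] x_def) (simp add: algebra_simps)
        finally show ?thesis by (simp only: c_def complex_mod_cnj) simp
      qed
      also have "\<dots> \<le> norm (cm (int (Suc n))) * (inc_Gamma (real m + 1) x * norm (qpow (- real (Suc n)) z))"
        using G by (intro mult_left_mono mult_right_mono) auto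
      also have "\<dots> = norm (?t z (1 + int n))"
        using G by (simp add: norm_mult x_def abs_of_nonneg[OF order_trans[OF exp_ge_zero]])
      finally show ?thesis .
    qed
    then have "summable (\<lambda>n. norm (c (Suc n)) * r ^ Suc n)"
      using z \<open>0 < r \<and> r < 1\<close> by (intro summable_comparison_test'[OF s2'[OF z(1)], of 0]) auto
    then show "summable (\<lambda>n. norm (c n) * r ^ n)" by (subst (asm) summable_Suc_iff)
  qed
  show "f z = qpow (- real n0) z * qseries c' z +
      (\<Sum>l\<le>m. of_real (fact m / fact l * (4 * pi * Im z) ^ l) * cnj (qseries (\<lambda>n. of_nat n ^ l * c n) z))"
    if z: "Im z > 0"
  proof -
    have x: "norm (qpow 1 z) < 1" by (rule norm_qpow_1_less[OF z])
    have "(\<Sum>n. cp (- int n0 + int n) * qpow (of_int (- int n0 + int n)) z) =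
       (\<Sum>n. qpow (- real n0) z * (c' n * qpow 1 z ^ n))"
      unfolding qsplit c'_def by (simp only: mult_ac)
    also have "\<dots> = qpow (- real n0) z * qseries c' z"
      unfolding qseries_def by (rule suminf_mult, rule summable_norm_cancel, rule unit_disc_seriesD[OF c' x])
    finally have 1: "(\<Sum>n. cp (- int n0 + int n) * qpow (of_int (- int n0 + int n)) z) = qpow (- real n0) z * qseries c' z" .
    have S: "(\<lambda>n. of_nat (Suc n) ^ l * c (Suc n) * qpow 1 z ^ Suc n) sums qseries (\<lambda>n. of_nat n ^ l * c n) z" for l
    proof -
      have "summable (\<lambda>n. of_nat n ^ l * c n * qpow 1 z ^ n)"
        by (rule summable_norm_cancel, rule unit_disc_seriesD[OF unit_disc_series_power[OF c] x])
      then have "(\<lambda>n. of_nat n ^ l * c n * qpow 1 z ^ n) sums qseries (\<lambda>n. of_nat n ^ l * c n) z"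
        unfolding qseries_def by (rule summable_sums)
      then show ?thesis by (subst sums_Suc_iff) (simp add: c_def)
    qed
    have "(\<lambda>n. \<Sum>l\<le>m. of_real (fact m / fact l * (4 * pi * Im z) ^ l) * cnj (of_nat (Suc n) ^ l * c (Suc n) * qpow 1 z ^ Suc n))
       sums (\<Sum>l\<le>m. of_real (fact m / fact l * (4 * pi * Im z) ^ l) * cnj (qseries (\<lambda>n. of_nat n ^ l * c n) z))"
      by (intro sums_sum sums_mult) (use S in \<open>simp only: sums_cnj\<close>)
    then have "(\<Sum>n. ?t z (1 + int n)) = (\<Sum>l\<le>m. of_real (fact m / fact l * (4 * pi * Im z) ^ l) * cnj (qseries (\<lambda>n. of_nat n ^ l * c n) z))"
      unfolding t[OF z] by (rule sums_unique[symmetric])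
    with 1 fz[OF z] show ?thesis by simp
  qed
qed

section \<open>Bounding the non-holomorphic coefficients\<close>

text \<open>The pairs with \<open>|z - z0|\<^sup>2 \<le> Im z Im z0 / 4\<close> are those at hyperbolic distance below a constant. Both this
  relation and \<open>|f - H| (Im z)\<^bsup>-m/2\<^esup>\<close> are invariant under the weight \<open>-m\<close> action, which is why the
  condition passes from a fundamental domain to all of the half plane and from \<open>f\<close> to its Fricke image.\<close>
definition near_holomorphic :: "nat \<Rightarrow> (complex \<Rightarrow> complex) \<Rightarrow> bool" where
  "near_holomorphic m f \<longleftrightarrow> (\<exists>B. \<forall>z0\<in>upper_half_plane. \<exists>H. H holomorphic_on upper_half_plane \<and>
     (\<forall>z\<in>upper_half_plane. (norm (z - z0))\<^sup>2 \<le> Im z * Im z0 / 4 \<longrightarrow> norm (f z - H z) \<le> B * Im z powr (real m / 2)))"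

text \<open>The second part of term l cancels the first part of term l + 1. With \<open>e l\<close>
  the q-series weighted by n^l, this is why the antiholomorphic derivative of \<open>f\<close>
  collapses to y^m times a single series, the one weighted by n^(m+1).\<close>

lemma telescope_exp_partial:
  fixes v :: complex and e :: "nat \<Rightarrow> complex"
  shows "(\<Sum>l\<le>m. fact m / fact l * (of_nat l * v ^ (l - 1) * - e l + v ^ l * e (Suc l))) = v ^ m * e (Suc m)"
proof (induction m)
  case (Suc m)
  have "(\<Sum>l\<le>m. fact (Suc m) / fact l * (of_nat l * v ^ (l - 1) * - e l + v ^ l * e (Suc l))) =
      of_nat (Suc m) * (\<Sum>l\<le>m. fact m / fact l * (of_nat l * v ^ (l - 1) * - e l + v ^ l * e (Suc l)))"
    unfolding sum_distrib_left by (intro sum.cong refl) simp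
  then show ?case using Suc by (simp del: of_nat_Suc fact_Suc)
qed simp

text \<open>Binomial expansion of 4 pi Im z = 2 pi i ((cnj z - z0) - (z - z0)), in which z0 cancels.
  The point of inserting it is that powers of z - z0 become monomials on circles around z0.\<close>

lemma im_power_taylor:
  fixes z z0 :: complex
  shows "of_real ((4 * pi * Im z) ^ l) = (\<Sum>j\<le>l. (z - z0) ^ j * cnj ((- 2 * of_real pi * \<i>) ^ l * (of_nat (l choose j) * (- 1) ^ j * (z - cnj z0) ^ (l - j))))"
proof -
  have e: "of_real (4 * pi * Im z) = (2 * of_real pi * \<i>) * (- (z - z0) + cnj (z - cnj z0))"
    by (simp add: complex_eq_iff)
  have "of_real ((4 * pi * Im z) ^ l) = (2 * of_real pi * \<i>) ^ l * (- (z - z0) + cnj (z - cnj z0)) ^ l"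
    by (simp only: of_real_power e) (rule power_mult_distrib)
  also have "(- (z - z0) + cnj (z - cnj z0)) ^ l =
      (\<Sum>j\<le>l. of_nat (l choose j) * (- (z - z0)) ^ j * cnj (z - cnj z0) ^ (l - j))"
    by (rule binomial_ring)
  also have "(2 * of_real pi * \<i>) ^ l * \<dots> = (\<Sum>j\<le>l. (z - z0) ^ j * cnj ((- 2 * of_real pi * \<i>) ^ l * (of_nat (l choose j) * (- 1) ^ j * (z - cnj z0) ^ (l - j))))"
    unfolding sum_distrib_left
  proof (intro sum.cong refl)
    fix j
    show "(2 * of_real pi * \<i>) ^ l * (of_nat (l choose j) * (- (z - z0)) ^ j * cnj (z - cnj z0) ^ (l - j)) =
        (z - z0) ^ j * cnj ((- 2 * of_real pi * \<i>) ^ l * (of_nat (l choose j) * (- 1) ^ j * (z - cnj z0) ^ (l - j)))"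
      unfolding power_minus[of "z - z0" j] by (simp add: mult_ac)
  qed
  finally show ?thesis .
qed

text \<open>Rewriting \<open>Im z\<close> through \<open>z - z0\<close> and \<open>cnj (z - cnj z0)\<close> exhibits the non-holomorphic part as a polynomial in
  \<open>z - z0\<close> with antiholomorphic coefficients.\<close>
lemma fourier_coeff_near_maass:
  assumes F: "\<And>z. Im z > 0 \<Longrightarrow> F z = h z +
      (\<Sum>l\<le>m. of_real (fact m / fact l * (4 * pi * Im z) ^ l) * cnj (qseries (\<lambda>n. of_nat n ^ l * c n) z))"
    and h: "h holomorphic_on upper_half_plane" and c: "unit_disc_series c"
    and z0: "Im z0 > 0"
  shows "\<exists>b. norm (b 0) = 2 * pi * (4 * pi * Im z0) ^ m * norm (qseries (\<lambda>n. of_nat n ^ (m + 1) * c n) z0) \<and>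
     (\<forall>r. 0 < r \<and> r < Im z0 \<longrightarrow> fourier_coeff (-1) (\<lambda>x. F (z0 + of_real r * cis2pi 1 x)) =
        (\<Sum>j\<le>m. b j * of_real r ^ (2 * j + 1)))"
proof -
  define E where "E l = qseries (\<lambda>n. of_nat n ^ l * c n)" for l
  define k where "k = - 2 * of_real pi * \<i>"
  define A where "A j z = (\<Sum>l\<in>{j..m}. fact m / fact l * (k ^ l * (of_nat (l choose j) * (- 1) ^ j * (z - cnj z0) ^ (l - j))) * E l z)" for j z
  define b where "b j = cnj ((deriv ^^ (j + 1)) (A j) z0 / fact (j + 1))" for j
  have ball: "ball z0 (Im z0) \<subseteq> upper_half_plane"
  proof
    fix z assume "z \<in> ball z0 (Im z0)"
    then have "norm (z0 - z) < Im z0" by (simp add: dist_norm)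
    moreover have "\<bar>Im (z0 - z)\<bar> \<le> norm (z0 - z)" by (rule abs_Im_le_cmod)
    ultimately show "z \<in> upper_half_plane" by (simp add: upper_half_plane_def)
  qed
  have E_hol: "E l holomorphic_on upper_half_plane" for l
    unfolding E_def by (rule qseries_holomorphic[OF unit_disc_series_power[OF c]])
  have A_hol: "A j holomorphic_on ball z0 (Im z0)" for j
    unfolding A_def using E_hol holomorphic_on_subset[OF _ ball] by (intro holomorphic_intros) auto
  have FA: "F z = h z + (\<Sum>j\<le>m. (z - z0) ^ j * cnj (A j z))" if "z \<in> ball z0 (Im z0)" for z
  proof -
    have z: "Im z > 0" using that ball by (auto simp: upper_half_plane_def)
    let ?T = "\<lambda>l j. (z - z0) ^ j * cnj (fact m / fact l * (k ^ l * (of_nat (l choose j) * (- 1) ^ j * (z - cnj z0) ^ (l - j))) * E l z)"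
    have "(\<Sum>l\<le>m. of_real (fact m / fact l * (4 * pi * Im z) ^ l) * cnj (E l z)) =
        (\<Sum>l\<le>m. \<Sum>j\<le>l. ?T l j)"
    proof (intro sum.cong refl)
      fix l
      have "of_real (fact m / fact l * (4 * pi * Im z) ^ l) * cnj (E l z) =
         of_real (fact m / fact l) * cnj (E l z) * of_real ((4 * pi * Im z) ^ l)" by simp
      also have "\<dots> = (\<Sum>j\<le>l. ?T l j)"
        unfolding im_power_taylor[of z l z0] sum_distrib_left k_def
        by (intro sum.cong refl) (simp add: mult_ac)
      finally show "of_real (fact m / fact l * (4 * pi * Im z) ^ l) * cnj (E l z) = (\<Sum>j\<le>l. ?T l j)" .
    qed
    also have "\<dots> = (\<Sum>j\<le>m. \<Sum>l\<in>{j..m}. ?T l j)"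
    proof -
      have "(\<Sum>l\<le>m. \<Sum>j\<le>l. ?T l j) = (\<Sum>(l,j)\<in>(SIGMA l:{..m}. {..l}). ?T l j)"
        by (rule sum.Sigma) auto
      also have "\<dots> = (\<Sum>(j,l)\<in>(SIGMA j:{..m}. {j..m}). ?T l j)"
        by (rule sum.reindex_bij_witness[of _ "\<lambda>(j,l). (l,j)" "\<lambda>(l,j). (j,l)"]) auto
      also have "\<dots> = (\<Sum>j\<le>m. \<Sum>l\<in>{j..m}. ?T l j)"
        by (rule sum.Sigma[symmetric]) auto
      finally show ?thesis .
    qed
    also have "\<dots> = (\<Sum>j\<le>m. (z - z0) ^ j * cnj (A j z))"
      by (simp only: A_def sum_distrib_left cnj_sum)
    finally show ?thesis using F[OF z] by (simp add: E_def)
  qed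
  have four: "fourier_coeff (-1) (\<lambda>x. F (z0 + of_real r * cis2pi 1 x)) = (\<Sum>j\<le>m. b j * of_real r ^ (2 * j + 1))"
    if "0 < r" "r < Im z0" for r
    unfolding b_def
    by (rule fourier_coeff_circle_sum[OF holomorphic_on_subset[OF h ball] A_hol that FA])
  \<comment> \<open>At \<open>z0\<close> only j = 0 contributes, so the conjugate of this number is
    the antiholomorphic derivative of \<open>F\<close> there. The constant
    \<open>k * (z0 - cnj z0)\<close> is the real number \<open>4 * pi * Im z0\<close>.\<close>
  have "deriv (A 0) z0 = 2 * of_real pi * \<i> * ((k * (z0 - cnj z0)) ^ m * E (Suc m) z0)"
  proof -
    let ?v = "k * (z0 - cnj z0)"
    have A0: "A 0 z = (\<Sum>l\<le>m. fact m / fact l * ((k * (z - cnj z0)) ^ l * E l z))" for z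
      unfolding A_def by (rule sum.cong) (auto simp: power_mult_distrib mult_ac)
    have dE: "(E l has_field_derivative 2 * of_real pi * \<i> * E (Suc l) z0) (at z0)" for l
      using qseries_has_field_derivative[OF unit_disc_series_power[OF c] z0, of l]
      unfolding E_def by (simp add: mult.assoc)
    have "((\<lambda>z. k * (z - cnj z0)) has_field_derivative k) (at z0)"
      by (auto intro!: derivative_eq_intros)
    note dv = DERIV_power[OF this]
    have "(A 0 has_field_derivative (\<Sum>l\<le>m. fact m / fact l *
       (of_nat l * (k * ?v ^ (l - Suc 0)) * E l z0 + 2 * of_real pi * \<i> * E (Suc l) z0 * ?v ^ l))) (at z0)"
      unfolding A0[abs_def]
      by (intro DERIV_sum DERIV_cmult DERIV_mult[OF dv dE])
    then have "deriv (A 0) z0 = (\<Sum>l\<le>m. fact m / fact l *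
       (of_nat l * (k * ?v ^ (l - Suc 0)) * E l z0 + 2 * of_real pi * \<i> * E (Suc l) z0 * ?v ^ l))"
      by (rule DERIV_imp_deriv)
    also have "\<dots> = 2 * of_real pi * \<i> * (\<Sum>l\<le>m. fact m / fact l *
       (of_nat l * ?v ^ (l - 1) * - E l z0 + ?v ^ l * E (Suc l) z0))"
      unfolding sum_distrib_left by (intro sum.cong refl) (simp add: k_def algebra_simps)
    also have "\<dots> = 2 * of_real pi * \<i> * (?v ^ m * E (Suc m) z0)"
      using telescope_exp_partial[of m ?v "\<lambda>l. E l z0"] by (simp only: mult_ac)
    finally show ?thesis .
  qed
  moreover have "k * (z0 - cnj z0) = of_real (4 * pi * Im z0)"
    by (simp add: k_def complex_eq_iff)
  ultimately have "norm (b 0) = 2 * pi * (4 * pi * Im z0) ^ m * norm (E (Suc m) z0)"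
    using z0 by (simp add: b_def norm_mult norm_power)
  then show ?thesis using four by (intro exI[of _ b]) (simp add: E_def)
qed

text \<open>Subtracting \<open>H\<close> changes only the holomorphic part, which frequency -1
  ignores. The Fourier coefficient of f - H is therefore an odd polynomial in the radius, bounded
  for all small radii by the bound on f - H, and its linear coefficient \<open>b 0\<close> carries
  the value of the q-series at \<open>z0\<close>.\<close>

lemma near_holomorphic_imp_qseries_bound:
  assumes f: "\<And>z. Im z > 0 \<Longrightarrow> f z = h z +
      (\<Sum>l\<le>m. of_real (fact m / fact l * (4 * pi * Im z) ^ l) * cnj (qseries (\<lambda>n. of_nat n ^ l * c n) z))"
    and h: "h holomorphic_on upper_half_plane" and c: "unit_disc_series c"
    and near: "near_holomorphic m f"
  shows "\<exists>B. \<forall>z. Im z > 0 \<longrightarrow> norm (qseries (\<lambda>n. of_nat n ^ (m + 1) * c n) z) * Im z ^ (m + 1) \<le> B * Im z powr (real m / 2)"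
proof -
  obtain B where B: "\<And>z0. z0 \<in> upper_half_plane \<Longrightarrow> \<exists>H. H holomorphic_on upper_half_plane \<and>
     (\<forall>z\<in>upper_half_plane. (norm (z - z0))\<^sup>2 \<le> Im z * Im z0 / 4 \<longrightarrow> norm (f z - H z) \<le> B * Im z powr (real m / 2))"
    using near unfolding near_holomorphic_def by blast
  obtain K where K: "K \<ge> 0" "\<And>(b :: nat \<Rightarrow> complex) R S. R > 0 \<Longrightarrow>
     (\<And>r. 0 < r \<Longrightarrow> r \<le> R \<Longrightarrow> norm (\<Sum>j\<le>m. b j * of_real r ^ (2 * j + 1)) \<le> S) \<Longrightarrow> norm (b 0) * R \<le> K * S"
    using odd_poly_linear_coeff_bound[of m] by blast
  define M where "M = K * (\<bar>B\<bar> * 2 powr (real m / 2)) * 4 / (2 * pi * (4 * pi) ^ m)"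
  show ?thesis
  proof (intro exI[of _ M] allI impI)
    fix z0 assume z0: "Im z0 > 0"
    then obtain H where H: "H holomorphic_on upper_half_plane"
      "\<And>z. Im z > 0 \<Longrightarrow> (norm (z - z0))\<^sup>2 \<le> Im z * Im z0 / 4 \<Longrightarrow> norm (f z - H z) \<le> B * Im z powr (real m / 2)"
      using B[of z0] by (auto simp: upper_half_plane_def)
    have F: "f z - H z = (h z - H z) +
      (\<Sum>l\<le>m. of_real (fact m / fact l * (4 * pi * Im z) ^ l) * cnj (qseries (\<lambda>n. of_nat n ^ l * c n) z))"
      if "Im z > 0" for z using f[OF that] by simp
    have "(\<lambda>z. h z - H z) holomorphic_on upper_half_plane" by (intro holomorphic_intros h H)
    from fourier_coeff_near_maass[where F = "\<lambda>z. f z - H z", OF F this c z0]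
    obtain b where b0: "norm (b 0) = 2 * pi * (4 * pi * Im z0) ^ m * norm (qseries (\<lambda>n. of_nat n ^ (m + 1) * c n) z0)"
      and b: "\<And>r. 0 < r \<Longrightarrow> r < Im z0 \<Longrightarrow> fourier_coeff (-1) (\<lambda>x. f (z0 + of_real r * cis2pi 1 x) - H (z0 + of_real r * cis2pi 1 x)) =
        (\<Sum>j\<le>m. b j * of_real r ^ (2 * j + 1))"
      by blast
    let ?S = "\<bar>B\<bar> * (2 * Im z0) powr (real m / 2)"
    \<comment> \<open>For r \<le> Im z0 / 4 the circle stays between the heights 3/4 Im z0 and 2 Im
      z0 and satisfies the closeness condition, as 1/16 \<le> 3/16. The height 2 Im z0 is the source
      of \<open>2 powr (real m / 2)\<close> in \<open>M\<close>, and this radius of its factor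
      4.\<close>
    have "norm (b 0) * (Im z0 / 4) \<le> K * ?S"
    proof (rule K(2))
      fix r assume r: "0 < r" "r \<le> Im z0 / 4"
      have "norm (f (z0 + of_real r * cis2pi 1 x) - H (z0 + of_real r * cis2pi 1 x)) \<le> ?S" for x
      proof -
        define z where "z = z0 + of_real r * cis2pi 1 x"
        have n: "norm (z - z0) = r" using r by (simp add: z_def norm_mult)
        have "\<bar>Im (z - z0)\<bar> \<le> r" unfolding n[symmetric] by (rule abs_Im_le_cmod)
        then have im: "Im z \<ge> 3 / 4 * Im z0" "Im z \<le> 2 * Im z0" using r by (auto simp: abs_le_iff)
        have "r\<^sup>2 \<le> (Im z0 / 4)\<^sup>2" using r by (intro power_mono) auto
        also have "\<dots> \<le> (3 / 4 * Im z0) * Im z0 / 4" using z0 by (simp add: power2_eq_square)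
        also have "\<dots> \<le> Im z * Im z0 / 4" using im z0 by (intro divide_right_mono mult_right_mono) auto
        finally have "norm (f z - H z) \<le> B * Im z powr (real m / 2)"
          using im z0 by (intro H) (auto simp: n)
        also have "\<dots> \<le> \<bar>B\<bar> * (2 * Im z0) powr (real m / 2)"
          using im z0 by (intro mult_mono powr_mono2) auto
        finally show ?thesis by (simp add: z_def)
      qed
      then have "norm (fourier_coeff (-1) (\<lambda>x. f (z0 + of_real r * cis2pi 1 x) - H (z0 + of_real r * cis2pi 1 x))) \<le> ?S"
        by (rule norm_fourier_coeff_le)
      moreover have "r < Im z0" using r z0 by linarith
      ultimately show "norm (\<Sum>j\<le>m. b j * of_real r ^ (2 * j + 1)) \<le> ?S"
        by (simp only: b[OF r(1)])
    qed (use z0 in auto)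
    then have "2 * pi * (4 * pi) ^ m / 4 * (norm (qseries (\<lambda>n. of_nat n ^ (m + 1) * c n) z0) * Im z0 ^ (m + 1)) \<le>
       K * (\<bar>B\<bar> * 2 powr (real m / 2)) * Im z0 powr (real m / 2)"
      using z0 unfolding b0 by (simp add: powr_mult power_mult_distrib mult_ac)
    then show "norm (qseries (\<lambda>n. of_nat n ^ (m + 1) * c n) z0) * Im z0 ^ (m + 1) \<le> M * Im z0 powr (real m / 2)"
      unfolding M_def by (simp add: field_simps)
  qed
qed

text \<open>\<open>c n\<close> times the exponential is a Fourier coefficient of the restriction to
  the horizontal line at height y.\<close>

lemma qseries_coeff_bound:
  assumes c: "unit_disc_series c" and y: "y > 0"
    and B: "\<And>x. norm (qseries c (Complex x y)) \<le> B"
  shows "norm (c n) * exp (- (2 * pi * real n * y)) \<le> B"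
proof -
  define a where "a n = c n * of_real (exp (- (2 * pi * real n * y)))" for n
  have q: "qpow 1 (Complex x y) ^ n = of_real (exp (- (2 * pi * real n * y))) * cis2pi (int n) x" for x n
  proof -
    have e: "2 * of_real pi * \<i> * of_real (real n) * Complex x y =
      of_real (- (2 * pi * real n * y)) + 2 * of_real pi * \<i> * of_int (int n) * of_real x"
      by (simp add: complex_eq_iff)
    show ?thesis unfolding qpow_nat[symmetric] unfolding qpow_def cis2pi_def e exp_add exp_of_real ..
  qed
  have "norm (qpow 1 (Complex 0 y)) < 1" using y by (intro norm_qpow_1_less) simp
  from unit_disc_seriesD[OF c this] have a: "summable (\<lambda>n. norm (a n))"
    by (simp add: a_def q norm_mult)
  have "qseries c (Complex x y) = (\<Sum>n. a n * cis2pi (int n) x)" for x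
    unfolding qseries_def q a_def by (simp add: mult.assoc)
  then have "norm (fourier_coeff (int n) (\<lambda>x. \<Sum>n. a n * cis2pi (int n) x)) \<le> B"
    using B by (intro norm_fourier_coeff_le) metis
  also have "fourier_coeff (int n) (\<lambda>x. \<Sum>n. a n * cis2pi (int n) x) = a n"
    unfolding fourier_coeff_suminf(2)[OF a] by (rule suminf_if_inj) (auto simp: inj_def)
  finally show ?thesis by (simp add: a_def norm_mult)
qed

text \<open>Hecke's choice y = 1/n: the exponential becomes the constant exp(-2 pi), and y^(m+1) on
  the left compensates the weights n^(m+1) of the q-series. The remaining factor y^(m/2) is
  estimated by 1.\<close>

theorem minus_coefficients_bounded:
  assumes E: "has_maass_expansion (- real m) 1 n0 cp cm f" and near: "near_holomorphic m f"
  shows "\<exists>B. \<forall>n\<ge>1. norm (cm n) \<le> B"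
proof -
  define c where "c n = (if n = 0 then 0 else cnj (cm (int n)))" for n :: nat
  define c' where "c' n = cp (- int n0 + int n)" for n :: nat
  note exps = has_maass_expansion_nat_weight[OF E, folded c_def c'_def]
  have "(\<lambda>z. qpow (- real n0) z * qseries c' z) holomorphic_on upper_half_plane"
    by (intro holomorphic_intros qseries_holomorphic exps(2)) (simp add: qpow_def[abs_def] holomorphic_intros)
  from near_holomorphic_imp_qseries_bound[where h = "\<lambda>z. qpow (- real n0) z * qseries c' z", OF exps(3) this exps(1) near]
  obtain B where B: "\<And>z. Im z > 0 \<Longrightarrow>
      norm (qseries (\<lambda>n. of_nat n ^ (m + 1) * c n) z) * Im z ^ (m + 1) \<le> B * Im z powr (real m / 2)"
    by blast
  show ?thesis
  proof (intro exI[of _ "\<bar>B\<bar> * exp (2 * pi)"] allI impI)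
    fix i :: int assume i: "i \<ge> 1"
    define n where "n = nat i"
    have n: "n > 0" "i = int n" using i by (auto simp: n_def)
    define y where "y = 1 / real n"
    have y: "0 < y" "y \<le> 1" "real n * y = 1" using n by (auto simp: y_def)
    have "norm (qseries (\<lambda>n. of_nat n ^ (m + 1) * c n) (Complex x y)) \<le> \<bar>B\<bar> * real n ^ (m + 1)" for x
    proof -
      have "norm (qseries (\<lambda>n. of_nat n ^ (m + 1) * c n) (Complex x y)) =
         norm (qseries (\<lambda>n. of_nat n ^ (m + 1) * c n) (Complex x y)) * y ^ (m + 1) * real n ^ (m + 1)"
        using y(3) by (simp only: mult.assoc power_mult_distrib[symmetric] mult.commute[of y] power_one mult_1_right)
      also have "\<dots> \<le> (B * y powr (real m / 2)) * real n ^ (m + 1)"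
        using B[of "Complex x y"] y by (intro mult_right_mono) auto
      also have "\<dots> \<le> (\<bar>B\<bar> * 1) * real n ^ (m + 1)"
        using y by (intro mult_right_mono mult_mono powr_le1) auto
      finally show ?thesis by simp
    qed
    from qseries_coeff_bound[OF unit_disc_series_power[OF exps(1)] y(1) this, of n]
    have "norm (of_nat n ^ (m + 1) * c n) * exp (- (2 * pi * real n * y)) \<le> \<bar>B\<bar> * real n ^ (m + 1)" .
    moreover have e: "2 * pi * real n * y = 2 * pi" using y(3) by (simp add: mult.assoc)
    ultimately have "norm (of_nat n ^ (m + 1) * c n) * exp (- (2 * pi)) \<le> \<bar>B\<bar> * real n ^ (m + 1)"
      by (simp only:)
    then have "real n ^ (m + 1) * (norm (cm i) * exp (- (2 * pi))) \<le> real n ^ (m + 1) * \<bar>B\<bar>"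
      using n by (simp add: c_def norm_mult norm_power mult_ac)
    then have "norm (cm i) * exp (- (2 * pi)) \<le> \<bar>B\<bar>"
      using n by (simp only: mult_le_cancel_left_pos zero_less_power of_nat_0_less_iff)
    then show "norm (cm i) \<le> \<bar>B\<bar> * exp (2 * pi)"
      by (simp add: exp_minus field_simps)
  qed
qed

section \<open>Reduction theory and the cusp conditions\<close>

definition mat2 :: "int \<Rightarrow> int \<Rightarrow> int \<Rightarrow> int \<Rightarrow> int ^ 2 ^ 2" where
  "mat2 a b c d = vector [vector [a, b], vector [c, d]]"

lemma mat2_nth [simp]:
  "mat2 a b c d $ 1 $ 1 = a" "mat2 a b c d $ 1 $ 2 = b" "mat2 a b c d $ 2 $ 1 = c" "mat2 a b c d $ 2 $ 2 = d"
  by (simp_all add: mat2_def)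

lemma mat2_in_SL2Z: "mat2 a b c d \<in> SL2Z \<longleftrightarrow> a * d - b * c = 1"
  by (simp add: SL2Z_def det_2)

definition mob :: "int \<Rightarrow> int \<Rightarrow> int \<Rightarrow> int \<Rightarrow> complex \<Rightarrow> complex" where
  "mob a b c d z = (of_int a * z + of_int b) / (of_int c * z + of_int d)"

lemma moebius_mat2 [simp]: "moebius (mat2 a b c d) = mob a b c d"
  by (simp add: moebius_def mob_def fun_eq_iff)

lemma aut_factor_nonzero:
  assumes "a * d - b * c = (1::int)" "Im z > 0"
  shows "of_int c * z + of_int d \<noteq> (0::complex)"
proof
  assume "of_int c * z + of_int d = (0::complex)"
  then have "Re (of_int c * z + of_int d) = 0" "Im (of_int c * z + of_int d) = 0" by simp_all
  with assms have "c = 0" "d = 0" by auto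
  with assms(1) show False by simp
qed

lemma Im_mob:
  assumes "a * d - b * c = (1::int)" "Im z > 0"
  shows "Im (mob a b c d z) = Im z / (norm (of_int c * z + of_int d))\<^sup>2"
proof -
  have "real_of_int (a * d - b * c) = 1" using assms by simp
  then have det: "real_of_int a * real_of_int d - real_of_int b * real_of_int c = 1" by simp
  have "Im (mob a b c d z) = (Im (of_int a * z + of_int b) * Re (of_int c * z + of_int d) -
      Re (of_int a * z + of_int b) * Im (of_int c * z + of_int d)) / (norm (of_int c * z + of_int d))\<^sup>2"
    unfolding mob_def Im_divide cmod_power2 by simp
  also have "Im (of_int a * z + of_int b) * Re (of_int c * z + of_int d) -
      Re (of_int a * z + of_int b) * Im (of_int c * z + of_int d) = (of_int a * of_int d - of_int b * of_int c) * Im z"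
    by (simp add: algebra_simps)
  finally show ?thesis by (simp add: det)
qed

lemma Im_mob_pos:
  assumes "a * d - b * c = (1::int)" "Im z > 0"
  shows "Im (mob a b c d z) > 0"
  using assms aut_factor_nonzero[OF assms] by (simp add: Im_mob)

lemma mob_diff:
  assumes "a * d - b * c = (1::int)" "Im z > 0" "Im w > 0"
  shows "mob a b c d z - mob a b c d w = (z - w) / ((of_int c * z + of_int d) * (of_int c * w + of_int d))"
proof -
  have "complex_of_int (a * d - b * c) = 1" using assms by simp
  then have det: "complex_of_int a * of_int d - of_int b * of_int c = 1" by simp
  have "mob a b c d z - mob a b c d w =
     ((of_int a * z + of_int b) * (of_int c * w + of_int d) - (of_int a * w + of_int b) * (of_int c * z + of_int d)) /
     ((of_int c * z + of_int d) * (of_int c * w + of_int d))"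
    unfolding mob_def using aut_factor_nonzero[OF assms(1,2)] aut_factor_nonzero[OF assms(1,3)]
    by (subst diff_frac_eq) (auto simp: mult.commute)
  also have "(of_int a * z + of_int b) * (of_int c * w + of_int d) - (of_int a * w + of_int b) * (of_int c * z + of_int d) =
     (of_int a * of_int d - of_int b * of_int c) * (z - w)"
    by (simp add: algebra_simps)
  finally show ?thesis by (simp add: det)
qed

text \<open>The quotient |z - w|^2 / (Im z Im w) is a point-pair invariant: numerator and
  denominator acquire the same automorphy factors.\<close>

lemma mob_close:
  assumes det: "a * d - b * c = (1::int)" and z: "Im z > 0" "Im w > 0"
    and close: "(norm (z - w))\<^sup>2 \<le> Im z * Im w / 4"
  shows "(norm (mob a b c d z - mob a b c d w))\<^sup>2 \<le> Im (mob a b c d z) * Im (mob a b c d w) / 4"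
proof -
  let ?j = "\<lambda>z. (norm (of_int c * z + of_int d :: complex))\<^sup>2"
  have "(norm (mob a b c d z - mob a b c d w))\<^sup>2 = (norm (z - w))\<^sup>2 / (?j z * ?j w)"
    unfolding mob_diff[OF det z] by (simp add: norm_divide norm_mult power_divide power_mult_distrib)
  also have "\<dots> \<le> (Im z * Im w / 4) / (?j z * ?j w)"
    using close by (intro divide_right_mono) auto
  finally show ?thesis unfolding Im_mob[OF det z(1)] Im_mob[OF det z(2)] by simp
qed

lemma mob_inverse:
  assumes det: "a * d - b * c = (1::int)" and z: "Im z > 0"
  shows "mob d (- b) (- c) a (mob a b c d z) = z"
    and "(of_int c * z + of_int d) * (of_int (- c) * mob a b c d z + of_int a) = 1"
proof -
  have "complex_of_int (a * d - b * c) = 1" using det by simp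
  then have det': "complex_of_int a * of_int d - of_int b * of_int c = 1" by simp
  note nz = aut_factor_nonzero[OF det z]
  have m: "mob a b c d z * (of_int c * z + of_int d) = of_int a * z + of_int b"
    using nz by (simp add: mob_def)
  have "(of_int c * z + of_int d) * (of_int (- c) * mob a b c d z + of_int a) =
     - of_int c * (mob a b c d z * (of_int c * z + of_int d)) + of_int a * (of_int c * z + of_int d)"
    by (simp add: algebra_simps)
  also have "\<dots> = complex_of_int a * of_int d - of_int b * of_int c" unfolding m by (simp add: algebra_simps)
  finally show j: "(of_int c * z + of_int d) * (of_int (- c) * mob a b c d z + of_int a) = 1"
    using det' by simp
  then have j': "of_int (- c) * mob a b c d z + of_int a = 1 / (of_int c * z + of_int d)"
    using nz by (simp add: field_simps)
  have "mob d (- b) (- c) a (mob a b c d z) = (of_int d * mob a b c d z + of_int (- b)) * (of_int c * z + of_int d)"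
    unfolding mob_def[of d] j' by simp
  also have "\<dots> = of_int d * (mob a b c d z * (of_int c * z + of_int d)) - of_int b * (of_int c * z + of_int d)"
    by (simp add: algebra_simps)
  also have "\<dots> = (complex_of_int a * of_int d - of_int b * of_int c) * z" unfolding m by (simp add: algebra_simps)
  finally show "mob d (- b) (- c) a (mob a b c d z) = z" using det' by simp
qed

text \<open>A fraction h/k close to Re z makes |k z - h|^2 at most 5 Im z, and completing (k, -h) to
  a matrix by Bezout lifts z to height at least 1/5. Any positive constant would serve as lower
  bound for the height.\<close>

lemma SL2Z_reduction:
  assumes z: "Im z > 0"
  shows "\<exists>a b c d. a * d - b * c = (1::int) \<and> Im (mob a b c d z) \<ge> 1 / 5 \<and> \<bar>Re (mob a b c d z)\<bar> \<le> 1 / 2"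
proof -
  have "\<exists>a b c d. a * d - b * c = (1::int) \<and> Im (mob a b c d z) \<ge> 1 / 5"
  proof (cases "Im z \<ge> 1")
    case True
    then show ?thesis by (intro exI[of _ 1] exI[of _ 0]) (simp add: mob_def)
  next
    case False
    define y where "y = Im z"
    have y: "0 < y" "y < 1" using z False by (auto simp: y_def)
    \<comment> \<open>This size balances the two squares: the approximation error 1/M and the
      product k y \<le> M y are both of order sqrt y.\<close>
    define M where "M = nat \<lceil>1 / sqrt y\<rceil>"
    have "1 / sqrt y > 0" using y by simp
    then have M1: "1 / sqrt y \<le> real M" and M2: "real M \<le> 1 / sqrt y + 1"
      by (auto simp: M_def)
    have M0: "M > 0" using M1 \<open>1 / sqrt y > 0\<close> by (cases M) auto
    obtain h k where hk: "coprime h k" "0 < k" "k \<le> int M" "\<bar>of_int k * Re z - of_int h\<bar> < 1 / real M"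
      using Dirichlet_approx_coprime[of M "Re z"] M0 by auto
    obtain u v where uv: "u * h + v * k = 1"
      using bezout_int[of h k] hk(1) by (auto simp: coprime_iff_gcd_eq_1)
    have det: "(- u) * (- h) - (- v) * k = 1" using uv by simp
    have "(norm (of_int k * z + of_int (- h)))\<^sup>2 = (of_int k * Re z - of_int h)\<^sup>2 + (of_int k * y)\<^sup>2"
      by (simp add: cmod_power2 y_def)
    also have "\<dots> \<le> y + 4 * y"
    proof (rule add_mono)
      have "\<bar>of_int k * Re z - of_int h\<bar> \<le> sqrt y"
      proof -
        have "1 / real M \<le> sqrt y" using M1 M0 y by (simp add: field_simps)
        then show ?thesis using hk(4) by linarith
      qed
      then have "\<bar>of_int k * Re z - of_int h\<bar>\<^sup>2 \<le> (sqrt y)\<^sup>2" by (intro power_mono) auto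
      then show "(of_int k * Re z - of_int h)\<^sup>2 \<le> y" using y by simp
      have "real_of_int k \<le> real M" using hk(3) by linarith
      also have "real M \<le> 2 / sqrt y"
      proof -
        have "1 \<le> 1 / sqrt y" using y by (simp add: real_sqrt_le_1_iff)
        then show ?thesis using M2 by simp
      qed
      finally have "of_int k * y \<le> 2 / sqrt y * y" using y by (intro mult_right_mono) auto
      also have "\<dots> = 2 * sqrt y" using y by (simp add: field_simps)
      finally have "(of_int k * y)\<^sup>2 \<le> (2 * sqrt y)\<^sup>2" using hk(2) y by (intro power_mono) auto
      then show "(of_int k * y)\<^sup>2 \<le> 4 * y" using y by (simp add: power_mult_distrib)
    qed
    finally have "(norm (of_int k * z + of_int (- h)))\<^sup>2 \<le> 5 * y" by simp
    moreover have "(norm (of_int k * z + of_int (- h)))\<^sup>2 > 0"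
      using aut_factor_nonzero[OF det z] by simp
    ultimately have "Im (mob (- u) (- v) k (- h) z) \<ge> 1 / 5"
      unfolding Im_mob[OF det z] using y by (simp add: y_def field_simps del: of_int_minus)
    with det show ?thesis by blast
  qed
  then obtain a b c d where det: "a * d - b * c = (1::int)" and im: "Im (mob a b c d z) \<ge> 1 / 5" by blast
  \<comment> \<open>Translation by the nearest integer adjusts the real part and keeps the
    height.\<close>
  define n where "n = round (Re (mob a b c d z))"
  have det': "(a - n * c) * d - (b - n * d) * c = 1" using det by (simp add: algebra_simps)
  have "mob (a - n * c) (b - n * d) c d z = mob a b c d z - of_int n"
    using aut_factor_nonzero[OF det z] by (simp add: mob_def field_simps)
  moreover have "\<bar>Re (mob a b c d z) - of_int n\<bar> \<le> 1 / 2"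
    unfolding n_def by (metis abs_minus_commute of_int_round_abs_le)
  ultimately have "Im (mob (a - n * c) (b - n * d) c d z) \<ge> 1 / 5 \<and> \<bar>Re (mob (a - n * c) (b - n * d) c d z)\<bar> \<le> 1 / 2"
    using im by simp
  with det' show ?thesis by blast
qed

lemma slash_neg_nat_weight:
  assumes det: "a * d - b * c = (1::int)" and z: "Im z > 0"
  shows "slash (- real m) (mat2 a b c d) f z = (of_int c * z + of_int d) ^ m * f (mob a b c d z)"
proof -
  have "- real m \<in> \<int>" by simp
  then show ?thesis
    using aut_factor_nonzero[OF det z] by (simp add: slash_def multiplier_def powr_nat)
qed

text \<open>The quotient of the two matrices has the rows (A, B) and (G, E), with (G, E) congruent
  to (0, 1) modulo N. So it lies in \<open>Gamma0 N\<close> and acts on \<open>f\<close> by chi(E) =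
  1. Consequently only finitely many distinct functions arise from all of SL2(Z), which makes the
  constants at the cusps uniform.\<close>

lemma slash_cong_mod:
  assumes N: "N > 0" and chi: "dirichlet_character N chi"
    and inv: "\<And>\<gamma> z. \<gamma> \<in> Gamma0 N \<Longrightarrow> z \<in> upper_half_plane \<Longrightarrow> slash (- real m) \<gamma> f z = chi (\<gamma> $ 2 $ 2) * f z"
    and det: "a * d - b * c = (1::int)" and det': "a' * d' - b' * c' = (1::int)"
    and cong: "[a = a'] (mod int N)" "[b = b'] (mod int N)" "[c = c'] (mod int N)" "[d = d'] (mod int N)"
    and w: "Im w > 0"
  shows "slash (- real m) (mat2 a b c d) f w = slash (- real m) (mat2 a' b' c' d') f w"
proof -
  define A B G E where "A = a * d' - b * c'" and "B = b * a' - a * b'"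
    and "G = c * d' - d * c'" and "E = d * a' - c * b'"
  have "A * E - B * G = (a * d - b * c) * (a' * d' - b' * c')"
    by (simp add: A_def B_def G_def E_def algebra_simps)
  then have detD: "A * E - B * G = 1" using det det' by simp
  have "[G = c' * d' - d' * c'] (mod int N)" unfolding G_def by (intro cong_diff cong_mult cong cong_refl)
  then have "int N dvd G" by (simp add: cong_0_iff mult.commute)
  have "[E = d' * a' - c' * b'] (mod int N)" unfolding E_def by (intro cong_diff cong_mult cong cong_refl)
  then have "[E = 1] (mod int N)" using det' by (simp add: algebra_simps)
  then obtain t where t: "E = 1 + t * int N" by (metis cong_iff_lin cong_sym mult.commute)
  have per: "chi (x + int N) = chi x" for x using chi by (auto simp: dirichlet_character_def)
  have pern: "chi (x + int n * int N) = chi x" for x n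
    by (induction n) (use per[of "x + int n * int N" for n] in \<open>auto simp: algebra_simps\<close>)
  have chi1: "chi 1 = 1"
  proof -
    have "chi (1 * 1) = chi 1 * chi 1" "chi 1 \<noteq> 0" using chi unfolding dirichlet_character_def by (blast, simp)
    then show ?thesis by simp
  qed
  have "chi E = 1"
  proof (cases "t \<ge> 0")
    case True
    then show ?thesis using pern[of 1 "nat t"] chi1 by (simp add: t)
  next
    case False
    then show ?thesis using pern[of E "nat (- t)"] chi1 by (simp add: t)
  qed
  let ?w = "mob a' b' c' d' w"
  have w': "Im ?w > 0" by (rule Im_mob_pos[OF det' w])
  have "mat2 A B G E \<in> Gamma0 N" using \<open>int N dvd G\<close> detD by (simp add: Gamma0_def mat2_in_SL2Z)
  from inv[OF this, of ?w] have f_inv: "(of_int G * ?w + of_int E) ^ m * f (mob A B G E ?w) = f ?w"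
    using w' \<open>chi E = 1\<close> by (simp add: slash_neg_nat_weight[OF detD w'] upper_half_plane_def)
  have nz: "of_int c' * w + of_int d' \<noteq> (0::complex)" by (rule aut_factor_nonzero[OF det' w])
  have cdet': "complex_of_int a' * of_int d' - of_int b' * of_int c' = 1"
    using arg_cong[OF det', of complex_of_int] by simp
  have m': "?w * (of_int c' * w + of_int d') = of_int a' * w + of_int b'" using nz by (simp add: mob_def)
  have num: "(of_int A * ?w + of_int B) * (of_int c' * w + of_int d') = of_int a * w + of_int b"
  proof -
    have "(of_int A * ?w + of_int B) * (of_int c' * w + of_int d') =
       of_int A * (?w * (of_int c' * w + of_int d')) + of_int B * (of_int c' * w + of_int d')"
      by (simp add: algebra_simps)
    also have "\<dots> = (of_int a * w + of_int b) * (complex_of_int a' * of_int d' - of_int b' * of_int c')"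
      unfolding m' by (simp add: A_def B_def algebra_simps)
    finally show ?thesis using cdet' by simp
  qed
  have den: "(of_int G * ?w + of_int E) * (of_int c' * w + of_int d') = of_int c * w + of_int d"
  proof -
    have "(of_int G * ?w + of_int E) * (of_int c' * w + of_int d') =
       of_int G * (?w * (of_int c' * w + of_int d')) + of_int E * (of_int c' * w + of_int d')"
      by (simp add: algebra_simps)
    also have "\<dots> = (of_int c * w + of_int d) * (complex_of_int a' * of_int d' - of_int b' * of_int c')"
      unfolding m' by (simp add: G_def E_def algebra_simps)
    finally show ?thesis using cdet' by simp
  qed
  have "mob A B G E ?w = mob a b c d w"
    unfolding mob_def[of A] mob_def[of a] num[symmetric] den[symmetric] using nz by simp
  then show ?thesis
    unfolding slash_neg_nat_weight[OF det w] slash_neg_nat_weight[OF det' w] f_inv[symmetric] den[symmetric]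
    by (simp add: power_mult_distrib mult_ac)
qed

lemma smooth_imp_continuous_on:
  "smooth_on_upper_half_plane f \<Longrightarrow> continuous_on upper_half_plane f"
  unfolding smooth_on_upper_half_plane_def
  by (drule spec[of _ "[]"]) (simp add: differentiable_imp_continuous_on)

text \<open>This is the weight at work: with j the automorphy factor, |j|^m compensates the change
  of the height from y to y / |j|^2.\<close>

lemma powr_im_div:
  assumes "y > 0" "j \<noteq> (0::complex)"
  shows "norm j ^ m * (y / (norm j)\<^sup>2) powr (real m / 2) = y powr (real m / 2)"
proof -
  have n: "norm j > 0" using assms by simp
  have "((norm j)\<^sup>2) powr (real m / 2) = (norm j powr 2) powr (real m / 2)"
    using n by simp
  also have "\<dots> = norm j ^ m" unfolding powr_powr using n by (simp add: powr_realpow)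
  finally show ?thesis using assms n by (simp add: powr_divide)
qed

text \<open>A neighbourhood of a fundamental domain that contains the hyperbolic discs needed above.\<close>
definition cusp_region :: "complex set" where
  "cusp_region = {w. 1 / 10 \<le> Im w \<and> \<bar>Re w\<bar> \<le> 1 / 2 + Im w}"

text \<open>Closeness makes the heights comparable: t0 > 2 t would force (t - t0)^2 above t t0 / 4.
  Half of the height 1/5 is the 1/10 in \<open>cusp_region\<close>, and the horizontal distance is
  then at most t.\<close>

lemma cusp_region_near:
  assumes "Im w > 0" "1 / 5 \<le> Im w0" "\<bar>Re w0\<bar> \<le> 1 / 2" "(norm (w - w0))\<^sup>2 \<le> Im w * Im w0 / 4"
  shows "w \<in> cusp_region"
proof -
  define t t0 where "t = Im w" and "t0 = Im w0"
  have "(Re w - Re w0)\<^sup>2 + (t - t0)\<^sup>2 \<le> t * t0 / 4"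
    using assms(4) by (simp add: cmod_power2 t_def t0_def)
  then have 1: "(Re w - Re w0)\<^sup>2 \<le> t * t0 / 4" and 2: "(t - t0)\<^sup>2 \<le> t * t0 / 4"
    using zero_le_power2[of "Re w - Re w0"] zero_le_power2[of "t - t0"] by linarith+
  have t: "t > 0" "t0 \<ge> 1 / 5" using assms by (auto simp: t_def t0_def)
  have "t0 \<le> 2 * t"
  proof (rule ccontr)
    assume "\<not> t0 \<le> 2 * t"
    then have h: "t0 / 2 < t0 - t" "t < t0 / 2" by auto
    have "(t0 / 2)\<^sup>2 \<le> (t0 - t)\<^sup>2" using h t by (intro power_mono) auto
    also have "\<dots> = (t - t0)\<^sup>2" by (rule power2_commute)
    also have "\<dots> \<le> t * t0 / 4" by (rule 2)
    also have "\<dots> < t0 / 2 * t0 / 4" using h t by (intro divide_strict_right_mono mult_strict_right_mono) auto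
    finally have "t0 * t0 / 4 < t0 * t0 / 8" by (simp add: power2_eq_square)
    then show False using t by simp
  qed
  have "t * t0 / 4 \<le> t * (2 * t) / 4" using \<open>t0 \<le> 2 * t\<close> t by (intro divide_right_mono mult_left_mono) auto
  also have "\<dots> \<le> t\<^sup>2" by (simp add: power2_eq_square)
  finally have "\<bar>Re w - Re w0\<bar>\<^sup>2 \<le> t\<^sup>2" using 1 by simp
  then have "\<bar>Re w - Re w0\<bar> \<le> t" by (rule power2_le_imp_le) (use t in simp)
  then show ?thesis using \<open>t0 \<le> 2 * t\<close> t assms(3) by (simp add: cusp_region_def t_def)
qed

lemma continuous_on_slash:
  assumes f: "continuous_on upper_half_plane f" and det: "a * d - b * c = (1::int)"
  shows "continuous_on upper_half_plane (slash (- real m) (mat2 a b c d) f)"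
proof -
  have nz: "of_int c * z + of_int d \<noteq> (0::complex)" if "z \<in> upper_half_plane" for z
    using aut_factor_nonzero[OF det, of z] that by (simp add: upper_half_plane_def)
  have mob: "continuous_on upper_half_plane (mob a b c d)"
    unfolding mob_def[abs_def] by (intro continuous_intros) (use nz in auto)
  have "mob a b c d ` upper_half_plane \<subseteq> upper_half_plane"
    using Im_mob_pos[OF det] by (auto simp: upper_half_plane_def)
  then have "continuous_on upper_half_plane (\<lambda>z. f (mob a b c d z))"
    by (rule continuous_on_compose2[OF f mob])
  then have "continuous_on upper_half_plane (\<lambda>z. (of_int c * z + of_int d) ^ m * f (mob a b c d z))"
    by (intro continuous_intros)
  then show ?thesis
    by (rule continuous_on_eq) (simp add: slash_neg_nat_weight[OF det] upper_half_plane_def)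
qed

text \<open>High up the exponential error term wins; there the region becomes arbitrarily wide, so
  uniformity of the O-condition in the real part is essential. What remains is compact, and a power
  of 10 makes up for heights between 1/10 and 1.\<close>

lemma cusp_bound:
  fixes F :: "complex \<Rightarrow> complex"
  assumes F: "continuous_on upper_half_plane F"
    and P: "continuous_on upper_half_plane P" and eps: "\<epsilon> > 0"
    and O: "(\<lambda>z. norm (F z - P z)) \<in> O[Im going_to at_top](\<lambda>z. exp (- \<epsilon> * Im z))"
  shows "\<exists>K. \<forall>w\<in>cusp_region. norm (F w - P w) \<le> K * Im w powr (real m / 2)"
proof -
  from O obtain A where "eventually (\<lambda>z. norm (norm (F z - P z)) \<le> A * norm (exp (- \<epsilon> * Im z))) (Im going_to at_top)"
    by (rule landau_o.bigE)
  then obtain Y where Y: "\<And>z. Im z \<ge> Y \<Longrightarrow> norm (F z - P z) \<le> A * exp (- \<epsilon> * Im z)"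
    unfolding eventually_going_to_at_top_linorder by auto
  define Y1 where "Y1 = max Y 1"
  define S where "S = cbox (Complex (- (1 / 2 + Y1)) (1 / 10)) (Complex (1 / 2 + Y1) Y1)"
  have mem: "w \<in> S \<longleftrightarrow> \<bar>Re w\<bar> \<le> 1 / 2 + Y1 \<and> 1 / 10 \<le> Im w \<and> Im w \<le> Y1" for w
    by (auto simp: S_def in_cbox_complex_iff)
  have "S \<subseteq> upper_half_plane" using mem by (auto simp: upper_half_plane_def)
  then have "continuous_on S (\<lambda>w. F w - P w)"
    by (intro continuous_intros continuous_on_subset[OF F] continuous_on_subset[OF P])
  then have "compact ((\<lambda>w. F w - P w) ` S)" by (rule compact_continuous_image) (simp add: S_def)
  then obtain M where M: "\<And>w. w \<in> S \<Longrightarrow> norm (F w - P w) \<le> M"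
    using compact_imp_bounded bounded_iff by (metis (no_types, lifting) image_eqI)
  define K where "K = \<bar>A\<bar> + \<bar>M\<bar> * 10 powr (real m / 2)"
  show ?thesis
  proof (intro exI[of _ K] ballI)
    fix w assume w: "w \<in> cusp_region"
    show "norm (F w - P w) \<le> K * Im w powr (real m / 2)"
    proof (cases "Im w \<ge> Y1")
      case True
      then have i: "Im w \<ge> Y" "Im w \<ge> 1" by (auto simp: Y1_def)
      have "norm (F w - P w) \<le> A * exp (- \<epsilon> * Im w)" by (rule Y[OF i(1)])
      also have "\<dots> \<le> \<bar>A\<bar> * 1" using eps i by (intro mult_mono) auto
      also have "\<dots> \<le> K * Im w powr (real m / 2)"
        using i by (intro mult_mono ge_one_powr_ge_zero) (auto simp: K_def)
      finally show ?thesis .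
    next
      case False
      then have "w \<in> S" using w by (auto simp: mem cusp_region_def)
      then have "norm (F w - P w) \<le> \<bar>M\<bar> * 1" using M[of w] by simp
      also have "\<dots> \<le> \<bar>M\<bar> * (10 * Im w) powr (real m / 2)"
        using w by (intro mult_left_mono ge_one_powr_ge_zero) (auto simp: cusp_region_def)
      also have "\<dots> = (\<bar>M\<bar> * 10 powr (real m / 2)) * Im w powr (real m / 2)"
        using w by (simp add: powr_mult cusp_region_def)
      also have "\<dots> \<le> K * Im w powr (real m / 2)"
        by (intro mult_right_mono) (auto simp: K_def)
      finally show ?thesis .
    qed
  qed
qed

lemma continuous_on_qpow: "continuous_on A (qpow r)"
  unfolding qpow_def[abs_def] by (intro continuous_intros)

lemma qpow_holomorphic: "qpow r holomorphic_on A"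
  unfolding qpow_def[abs_def] by (intro holomorphic_intros)

lemma continuous_on_poly_compose: "continuous_on A g \<Longrightarrow> continuous_on A (\<lambda>z. poly P (g z :: complex))"
  by (induction P) (auto intro!: continuous_intros)

lemma holomorphic_on_poly_compose: "g holomorphic_on A \<Longrightarrow> (\<lambda>z. poly P (g z)) holomorphic_on A"
  by (induction P) (auto intro!: holomorphic_intros)

text \<open>Some matrix carries z0 to bounded real part and height at least 1/5, and the points near
  z0 into \<open>cusp_region\<close>. There \<open>f\<close>, slashed by the inverse matrix, differs
  little from a principal part. The polynomial may depend on the matrix, but the constant must
  not.\<close>

theorem harmonic_maass_form_near_holomorphic:
  assumes N: "N > 0" and chi: "dirichlet_character N chi" and f: "harmonic_maass_form (- real m) N chi f"
  shows "near_holomorphic m f"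
proof -
  have smooth: "smooth_on_upper_half_plane f"
    and inv: "\<And>\<gamma> z. \<gamma> \<in> Gamma0 N \<Longrightarrow> z \<in> upper_half_plane \<Longrightarrow> slash (- real m) \<gamma> f z = chi (\<gamma> $ 2 $ 2) * f z"
    and cusps: "\<And>\<sigma>. \<sigma> \<in> SL2Z \<Longrightarrow> \<exists>(P :: complex poly) \<epsilon>. \<epsilon> > 0 \<and>
        (\<lambda>z. norm (slash (- real m) \<sigma> f z - poly P (qpow (- 1 / real N) z)))
          \<in> O[Im going_to at_top](\<lambda>z. exp (- \<epsilon> * Im z))"
    using f unfolding harmonic_maass_form_def by auto
  note cont = smooth_imp_continuous_on[OF smooth]
  define good where "good \<sigma> K \<longleftrightarrow> (\<exists>P :: complex poly. \<forall>w\<in>cusp_region.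
      norm (slash (- real m) \<sigma> f w - poly P (qpow (- 1 / real N) w)) \<le> K * Im w powr (real m / 2))" for \<sigma> K
  have ex_good: "\<exists>K. good (mat2 a b c d) K" if det: "a * d - b * c = 1" for a b c d
  proof -
    have "mat2 a b c d \<in> SL2Z" using det by (simp add: mat2_in_SL2Z)
    from cusps[OF this] obtain P :: "complex poly" and \<epsilon> where P: "\<epsilon> > 0"
      "(\<lambda>z. norm (slash (- real m) (mat2 a b c d) f z - poly P (qpow (- 1 / real N) z)))
          \<in> O[Im going_to at_top](\<lambda>z. exp (- \<epsilon> * Im z))" by blast
    show ?thesis
      unfolding good_def
      using cusp_bound[OF continuous_on_slash[OF cont det] continuous_on_poly_compose[OF continuous_on_qpow] P, of m]
      by blast
  qed
  define T where "T = {0..<int N} \<times> {0..<int N} \<times> {0..<int N} \<times> {0..<int N}"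
  \<comment> \<open>One constant for each residue class \<open>r\<close> modulo N; for a class
    without a matrix of determinant 1 the claim is vacuous.\<close>
  have "\<exists>K. \<forall>a b c d. a * d - b * c = 1 \<longrightarrow> (a mod int N, b mod int N, c mod int N, d mod int N) = r \<longrightarrow>
      good (mat2 a b c d) K" for r
  proof (cases "\<exists>a b c d. a * d - b * c = 1 \<and> (a mod int N, b mod int N, c mod int N, d mod int N) = r")
    case True
    then obtain a b c d where det: "a * d - b * c = 1"
      and r: "(a mod int N, b mod int N, c mod int N, d mod int N) = r" by blast
    obtain K where K: "good (mat2 a b c d) K" using ex_good[OF det] by blast
    have "good (mat2 a' b' c' d') K" if det': "a' * d' - b' * c' = 1"
      and r': "(a' mod int N, b' mod int N, c' mod int N, d' mod int N) = r" for a' b' c' d'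
    proof -
      have cg: "[a' = a] (mod int N)" "[b' = b] (mod int N)" "[c' = c] (mod int N)" "[d' = d] (mod int N)"
        using r r' by (auto simp: cong_def)
      have "slash (- real m) (mat2 a' b' c' d') f w = slash (- real m) (mat2 a b c d) f w" if "w \<in> cusp_region" for w
        using that by (intro slash_cong_mod[OF N chi inv det' det cg]) (auto simp: cusp_region_def)
      with K show ?thesis unfolding good_def by auto
    qed
    then show ?thesis by blast
  qed auto
  then obtain K where K: "\<And>a b c d. a * d - b * c = 1 \<Longrightarrow>
     good (mat2 a b c d) (K (a mod int N, b mod int N, c mod int N, d mod int N))" by metis
  define B where "B = (\<Sum>r\<in>T. \<bar>K r\<bar>)"
  have fin: "finite T" by (simp add: T_def)
  have good: "good (mat2 a b c d) B" if det: "a * d - b * c = 1" for a b c d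
  proof -
    let ?r = "(a mod int N, b mod int N, c mod int N, d mod int N)"
    have "?r \<in> T" using N by (simp add: T_def)
    then have "\<bar>K ?r\<bar> \<le> B" unfolding B_def by (intro member_le_sum fin) auto
    then have "K ?r * x \<le> B * x" if "x \<ge> 0" for x using that by (intro mult_right_mono) auto
    then show ?thesis using K[OF det] unfolding good_def by (meson order_trans powr_ge_zero)
  qed
  show ?thesis
    unfolding near_holomorphic_def
  proof (intro exI[of _ B] ballI)
    fix z0 assume "z0 \<in> upper_half_plane"
    then have z0: "Im z0 > 0" by (simp add: upper_half_plane_def)
    obtain a b c d where det: "a * d - b * c = (1::int)" and im: "Im (mob a b c d z0) \<ge> 1 / 5"
      and re: "\<bar>Re (mob a b c d z0)\<bar> \<le> 1 / 2"
      using SL2Z_reduction[OF z0] by blast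
    have det': "d * a - (- b) * (- c) = 1" using det by (simp add: mult.commute)
    obtain P :: "complex poly" where P: "\<And>w. w \<in> cusp_region \<Longrightarrow>
      norm (slash (- real m) (mat2 d (- b) (- c) a) f w - poly P (qpow (- 1 / real N) w)) \<le> B * Im w powr (real m / 2)"
      using good[OF det'] unfolding good_def by blast
    \<comment> \<open>The principal part pulled back to z0: by \<open>mob_inverse\<close> the two
      automorphy factors have product 1, so slashing by the inverse matrix and then undoing it
      returns \<open>f\<close>.\<close>
    define H where "H z = (of_int c * z + of_int d) ^ m * poly P (qpow (- 1 / real N) (mob a b c d z))" for z
    show "\<exists>H. H holomorphic_on upper_half_plane \<and>
     (\<forall>z\<in>upper_half_plane. (norm (z - z0))\<^sup>2 \<le> Im z * Im z0 / 4 \<longrightarrow> norm (f z - H z) \<le> B * Im z powr (real m / 2))"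
    proof (intro exI[of _ H] conjI ballI impI)
      have "mob a b c d holomorphic_on upper_half_plane"
        unfolding mob_def[abs_def] by (intro holomorphic_intros) (use aut_factor_nonzero[OF det] in \<open>auto simp: upper_half_plane_def\<close>)
      from holomorphic_on_compose[OF this qpow_holomorphic[of "- 1 / real N"]]
      show "H holomorphic_on upper_half_plane"
        unfolding H_def by (intro holomorphic_intros holomorphic_on_poly_compose) (simp add: o_def)
      fix z assume "z \<in> upper_half_plane" and close: "(norm (z - z0))\<^sup>2 \<le> Im z * Im z0 / 4"
      then have z: "Im z > 0" by (simp add: upper_half_plane_def)
      let ?j = "of_int c * z + of_int d :: complex" and ?w = "mob a b c d z"
      have w: "Im ?w > 0" by (rule Im_mob_pos[OF det z])
      have "?w \<in> cusp_region"
        by (rule cusp_region_near[OF w im re mob_close[OF det z z0 close]])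
      note bound = P[OF this]
      have j: "?j \<noteq> 0" by (rule aut_factor_nonzero[OF det z])
      have "?j ^ m * slash (- real m) (mat2 d (- b) (- c) a) f ?w =
         (?j * (of_int (- c) * ?w + of_int a)) ^ m * f (mob d (- b) (- c) a ?w)"
        unfolding slash_neg_nat_weight[OF det' w] by (simp only: power_mult_distrib mult.assoc)
      also have "\<dots> = f z"
        unfolding mob_inverse[OF det z] by simp
      finally have "f z - H z = ?j ^ m * (slash (- real m) (mat2 d (- b) (- c) a) f ?w - poly P (qpow (- 1 / real N) ?w))"
        by (simp add: H_def right_diff_distrib)
      then have "norm (f z - H z) = norm ?j ^ m * norm (slash (- real m) (mat2 d (- b) (- c) a) f ?w - poly P (qpow (- 1 / real N) ?w))"
        by (simp add: norm_mult norm_power)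
      also have "\<dots> \<le> norm ?j ^ m * (B * Im ?w powr (real m / 2))"
        by (intro mult_left_mono bound) simp
      also have "\<dots> = B * (norm ?j ^ m * (Im z / (norm ?j)\<^sup>2) powr (real m / 2))"
        unfolding Im_mob[OF det z] by (simp only: mult_ac)
      also have "\<dots> = B * Im z powr (real m / 2)"
        by (simp only: powr_im_div[OF z j])
      finally show "norm (f z - H z) \<le> B * Im z powr (real m / 2)" .
    qed
  qed
qed

section \<open>Transfer to the Fricke image\<close>

lemma fricke_neg_nat_weight:
  assumes "N > 0" "Im z > 0"
  shows "fricke (- real m) N f z = of_real (real N powr (- real m / 2)) * (of_nat N * z) ^ m * f (- 1 / (of_nat N * z))"
proof -
  have "of_nat N * z \<noteq> 0" using assms by auto
  then show ?thesis by (simp add: fricke_def powr_nat)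
qed

text \<open>z -> -1/(N z) is a hyperbolic isometry, so it preserves closeness, and the powers of N
  in the slash factor and in Im cancel; the same \<open>B\<close> works. Transporting the condition
  along this map replaces a study of the cusps of the Fricke image.\<close>

theorem near_holomorphic_fricke:
  assumes N: "N > 0" and near: "near_holomorphic m f"
  shows "near_holomorphic m (fricke (- real m) N f)"
proof -
  obtain B where B: "\<And>z0. z0 \<in> upper_half_plane \<Longrightarrow> \<exists>H. H holomorphic_on upper_half_plane \<and>
     (\<forall>z\<in>upper_half_plane. (norm (z - z0))\<^sup>2 \<le> Im z * Im z0 / 4 \<longrightarrow> norm (f z - H z) \<le> B * Im z powr (real m / 2))"
    using near unfolding near_holomorphic_def by blast
  let ?w = "\<lambda>z :: complex. - 1 / (of_nat N * z)"
  have imw: "Im (?w z) = Im z / real N / (norm z)\<^sup>2" for z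
  proof -
    have "Im (?w z) = Im (of_nat N * z) / (norm (of_nat N * z))\<^sup>2"
      by (simp add: Im_divide cmod_power2)
    also have "\<dots> = real N * Im z / (real N * norm z)\<^sup>2" by (simp add: norm_mult)
    finally show ?thesis using N by (simp add: power2_eq_square)
  qed
  have imw_pos: "Im (?w z) > 0" if "Im z > 0" for z
  proof -
    have "z \<noteq> 0" using that by auto
    then show ?thesis unfolding imw using that N by simp
  qed
  show ?thesis
    unfolding near_holomorphic_def
  proof (intro exI[of _ B] ballI)
    fix z0 assume "z0 \<in> upper_half_plane"
    then have z0: "Im z0 > 0" by (simp add: upper_half_plane_def)
    obtain H' where H': "H' holomorphic_on upper_half_plane"
      "\<And>z. Im z > 0 \<Longrightarrow> (norm (z - ?w z0))\<^sup>2 \<le> Im z * Im (?w z0) / 4 \<Longrightarrow> norm (f z - H' z) \<le> B * Im z powr (real m / 2)"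
      using B[of "?w z0"] imw_pos[OF z0] unfolding upper_half_plane_def by blast
    define H where "H z = of_real (real N powr (- real m / 2)) * (of_nat N * z) ^ m * H' (?w z)" for z
    show "\<exists>H. H holomorphic_on upper_half_plane \<and>
     (\<forall>z\<in>upper_half_plane. (norm (z - z0))\<^sup>2 \<le> Im z * Im z0 / 4 \<longrightarrow>
        norm (fricke (- real m) N f z - H z) \<le> B * Im z powr (real m / 2))"
    proof (intro exI[of _ H] conjI ballI impI)
      have "?w holomorphic_on upper_half_plane"
        by (intro holomorphic_intros) (use N in \<open>auto simp: upper_half_plane_def\<close>)
      moreover have "?w ` upper_half_plane \<subseteq> upper_half_plane"
        using imw_pos by (auto simp: upper_half_plane_def)
      ultimately have "(H' \<circ> ?w) holomorphic_on upper_half_plane"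
        by (rule holomorphic_on_compose_gen[OF _ H'(1)])
      then show "H holomorphic_on upper_half_plane"
        unfolding H_def by (intro holomorphic_intros) (simp add: o_def)
      fix z assume "z \<in> upper_half_plane" and close: "(norm (z - z0))\<^sup>2 \<le> Im z * Im z0 / 4"
      then have z: "Im z > 0" by (simp add: upper_half_plane_def)
      have nz: "z \<noteq> 0" "z0 \<noteq> 0" using z z0 by auto
      have "?w z - ?w z0 = (z - z0) / (of_nat N * z * z0)"
        using nz N by (simp add: field_simps)
      then have "(norm (?w z - ?w z0))\<^sup>2 = (norm (z - z0))\<^sup>2 / ((real N)\<^sup>2 * (norm z)\<^sup>2 * (norm z0)\<^sup>2)"
        by (simp add: norm_divide norm_mult power_divide power_mult_distrib)
      also have "\<dots> \<le> (Im z * Im z0 / 4) / ((real N)\<^sup>2 * (norm z)\<^sup>2 * (norm z0)\<^sup>2)"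
        using close by (intro divide_right_mono) auto
      also have "\<dots> = Im (?w z) * Im (?w z0) / 4"
        unfolding imw by (simp add: power2_eq_square)
      finally have bound: "norm (f (?w z) - H' (?w z)) \<le> B * Im (?w z) powr (real m / 2)"
        by (rule H'(2)[OF imw_pos[OF z]])
      have "fricke (- real m) N f z - H z =
          of_real (real N powr (- real m / 2)) * (of_nat N * z) ^ m * (f (?w z) - H' (?w z))"
        by (simp add: fricke_neg_nat_weight[OF N z] H_def right_diff_distrib)
      then have "norm (fricke (- real m) N f z - H z) =
          real N powr (- real m / 2) * (real N ^ m * norm z ^ m) * norm (f (?w z) - H' (?w z))"
        by (simp add: norm_mult norm_power power_mult_distrib)
      also have "\<dots> \<le> real N powr (- real m / 2) * (real N ^ m * norm z ^ m) * (B * Im (?w z) powr (real m / 2))"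
        by (intro mult_left_mono bound) simp
      also have "\<dots> = real N powr (- real m / 2) * real N ^ m * B *
          (norm z ^ m * (Im z / real N / (norm z)\<^sup>2) powr (real m / 2))"
        unfolding imw by (simp only: mult_ac)
      also have "\<dots> = real N powr (- real m / 2) * real N ^ m * B * (Im z / real N) powr (real m / 2)"
        using powr_im_div[of "Im z / real N" z m] z N nz by simp
      also have "\<dots> = B * Im z powr (real m / 2)"
      proof -
        have "real N ^ m = real N powr (real m / 2) * real N powr (real m / 2)"
          using N by (simp add: powr_realpow flip: powr_add)
        then show ?thesis using N z by (simp add: powr_divide powr_minus field_simps)
      qed
      finally show "norm (fricke (- real m) N f z - H z) \<le> B * Im z powr (real m / 2)" .
    qed
  qed
qed

section \<open>Weakly holomorphic forms\<close>

text \<open>The real part h r x lets x in [0, 1] run through r periods of length h, so index n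
  acquires the frequency r n. The extra parameter allows expansions of different widths to be
  sampled along the same segment.\<close>

lemma qpow_Complex:
  assumes "h > 0"
  shows "qpow (of_int n / real h) (Complex (real h * (real r * x)) y) =
    of_real (exp (- (2 * pi * of_int n * y / real h))) * cis2pi (int r * n) x"
proof -
  have "2 * of_real pi * \<i> * of_real (of_int n / real h) * Complex (real h * (real r * x)) y =
      of_real (- (2 * pi * of_int n * y / real h)) + 2 * of_real pi * \<i> * of_int (int r * n) * of_real x"
    using assms by (simp add: complex_eq_iff)
  then show ?thesis
    unfolding qpow_def cis2pi_def by (simp only: exp_add exp_of_real)
qed

text \<open>Frequency - r n is produced by index -n of the holomorphic series and by index n of the
  other one, and by nothing else since r > 0. The order of the quantifiers is the content:
  \<open>p\<close>, which is a(-n), or 0 if that index is below the range, does not depend on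
  y.\<close>

lemma maass_expansion_fourier_coeff:
  assumes E: "has_maass_expansion k h m a b F" and h: "h > 0" and r: "r > 0" and n: "n \<ge> 1"
  shows "\<exists>p. \<forall>y>0. fourier_coeff (- (int r * n)) (\<lambda>x. F (Complex (real h * (real r * x)) y)) =
    (p + b n * of_real (inc_Gamma (1 - k) (4 * pi * of_int n * y / real h))) * of_real (exp (2 * pi * of_int n * y / real h))"
proof (intro exI allI impI)
  let ?p = "if n \<le> int m then a (- n) else 0"
  fix y :: real assume y: "y > 0"
  let ?e = "of_real (exp (2 * pi * of_int n * y / real h)) :: complex"
  define \<alpha> where "\<alpha> i = a (- int m + int i) * of_real (exp (- (2 * pi * of_int (- int m + int i) * y / real h)))" for i
  define \<beta> where "\<beta> i = b (1 + int i) * of_real (inc_Gamma (1 - k) (4 * pi * of_int (1 + int i) * y / real h)) *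
      of_real (exp (- (2 * pi * of_int (- (1 + int i)) * y / real h)))" for i
  let ?z = "\<lambda>x. Complex (real h * (real r * x)) y"
  note q = qpow_Complex[OF h, of _ r _ y]
  have z: "?z x \<in> upper_half_plane" for x using y by (simp add: upper_half_plane_def)
  have EZ: "(\<lambda>n. a n * qpow (of_int n / real h) (?z x)) summable_on {- int m..} \<and>
     (\<lambda>n. b n * of_real (inc_Gamma (1 - k) (4 * pi * of_int n * y / real h)) * qpow (of_int (- n) / real h) (?z x)) summable_on {1..} \<and>
     F (?z x) = (\<Sum>\<^sub>\<infinity>n\<in>{- int m..}. a n * qpow (of_int n / real h) (?z x)) +
       (\<Sum>\<^sub>\<infinity>n\<in>{1..}. b n * of_real (inc_Gamma (1 - k) (4 * pi * of_int n * y / real h)) * qpow (of_int (- n) / real h) (?z x))" for x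
    using E[unfolded has_maass_expansion_def, rule_format, OF z[of x]] by simp
  note s = EZ[unfolded summable_on_int_atLeast_iff, THEN conjunct1] EZ[unfolded summable_on_int_atLeast_iff, THEN conjunct2, THEN conjunct1]
  have a: "summable (\<lambda>i. norm (\<alpha> i))"
    using s(1)[of 0] h unfolding q \<alpha>_def by (simp add: norm_mult)
  have b: "summable (\<lambda>i. norm (\<beta> i))"
    using s(2)[of 0] h unfolding q \<beta>_def by (simp add: norm_mult)
  have "F (?z x) = (\<Sum>i. \<alpha> i * cis2pi (int r * (- int m + int i)) x) + (\<Sum>i. \<beta> i * cis2pi (int r * (- (1 + int i))) x)" for x
    unfolding EZ[THEN conjunct2, THEN conjunct2] infsum_int_atLeast[OF s(1)] infsum_int_atLeast[OF s(2)]
    unfolding q \<alpha>_def \<beta>_def by (simp only: mult.assoc)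
  then have "fourier_coeff (- (int r * n)) (\<lambda>x. F (?z x)) =
      fourier_coeff (- (int r * n)) (\<lambda>x. \<Sum>i. \<alpha> i * cis2pi (int r * (- int m + int i)) x) +
      fourier_coeff (- (int r * n)) (\<lambda>x. \<Sum>i. \<beta> i * cis2pi (int r * (- (1 + int i))) x)"
    unfolding fourier_coeff_def
    using fourier_coeff_suminf(1)[OF a, of "\<lambda>i. int r * (- int m + int i)" "- (int r * n)"]
      fourier_coeff_suminf(1)[OF b, of "\<lambda>i. int r * (- (1 + int i))" "- (int r * n)"]
    by (simp only: distrib_right scaleR_add_right Bochner_Integration.integral_add)
  also have "fourier_coeff (- (int r * n)) (\<lambda>x. \<Sum>i. \<alpha> i * cis2pi (int r * (- int m + int i)) x) = ?p * ?e"
  proof (cases "n \<le> int m")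
    case True
    define i0 where "i0 = nat (int m - n)"
    have i0: "- int m + int i0 = - n" using True by (simp add: i0_def)
    have "(\<Sum>i. if int r * (- int m + int i) = int r * (- int m + int i0) then \<alpha> i else 0) = \<alpha> i0"
      by (rule suminf_if_inj) (use r in \<open>auto simp: inj_def\<close>)
    moreover have "\<alpha> i0 = ?p * ?e" using True unfolding \<alpha>_def i0 by simp
    ultimately show ?thesis unfolding fourier_coeff_suminf(2)[OF a] i0 by simp
  next
    case False
    then have "int r * (- int m + int i) \<noteq> - (int r * n)" for i
    proof -
      have "int r * (- int m + int i) \<noteq> int r * (- n)" using False r by (simp only: mult_cancel_left) auto
      then show ?thesis by simp
    qed
    then show ?thesis unfolding fourier_coeff_suminf(2)[OF a] using False by simp
  qed
  also have "fourier_coeff (- (int r * n)) (\<lambda>x. \<Sum>i. \<beta> i * cis2pi (int r * (- (1 + int i))) x) =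
     b n * of_real (inc_Gamma (1 - k) (4 * pi * of_int n * y / real h)) * ?e"
  proof -
    define i0 where "i0 = nat (n - 1)"
    have i0: "1 + int i0 = n" using n by (simp add: i0_def)
    have "(\<Sum>i. if int r * (- (1 + int i)) = int r * (- (1 + int i0)) then \<beta> i else 0) = \<beta> i0"
      by (rule suminf_if_inj) (use r in \<open>auto simp: inj_def\<close>)
    moreover have "\<beta> i0 = b n * of_real (inc_Gamma (1 - k) (4 * pi * of_int n * y / real h)) * ?e"
      unfolding \<beta>_def i0 by simp
    ultimately show ?thesis unfolding fourier_coeff_suminf(2)[OF b] i0 by simp
  qed
  finally show "fourier_coeff (- (int r * n)) (\<lambda>x. F (?z x)) =
    (?p + b n * of_real (inc_Gamma (1 - k) (4 * pi * of_int n * y / real h))) * ?e"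
    by (simp add: distrib_right)
qed

text \<open>Expansions of different width are compared on the common period \<open>N\<close>; the factor
  \<open>\<Gamma>(1-k, 4\<pi>ny)\<close> of \<open>b n\<close> depends on \<open>y\<close>, whereas everything else is constant in \<open>y\<close>.\<close>
lemma minus_coefficients_vanish:
  assumes E: "has_maass_expansion k 1 m a b F" and E': "has_maass_expansion k N m' a' (\<lambda>_. 0) F"
    and N: "N > 0" and n: "n \<ge> 1"
  shows "b n = 0"
proof (rule ccontr)
  assume b: "b n \<noteq> 0"
  \<comment> \<open>Width 1 sampled over N periods and width N sampled over one period use the same
    points. Index n in the former corresponds to index N n in the latter.\<close>
  obtain p where p: "\<And>y. y > 0 \<Longrightarrow> fourier_coeff (- (int N * n)) (\<lambda>x. F (Complex (real N * x) y)) =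
    (p + b n * of_real (inc_Gamma (1 - k) (4 * pi * of_int n * y))) * of_real (exp (2 * pi * of_int n * y))"
    using maass_expansion_fourier_coeff[OF E _ N n] by auto
  have "1 \<le> int N * n" using N n by (simp add: int_one_le_iff_zero_less zero_less_mult_iff)
  from maass_expansion_fourier_coeff[OF E' N, of 1, OF _ this]
  obtain p' where p': "\<And>y. y > 0 \<Longrightarrow> fourier_coeff (- (int N * n)) (\<lambda>x. F (Complex (real N * x) y)) =
    p' * of_real (exp (2 * pi * of_int n * y))"
    using N by (auto simp: mult_ac)
  have eq: "p + b n * of_real (inc_Gamma (1 - k) (4 * pi * of_int n * y)) = p'" if "y > 0" for y
    using p[OF that] p'[OF that] by simp
  have "b n * of_real (inc_Gamma (1 - k) (4 * pi * of_int n * 1)) = b n * of_real (inc_Gamma (1 - k) (4 * pi * of_int n * 2))"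
    using eq[of 1] eq[of 2] by (metis add_left_cancel zero_less_numeral zero_less_one)
  then have "inc_Gamma (1 - k) (4 * pi * of_int n * 1) = inc_Gamma (1 - k) (4 * pi * of_int n * 2)"
    using b by simp
  moreover have "inc_Gamma (1 - k) (4 * pi * of_int n * 2) < inc_Gamma (1 - k) (4 * pi * of_int n * 1)"
    using n by (intro inc_Gamma_strict_antimono) auto
  ultimately show False by simp
qed

lemma slash_identity: "slash k (mat2 1 0 0 1) f z = f z"
proof -
  have "kronecker 0 1 = 1" by (simp add: kronecker_def)
  then show ?thesis by (simp add: slash_def multiplier_def mob_def theta_eps_def)
qed

text \<open>The inversion matrix lies outside \<open>Gamma0 4\<close>, so its multiplier is 1 also
  for half-integral weight, and the two principal powers agree literally.\<close>

lemma fricke_eq_slash: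
  assumes "N > 0"
  shows "fricke k N f z = of_real (real N powr (k / 2)) * slash k (mat2 0 (- 1) 1 0) f (of_nat N * z)"
  by (simp add: fricke_def slash_def multiplier_def mob_def Gamma0_def)

text \<open>The identity matrix gives the vanishing for \<open>f\<close>. For the Fricke image, the
  expansion of width N at the cusp 0 is rescaled by z -> N z to one of width 1, and the two
  expansions are compared.\<close>

lemma weakly_holomorphic_minus_coefficients:
  assumes N: "N > 0" and f: "weakly_holomorphic_form k N chi f" and n: "n \<ge> 1"
  shows "has_maass_expansion k 1 n0 cp cm f \<Longrightarrow> cm n = 0"
    and "has_maass_expansion k 1 n0 dp dm (fricke k N f) \<Longrightarrow> dm n = 0"
proof -
  have w: "\<exists>m a. has_maass_expansion k N m a (\<lambda>_. 0) (slash k \<sigma> f)" if "\<sigma> \<in> SL2Z" for \<sigma>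
    using f that by (simp add: weakly_holomorphic_form_def)
  obtain m a where "has_maass_expansion k N m a (\<lambda>_. 0) (slash k (mat2 1 0 0 1) f)"
    using w[of "mat2 1 0 0 1"] by (auto simp: mat2_in_SL2Z)
  then have "has_maass_expansion k N m a (\<lambda>_. 0) f" by (simp add: slash_identity has_maass_expansion_def)
  then show "has_maass_expansion k 1 n0 cp cm f \<Longrightarrow> cm n = 0"
    using minus_coefficients_vanish N n by blast
  obtain m' a' where E': "has_maass_expansion k N m' a' (\<lambda>_. 0) (slash k (mat2 0 (- 1) 1 0) f)"
    using w[of "mat2 0 (- 1) 1 0"] by (auto simp: mat2_in_SL2Z)
  let ?c = "of_real (real N powr (k / 2)) :: complex"
  have "has_maass_expansion k 1 m' (\<lambda>n. ?c * a' n) (\<lambda>_. 0) (fricke k N f)"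
    unfolding has_maass_expansion_def
  proof (intro ballI)
    fix z assume "z \<in> upper_half_plane"
    then have "of_nat N * z \<in> upper_half_plane" using N by (simp add: upper_half_plane_def)
    note E'' = E'[unfolded has_maass_expansion_def, rule_format, OF this]
    have q: "qpow (of_int n / real N) (of_nat N * z) = qpow (of_int n) z" for n
      using N by (simp add: qpow_def mult_ac)
    have s: "(\<lambda>n. a' n * qpow (of_int n) z) summable_on {- int m'..}"
      and v: "slash k (mat2 0 (- 1) 1 0) f (of_nat N * z) = (\<Sum>\<^sub>\<infinity>n\<in>{- int m'..}. a' n * qpow (of_int n) z)"
      using E'' by (simp_all add: q)
    have "(\<lambda>n. ?c * a' n * qpow (of_int n) z) summable_on {- int m'..}"
      using summable_on_cmult_right[OF s, of ?c] by (simp only: mult.assoc)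
    moreover have "(\<Sum>\<^sub>\<infinity>n\<in>{- int m'..}. ?c * a' n * qpow (of_int n) z) = ?c * (\<Sum>\<^sub>\<infinity>n\<in>{- int m'..}. a' n * qpow (of_int n) z)"
      unfolding mult.assoc by (rule infsum_cmult_right) (use s in simp)
    ultimately show "(\<lambda>n. ?c * a' n * qpow (of_int n / real 1) z) summable_on {- int m'..} \<and>
        (\<lambda>n. 0 * of_real (inc_Gamma (1 - k) (4 * pi * of_int n * Im z / real 1)) * qpow (- of_int n / real 1) z) summable_on {1..} \<and>
        fricke k N f z = (\<Sum>\<^sub>\<infinity>n\<in>{- int m'..}. ?c * a' n * qpow (of_int n / real 1) z) +
          (\<Sum>\<^sub>\<infinity>n\<in>{1..}. 0 * of_real (inc_Gamma (1 - k) (4 * pi * of_int n * Im z / real 1)) * qpow (- of_int n / real 1) z)"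
      by (simp add: fricke_eq_slash[OF N] v)
  qed
  then show "has_maass_expansion k 1 n0 dp dm (fricke k N f) \<Longrightarrow> dm n = 0"
    using minus_coefficients_vanish[of k n0 dp dm "fricke k N f" 1] n by (metis less_one)
qed

section \<open>Termwise integration\<close>

lemma summable_int_shift:
  fixes g :: "int \<Rightarrow> real"
  assumes "summable (\<lambda>n. g (int n))"
  shows "summable (\<lambda>n. g (c + int n))"
proof (cases "c \<ge> 0")
  case True
  then have "g (c + int n) = g (int (n + nat c))" for n by (simp add: add.commute)
  then show ?thesis using summable_ignore_initial_segment[OF assms, of "nat c"] by simp
next
  case False
  then have "g (c + int (n + nat (- c))) = g (int n)" for n by simp
  then have "summable (\<lambda>n. g (c + int (n + nat (- c))))" using assms by simp
  then show ?thesis by (subst (asm) summable_iff_shift[of "\<lambda>n. g (c + int n)"])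
qed

lemma summable_inverse_square_bigo:
  fixes f :: "nat \<Rightarrow> real"
  assumes "f \<in> O(\<lambda>n. inverse (real n ^ 2))"
  shows "summable f"
proof -
  have "summable (\<lambda>n. inverse (real n ^ 2))" by (rule inverse_power_summable) simp
  then have "summable (\<lambda>n. norm (inverse (real n ^ 2)))" by simp
  from summable_comparison_test_bigo[OF this assms] show ?thesis .
qed

text \<open>The Bessel functions decay like exp(-\<beta> sqrt n) with \<beta>^2 = 8 pi A / s, so the
  hypothesis on \<open>C\<close> says |C| < \<beta>. The surplus \<delta> = \<beta> - C absorbs
  every power of n, including the one from (A / b n)^(\<nu>/2).\<close>

lemma summable_bessel_integrals:
  fixes a :: "nat \<Rightarrow> real"
  assumes a: "a \<in> O(\<lambda>n. exp (C * sqrt (real n)))" and pos: "s > 0" "A > 0" "B > 0"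
    and C: "C\<^sup>2 < 8 * pi * A / s"
  shows "summable (\<lambda>n. a n * real n ^ l * (\<integral>u. bessel_kernel \<nu> A (B + 2 * pi * real n / s) u \<partial>lborel))"
proof (rule summable_inverse_square_bigo)
  define b where "b n = B + 2 * pi * real n / s" for n
  have b: "b n \<ge> B" "b n > 0" for n using pos by (auto simp: b_def add_pos_nonneg)
  define x0 where "x0 = 2 * sqrt (A * B)"
  define M where "M = exp x0 * bessel_K \<nu> x0"
  define \<beta> where "\<beta> = 2 * sqrt (2 * pi * A / s)"
  have x0: "x0 > 0" using pos by (simp add: x0_def)
  have "\<bar>C\<bar> < \<beta>"
  proof (rule power2_less_imp_less)
    have "\<beta>\<^sup>2 = 8 * pi * A / s" using pos by (simp add: \<beta>_def power_mult_distrib)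
    then show "\<bar>C\<bar>\<^sup>2 < \<beta>\<^sup>2" using C by simp
  qed (use pos in \<open>simp add: \<beta>_def\<close>)
  define \<delta> where "\<delta> = \<beta> - C"
  have \<delta>: "\<delta> > 0" using \<open>\<bar>C\<bar> < \<beta>\<close> by (simp add: \<delta>_def)
  have I: "norm (\<integral>u. bessel_kernel \<nu> A (b n) u \<partial>lborel) \<le> 2 * M * norm ((A / b n) powr (\<nu> / 2) * exp (- \<beta> * sqrt (real n)))" for n
  proof -
    have "\<beta> * sqrt (real n) = 2 * sqrt (A * (2 * pi * real n / s))"
      by (simp add: \<beta>_def flip: real_sqrt_mult)
    also have "\<dots> \<le> 2 * sqrt (A * b n)"
      using pos by (intro mult_left_mono real_sqrt_le_mono) (auto simp: b_def)
    finally have le: "\<beta> * sqrt (real n) \<le> 2 * sqrt (A * b n)" .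
    have x: "x0 \<le> 2 * sqrt (A * b n)" unfolding x0_def using pos b(1)[of n] by (intro mult_left_mono real_sqrt_le_mono) auto
    have "bessel_K \<nu> (2 * sqrt (A * b n)) \<le> M * exp (- (2 * sqrt (A * b n)))"
      unfolding M_def by (rule bessel_K_le[OF x0 x])
    also have "\<dots> \<le> M * exp (- \<beta> * sqrt (real n))"
      using le bessel_K_nonneg[OF x0, of \<nu>] by (intro mult_left_mono) (auto simp: M_def)
    finally have K: "bessel_K \<nu> (2 * sqrt (A * b n)) \<le> M * exp (- \<beta> * sqrt (real n))" .
    have "bessel_K \<nu> (2 * sqrt (A * b n)) \<ge> 0" using x x0 by (intro bessel_K_nonneg) linarith
    then have "norm (\<integral>u. bessel_kernel \<nu> A (b n) u \<partial>lborel) = 2 * (A / b n) powr (\<nu> / 2) * bessel_K \<nu> (2 * sqrt (A * b n))"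
      unfolding integral_bessel_kernel[OF pos(2) b(2)] by (simp add: abs_mult)
    also have "\<dots> \<le> 2 * (A / b n) powr (\<nu> / 2) * (M * exp (- \<beta> * sqrt (real n)))"
      by (intro mult_left_mono K) auto
    finally show ?thesis by (simp add: mult_ac)
  qed
  have O1: "(\<lambda>n. \<integral>u. bessel_kernel \<nu> A (b n) u \<partial>lborel) \<in> O(\<lambda>n. (A / b n) powr (\<nu> / 2) * exp (- \<beta> * sqrt (real n)))"
    by (rule bigoI[of _ "2 * M"]) (use I in simp)
  have "(\<lambda>n. a n * real n ^ l * (\<integral>u. bessel_kernel \<nu> A (b n) u \<partial>lborel)) \<in>
    O(\<lambda>n. exp (C * sqrt (real n)) * real n ^ l * ((A / b n) powr (\<nu> / 2) * exp (- \<beta> * sqrt (real n))))"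
    by (intro landau_o.big.mult a O1 landau_o.big_refl)
  also have "(\<lambda>n. exp (C * sqrt (real n)) * real n ^ l * ((A / b n) powr (\<nu> / 2) * exp (- \<beta> * sqrt (real n)))) =
      (\<lambda>n. real n ^ l * ((A / b n) powr (\<nu> / 2) * exp (- \<delta> * sqrt (real n))))"
    by (intro ext) (simp add: \<delta>_def algebra_simps flip: exp_add)
  also have "(\<lambda>n. real n ^ l * ((A / b n) powr (\<nu> / 2) * exp (- \<delta> * sqrt (real n)))) \<in> O(\<lambda>n. inverse (real n ^ 2))"
    unfolding b_def using pos \<delta> by real_asymp
  finally show "(\<lambda>n. a n * real n ^ l * (\<integral>u. bessel_kernel \<nu> A (B + 2 * pi * real n / s) u \<partial>lborel)) \<in> O(\<lambda>n. inverse (real n ^ 2))"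
    unfolding b_def .
qed

lemma summable_exp_decay:
  fixes a :: "nat \<Rightarrow> real"
  assumes a: "a \<in> O(\<lambda>n. exp (C * sqrt (real n)))" and C: "C > 0" and y: "y > 0"
  shows "summable (\<lambda>n. a n * real n ^ l * exp (- (y * real n)))"
proof (rule summable_inverse_square_bigo)
  have "(\<lambda>n. a n * real n ^ l * exp (- (y * real n))) \<in> O(\<lambda>n. exp (C * sqrt (real n)) * real n ^ l * exp (- (y * real n)))"
    by (intro landau_o.big.mult a landau_o.big_refl)
  also have "(\<lambda>n. exp (C * sqrt (real n)) * real n ^ l * exp (- (y * real n))) \<in> O(\<lambda>n. inverse (real n ^ 2))"
    using C y by real_asymp
  finally show "(\<lambda>n. a n * real n ^ l * exp (- (y * real n))) \<in> O(\<lambda>n. inverse (real n ^ 2))" .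
qed

text \<open>The new factor is q^x at the point i e^u / s. A term of a q-expansion is thus absorbed
  into the second parameter of the kernel, which is where \<open>D n\<close> comes from.\<close>

lemma bessel_kernel_shift:
  "bessel_kernel \<nu> A (B + 2 * pi * x / s) u = bessel_kernel \<nu> A B u * exp (- (2 * pi * exp u / s * x))"
  by (simp add: bessel_kernel_def algebra_simps flip: exp_add)

text \<open>A power (Im z)^l from the incomplete gamma polynomial raises the order; this is the
  source of the Bessel functions of order l and l + k.\<close>

lemma bessel_kernel_order_add: "bessel_kernel (\<nu> + real l) A B u = exp u ^ l * bessel_kernel \<nu> A B u"
  by (simp add: bessel_kernel_def algebra_simps flip: exp_add exp_of_nat_mult)

text \<open>Two convergence conditions of different strength enter. For fixed u the terms decay
  exponentially in n, which beats exp(C sqrt n) for any C; after integration the decay is only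
  exponential in sqrt n, and the bound on \<open>C^2\<close> is required. Positivity at the lowest
  index \<open>c\<close> gives it for all indices.\<close>

lemma integral_bessel_kernel_series:
  fixes a :: "int \<Rightarrow> complex" and l :: nat and \<nu> :: real
  assumes a: "(\<lambda>n. norm (a (int n))) \<in> O(\<lambda>n. exp (C * sqrt (real n)))" and pos: "s > 0" "A > 0" "B > 0"
    and "C > 0" and C: "C\<^sup>2 < 8 * pi * A / s" and c: "B + 2 * pi * of_int c / s > 0"
  defines "I \<equiv> \<lambda>j::int. \<integral>u. bessel_kernel \<nu> A (B + 2 * pi * of_int j / s) u \<partial>lborel"
    and "S \<equiv> \<lambda>u. \<Sum>\<^sub>\<infinity>j\<in>{c..}. a j * of_int j ^ l * of_real (exp (- (2 * pi * exp u / s * of_int j)))"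
  shows "(\<lambda>j. a j * of_int j ^ l * of_real (I j)) summable_on {c..}"
    and "integrable lborel (\<lambda>u. S u * of_real (bessel_kernel \<nu> A B u))"
    and "(\<integral>u. S u * of_real (bessel_kernel \<nu> A B u) \<partial>lborel) = (\<Sum>\<^sub>\<infinity>j\<in>{c..}. a j * of_int j ^ l * of_real (I j))"
proof -
  define a' where "a' n = a (c + int n) * of_int (c + int n) ^ l" for n
  define \<phi> where "\<phi> n u = bessel_kernel \<nu> A (B + 2 * pi * of_int (c + int n) / s) u" for n u
  have int: "integrable lborel (\<phi> n)" for n
  proof -
    have "of_int c \<le> (of_int (c + int n) :: real)" by simp
    then have "B + 2 * pi * of_int c / s \<le> B + 2 * pi * of_int (c + int n) / s"
      using pos by (intro add_left_mono divide_right_mono mult_left_mono) auto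
    then show ?thesis using c pos unfolding \<phi>_def by (intro integrable_bessel_kernel) linarith+
  qed
  have nonneg: "\<phi> n u \<ge> 0" for n u by (simp add: \<phi>_def less_imp_le[OF bessel_kernel_pos])
  have pw: "summable (\<lambda>n. norm (a' n) * \<phi> n u)" for u
  proof -
    have "2 * pi * exp u / s > 0" using pos by simp
    from summable_exp_decay[OF a \<open>C > 0\<close> this, of l]
    have "summable (\<lambda>n. norm (a (int n) * of_int (int n) ^ l) * exp (- (2 * pi * exp u / s * of_int (int n))))"
      by (simp add: norm_mult norm_power)
    from summable_int_shift[where g = "\<lambda>j. norm (a j * of_int j ^ l) * exp (- (2 * pi * exp u / s * of_int j))", OF this, of c]
    have "summable (\<lambda>n. norm (a' n) * exp (- (2 * pi * exp u / s * of_int (c + int n))))"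
      by (simp only: a'_def)
    from summable_mult[OF this, of "bessel_kernel \<nu> A B u"] show ?thesis
      unfolding \<phi>_def bessel_kernel_shift by (simp only: mult_ac)
  qed
  have "summable (\<lambda>n. norm (a (int n) * of_int (int n) ^ l) * I (int n))"
    using summable_bessel_integrals[OF a pos C, of l \<nu>] by (simp add: norm_mult norm_power I_def)
  from summable_int_shift[where g = "\<lambda>j. norm (a j * of_int j ^ l) * I j", OF this, of c]
  have sums: "summable (\<lambda>n. norm (a' n) * (\<integral>u. \<phi> n u \<partial>lborel))"
    by (simp only: a'_def I_def \<phi>_def)
  have I_nonneg: "(\<integral>u. \<phi> n u \<partial>lborel) \<ge> 0" for n using nonneg by simp
  have sums': "summable (\<lambda>n. norm (a (c + int n) * of_int (c + int n) ^ l * of_real (I (c + int n))))"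
    using sums I_nonneg unfolding a'_def \<phi>_def I_def by (simp add: norm_mult)
  then show "(\<lambda>j. a j * of_int j ^ l * of_real (I j)) summable_on {c..}"
    by (simp only: summable_on_int_atLeast_iff)
  have S: "S u * of_real (bessel_kernel \<nu> A B u) = (\<Sum>n. a' n * of_real (\<phi> n u))" for u
  proof -
    let ?t = "\<lambda>j. a j * of_int j ^ l * of_real (bessel_kernel \<nu> A (B + 2 * pi * of_int j / s) u)"
    have "S u * of_real (bessel_kernel \<nu> A B u) = (\<Sum>\<^sub>\<infinity>j\<in>{c..}. ?t j)"
      unfolding S_def bessel_kernel_shift by (subst infsum_cmult_left'[symmetric]) (simp add: mult_ac)
    also have "\<dots> = (\<Sum>n. ?t (c + int n))"
      by (rule infsum_int_atLeast) (use pw[of u] nonneg in \<open>simp add: norm_mult a'_def \<phi>_def less_imp_le[OF bessel_kernel_pos]\<close>)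
    finally show ?thesis by (simp only: a'_def \<phi>_def)
  qed
  show "integrable lborel (\<lambda>u. S u * of_real (bessel_kernel \<nu> A B u))"
    unfolding S by (rule integral_suminf_mult(1)[OF int nonneg pw sums])
  have "(\<integral>u. S u * of_real (bessel_kernel \<nu> A B u) \<partial>lborel) = (\<Sum>n. a' n * of_real (\<integral>u. \<phi> n u \<partial>lborel))"
    unfolding S by (rule integral_suminf_mult(2)[OF int nonneg pw sums])
  also have "\<dots> = (\<Sum>\<^sub>\<infinity>j\<in>{c..}. a j * of_int j ^ l * of_real (I j))"
    unfolding infsum_int_atLeast[OF sums'] by (simp only: a'_def \<phi>_def I_def)
  finally show "(\<integral>u. S u * of_real (bessel_kernel \<nu> A B u) \<partial>lborel) = (\<Sum>\<^sub>\<infinity>j\<in>{c..}. a j * of_int j ^ l * of_real (I j))" .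
qed

lemma has_sum_finite_sum:
  fixes f :: "'a \<Rightarrow> 'b \<Rightarrow> complex"
  assumes "finite L" "\<And>l. l \<in> L \<Longrightarrow> (f l has_sum S l) A"
  shows "((\<lambda>x. \<Sum>l\<in>L. f l x) has_sum (\<Sum>l\<in>L. S l)) A"
  using assms by (induction L rule: finite_induct) (auto intro: has_sum_add)

text \<open>The set \<open>L\<close> and the weights \<open>w\<close> are free so that one statement
  serves both cases: \<open>{..m}\<close> in weight -m, and the empty set for weakly holomorphic
  forms of any weight.\<close>

lemma integral_bessel_kernel_maass:
  fixes a b :: "int \<Rightarrow> complex" and w :: "nat \<Rightarrow> complex" and L :: "nat set" and \<nu> :: real
  assumes a: "(\<lambda>n. norm (a (int n))) \<in> O(\<lambda>n. exp (C * sqrt (real n)))"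
    and b: "(\<lambda>n. norm (b (int n))) \<in> O(\<lambda>n. exp (C * sqrt (real n)))"
    and pos: "s > 0" "A > 0" "B > 0" and C: "C > 0" "C\<^sup>2 < 8 * pi * A / s"
    and n0: "B > 2 * pi * real n0 / s"
    and F: "\<And>u. F u = (\<Sum>\<^sub>\<infinity>j\<in>{- int n0..}. a j * of_real (exp (- (2 * pi * exp u / s * of_int j)))) +
      (\<Sum>l\<in>L. w l * of_real (exp u ^ l) * (\<Sum>\<^sub>\<infinity>j\<in>{1..}. b j * of_int j ^ l * of_real (exp (- (2 * pi * exp u / s * of_int j)))))"
  defines "I \<equiv> \<lambda>\<nu> (j::int). complex_of_real (\<integral>u. bessel_kernel \<nu> A (B + 2 * pi * of_int j / s) u \<partial>lborel)"
  shows "(\<lambda>j. a j * I \<nu> j) summable_on {- int n0..}"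
    and "(\<lambda>j. b j * of_int j ^ l * I (\<nu> + real l) j) summable_on {1..}"
    and "(\<integral>u. F u * of_real (bessel_kernel \<nu> A B u) \<partial>lborel) =
      (\<Sum>\<^sub>\<infinity>j\<in>{- int n0..}. a j * I \<nu> j) +
      (\<Sum>l\<in>L. w l * (\<Sum>\<^sub>\<infinity>j\<in>{1..}. b j * of_int j ^ l * I (\<nu> + real l) j))"
proof -
  have c1: "B + 2 * pi * of_int (- int n0) / s > 0" using n0 by simp
  have c2: "B + 2 * pi * of_int 1 / s > 0" using pos by (simp add: add_pos_pos)
  note P = integral_bessel_kernel_series[OF a pos C c1, where l = 0, unfolded power_0 mult_1_right]
  note M = integral_bessel_kernel_series[OF b pos C c2]
  show "(\<lambda>j. a j * I \<nu> j) summable_on {- int n0..}" unfolding I_def by (rule P(1))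
  show "(\<lambda>j. b j * of_int j ^ l * I (\<nu> + real l) j) summable_on {1..}" unfolding I_def by (rule M(1))
  let ?p = "\<lambda>u. (\<Sum>\<^sub>\<infinity>j\<in>{- int n0..}. a j * of_real (exp (- (2 * pi * exp u / s * of_int j)))) * of_real (bessel_kernel \<nu> A B u)"
  let ?m = "\<lambda>l u. (\<Sum>\<^sub>\<infinity>j\<in>{1..}. b j * of_int j ^ l * of_real (exp (- (2 * pi * exp u / s * of_int j)))) * of_real (bessel_kernel (\<nu> + real l) A B u)"
  have eq: "F u * of_real (bessel_kernel \<nu> A B u) = ?p u + (\<Sum>l\<in>L. w l * ?m l u)" for u
    unfolding F bessel_kernel_order_add distrib_right sum_distrib_right
    by (simp only: of_real_mult of_real_power mult_ac)
  have "(\<integral>u. F u * of_real (bessel_kernel \<nu> A B u) \<partial>lborel) = (\<integral>u. ?p u \<partial>lborel) + (\<Sum>l\<in>L. w l * (\<integral>u. ?m l u \<partial>lborel))"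
  proof -
    have i: "integrable lborel (\<lambda>u. w l * ?m l u)" for l
      by (rule integrable_mult_right, rule M(2))
    have "(\<integral>u. (\<Sum>l\<in>L. w l * ?m l u) \<partial>lborel) = (\<Sum>l\<in>L. \<integral>u. w l * ?m l u \<partial>lborel)"
      by (rule Bochner_Integration.integral_sum) (rule i)
    also have "\<dots> = (\<Sum>l\<in>L. w l * (\<integral>u. ?m l u \<partial>lborel))"
      by (intro sum.cong refl integral_mult_right_zero)
    finally show ?thesis
      unfolding eq Bochner_Integration.integral_add[OF P(2) Bochner_Integration.integrable_sum[OF i]] by simp
  qed
  then show "(\<integral>u. F u * of_real (bessel_kernel \<nu> A B u) \<partial>lborel) =
      (\<Sum>\<^sub>\<infinity>j\<in>{- int n0..}. a j * I \<nu> j) +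
      (\<Sum>l\<in>L. w l * (\<Sum>\<^sub>\<infinity>j\<in>{1..}. b j * of_int j ^ l * I (\<nu> + real l) j))"
    unfolding P(3) M(3) I_def .
qed

lemma qpow_imaginary: "qpow r (\<i> * of_real y) = of_real (exp (- (2 * pi * y * r)))"
proof -
  have "2 * of_real pi * \<i> * of_real r * (\<i> * of_real y) = of_real (- (2 * pi * y * r))"
    by (simp add: complex_eq_iff)
  then show ?thesis unfolding qpow_def by (simp only: exp_of_real)
qed

text \<open>On the imaginary axis q^j is real and equals its conjugate, so holomorphic and
  antiholomorphic terms take the same form and differ only by powers of j and of exp u.\<close>

lemma has_maass_expansion_imaginary_nat_weight:
  assumes E: "has_maass_expansion (- real m) 1 n0 a b F" and s: "s > 0"
  shows "F (\<i> * of_real (exp u / s)) =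
      (\<Sum>\<^sub>\<infinity>j\<in>{- int n0..}. a j * of_real (exp (- (2 * pi * exp u / s * of_int j)))) +
      (\<Sum>l\<in>{..m}. of_real (fact m / fact l * (4 * pi / s) ^ l) * of_real (exp u ^ l) *
         (\<Sum>\<^sub>\<infinity>j\<in>{1..}. b j * of_int j ^ l * of_real (exp (- (2 * pi * exp u / s * of_int j)))))"
proof -
  define y where "y = exp u / s"
  have y: "y > 0" using s by (simp add: y_def)
  let ?z = "\<i> * of_real y :: complex"
  have z: "?z \<in> upper_half_plane" using y by (simp add: upper_half_plane_def)
  note E' = E[unfolded has_maass_expansion_def, rule_format, OF z]
  note c = has_maass_expansion_nat_weight(1)[OF E]
  have sm: "(\<lambda>j. b j * of_int j ^ l * of_real (exp (- (2 * pi * y * of_int j)))) summable_on {1..}" for l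
  proof -
    have "Im ?z > 0" using y by simp
    from unit_disc_seriesD[OF unit_disc_series_power[OF c, of l] norm_qpow_1_less[OF this]]
    have "summable (\<lambda>n. norm (of_nat n ^ l * (if n = 0 then 0 else cnj (b (int n))) * qpow 1 ?z ^ n))" .
    then have "summable (\<lambda>n. norm (of_nat (Suc n) ^ l * cnj (b (int (Suc n))) * qpow (real (Suc n)) ?z))"
      by (subst (asm) summable_Suc_iff[symmetric]) (simp add: qpow_nat del: of_nat_Suc power_Suc)
    then have "summable (\<lambda>n. norm (b (1 + int n) * of_int (1 + int n) ^ l * of_real (exp (- (2 * pi * y * of_int (1 + int n))))))"
      unfolding qpow_imaginary by (simp add: norm_mult norm_power mult_ac)
    then show ?thesis by (simp only: summable_on_int_atLeast_iff)
  qed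
  have t: "b j * of_real (inc_Gamma (1 - - real m) (4 * pi * of_int j * Im ?z / real 1)) * qpow (- of_int j / real 1) ?z =
      (\<Sum>l\<in>{..m}. of_real (fact m / fact l * (4 * pi / s) ^ l) * of_real (exp u ^ l) *
         (b j * of_int j ^ l * of_real (exp (- (2 * pi * y * of_int j)))))" if "j \<in> {1..}" for j
  proof -
    have j: "real_of_int j > 0" using that by simp
    have yl: "(4 * pi * y) ^ l = (4 * pi / s) ^ l * exp u ^ l" for l
      unfolding y_def by (simp add: power_mult_distrib power_divide)
    have "b j * of_real (inc_Gamma (1 - - real m) (4 * pi * of_int j * Im ?z / real 1)) * qpow (- of_int j / real 1) ?z =
       b j * (of_real (inc_Gamma (real m + 1) (4 * pi * of_int j * Im ?z)) * qpow (- of_int j) ?z)"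
      by (simp add: add.commute mult.assoc)
    also have "\<dots> = b j * (\<Sum>l\<le>m. of_real (fact m / fact l * (4 * pi * Im ?z) ^ l) * (of_real (of_int j) ^ l * cnj (qpow (of_int j) ?z)))"
      by (subst inc_Gamma_Suc_qpow[OF j]) (use y in simp_all)
    also have "\<dots> = (\<Sum>l\<in>{..m}. of_real (fact m / fact l * (4 * pi / s) ^ l) * of_real (exp u ^ l) *
         (b j * of_int j ^ l * of_real (exp (- (2 * pi * y * of_int j)))))"
      unfolding sum_distrib_left qpow_imaginary complex_cnj_complex_of_real
    proof (intro sum.cong refl)
      fix l
      have "Im ?z = y" by simp
      then show "b j * (of_real (fact m / fact l * (4 * pi * Im ?z) ^ l) * (of_real (of_int j) ^ l * of_real (exp (- (2 * pi * y * of_int j))))) =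
        of_real (fact m / fact l * (4 * pi / s) ^ l) * of_real (exp u ^ l) *
         (b j * of_int j ^ l * of_real (exp (- (2 * pi * y * of_int j))))"
        unfolding \<open>Im ?z = y\<close> yl by (simp only: of_real_mult of_real_of_int_eq mult_ac)
    qed
    finally show ?thesis .
  qed
  have inf: "(\<Sum>\<^sub>\<infinity>j\<in>{1..}. b j * of_real (inc_Gamma (1 - - real m) (4 * pi * of_int j * Im ?z / real 1)) * qpow (- of_int j / real 1) ?z) =
      (\<Sum>\<^sub>\<infinity>j\<in>{1..}. \<Sum>l\<in>{..m}. of_real (fact m / fact l * (4 * pi / s) ^ l) * of_real (exp u ^ l) *
         (b j * of_int j ^ l * of_real (exp (- (2 * pi * y * of_int j)))))"
    by (rule infsum_cong) (rule t)
  have "F ?z = (\<Sum>\<^sub>\<infinity>j\<in>{- int n0..}. a j * qpow (of_int j / real 1) ?z) +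
      (\<Sum>\<^sub>\<infinity>j\<in>{1..}. \<Sum>l\<in>{..m}. of_real (fact m / fact l * (4 * pi / s) ^ l) * of_real (exp u ^ l) *
         (b j * of_int j ^ l * of_real (exp (- (2 * pi * y * of_int j)))))"
    using E'[THEN conjunct2, THEN conjunct2] unfolding inf .
  also have "(\<Sum>\<^sub>\<infinity>j\<in>{1..}. \<Sum>l\<in>{..m}. of_real (fact m / fact l * (4 * pi / s) ^ l) * of_real (exp u ^ l) *
         (b j * of_int j ^ l * of_real (exp (- (2 * pi * y * of_int j))))) =
      (\<Sum>l\<in>{..m}. of_real (fact m / fact l * (4 * pi / s) ^ l) * of_real (exp u ^ l) *
         (\<Sum>\<^sub>\<infinity>j\<in>{1..}. b j * of_int j ^ l * of_real (exp (- (2 * pi * y * of_int j)))))"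
    by (rule infsumI, rule has_sum_finite_sum, simp, rule has_sum_cmult_right, rule has_sum_infsum, rule sm)
  finally show ?thesis unfolding qpow_imaginary y_def by simp
qed

section \<open>The Fricke functional equation\<close>

text \<open>A positive factor does not move the argument, so here the principal logarithm is
  additive.\<close>

lemma powr_of_real_times_ii:
  assumes r: "r > 0"
  shows "(of_real r * \<i>) powr (- of_real k) = of_real (r powr (- k)) * \<i> powr (- of_real k)"
proof -
  have ln: "Ln (of_real r * \<i>) = of_real (ln r) + Ln \<i>"
    by (simp only: Ln_times_of_real[OF r complex_i_not_zero] Ln_of_real[OF r])
  have e: "complex_of_real (r powr (- k)) = exp (- of_real k * of_real (ln r))"
    using r by (simp add: powr_def exp_of_real[symmetric])
  have nz: "(of_real r * \<i> = 0) = False" "(\<i> = 0) = False" using r by simp_all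
  show ?thesis
    unfolding e unfolding powr_def by (simp only: nz if_False ln distrib_left exp_add)
qed

text \<open>At z = i e^u / s one has N z = i s e^u and -1/(N z) = i e^(-u) / s. The normalizing
  factor N^(k/2) cancels s^(-k), so only i^(-k) and e^(-k u) remain to be moved across.\<close>

lemma fricke_functional_equation:
  assumes N: "N > 0"
  shows "f (\<i> * of_real (exp (- u) / sqrt (real N))) =
    \<i> powr of_real k * of_real (exp (k * u)) * fricke k N f (\<i> * of_real (exp u / sqrt (real N)))"
proof -
  define s where "s = sqrt (real N)"
  have s: "s > 0" "s * s = real N" using N by (auto simp: s_def)
  have Nz: "of_nat N * (\<i> * of_real (exp u / s)) = of_real (s * exp u) * \<i>"
  proof -
    have "of_nat N = complex_of_real (s * s)" by (simp only: s(2) of_real_of_nat_eq)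
    show ?thesis unfolding \<open>of_nat N = complex_of_real (s * s)\<close> using s(1) by (simp add: field_simps)
  qed
  have "s * exp u > 0" using s by simp
  have "- 1 / (of_real (s * exp u) * \<i>) = \<i> * of_real (exp (- u) / s)"
    using s by (simp add: exp_minus field_simps)
  moreover have "(of_real (s * exp u) * \<i>) powr (- of_real k) = of_real ((s * exp u) powr (- k)) * \<i> powr (- of_real k)"
    by (rule powr_of_real_times_ii[OF \<open>s * exp u > 0\<close>])
  ultimately have g: "fricke k N f (\<i> * of_real (exp u / s)) = of_real (real N powr (k / 2) * (s * exp u) powr (- k)) *
      \<i> powr (- of_real k) * f (\<i> * of_real (exp (- u) / s))"
    unfolding fricke_def Nz by (simp add: mult_ac)
  have "real N powr (k / 2) = s powr k"
    using N by (simp add: s_def powr_half_sqrt[symmetric] powr_powr)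
  moreover have "(s * exp u) powr (- k) = s powr (- k) * exp (- (k * u))"
    using s by (simp add: powr_mult powr_def[of "exp u"])
  ultimately have w: "real N powr (k / 2) * (s * exp u) powr (- k) = exp (- (k * u))"
    using s by (simp add: powr_minus)
  let ?f = "f (\<i> * of_real (exp (- u) / s))" and ?e = "\<lambda>x. complex_of_real (exp x)"
  have "\<i> powr of_real k * ?e (k * u) * fricke k N f (\<i> * of_real (exp u / s)) =
      (\<i> powr of_real k * \<i> powr (- of_real k)) * (?e (k * u) * ?e (- (k * u))) * ?f"
    unfolding g w by (simp only: mult_ac)
  also have "\<i> powr of_real k * \<i> powr (- of_real k) = (1::complex)" by (simp flip: powr_add)
  also have "?e (k * u) * ?e (- (k * u)) = 1"
    by (simp flip: of_real_mult exp_add)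
  finally show ?thesis by (simp add: s_def)
qed

text \<open>Reflection in u exchanges the kernel parameters, and the factor e^(k u) of the
  functional equation raises the order from 0 to k.\<close>

lemma fricke_bessel_integral:
  assumes N: "N > 0"
  shows "(\<integral>u. f (\<i> * of_real (exp u / sqrt (real N))) * of_real (bessel_kernel 0 B A u) \<partial>lborel) =
    \<i> powr of_real k * (\<integral>u. fricke k N f (\<i> * of_real (exp u / sqrt (real N))) * of_real (bessel_kernel k A B u) \<partial>lborel)"
proof -
  have "(\<integral>u. f (\<i> * of_real (exp u / sqrt (real N))) * of_real (bessel_kernel 0 B A u) \<partial>lborel) =
    (\<integral>u. f (\<i> * of_real (exp (- u) / sqrt (real N))) * of_real (bessel_kernel 0 A B u) \<partial>lborel)"
    by (subst lborel_integral_reflect[symmetric]) (simp add: bessel_kernel_reflect)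
  also have "\<dots> = (\<integral>u. \<i> powr of_real k * (fricke k N f (\<i> * of_real (exp u / sqrt (real N))) * of_real (bessel_kernel k A B u)) \<partial>lborel)"
  proof (rule Bochner_Integration.integral_cong[OF refl])
    fix u
    have "bessel_kernel k A B u = exp (k * u) * bessel_kernel 0 A B u"
      by (simp add: bessel_kernel_def algebra_simps flip: exp_add)
    then show "f (\<i> * of_real (exp (- u) / sqrt (real N))) * of_real (bessel_kernel 0 A B u) =
       \<i> powr of_real k * (fricke k N f (\<i> * of_real (exp u / sqrt (real N))) * of_real (bessel_kernel k A B u))"
      unfolding fricke_functional_equation[OF N, of f u k] by (simp add: mult_ac)
  qed
  finally show ?thesis by (simp add: integral_mult_right_zero)
qed


section \<open>The Bessel integrals in the normalization of the theorem\<close>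

lemma bessel_integral_plus:
  assumes "A > 0" "D > 0"
  shows "(\<integral>u. bessel_kernel 0 A D u \<partial>lborel) = 2 * bessel_K 0 (2 * sqrt (D * A))"
  using integral_bessel_kernel[OF assms, of 0] assms by (simp add: mult.commute)

text \<open>(A / D)^(l/2) is split: the part with A is independent of n and joins the outer weight,
  the part with D turns n^l into (n / sqrt D)^l.\<close>

lemma bessel_integral_minus:
  assumes "A > 0" "D > 0"
  shows "n ^ l * (\<integral>u. bessel_kernel (real l) A D u \<partial>lborel) =
    2 * sqrt A ^ l * ((n / sqrt D) ^ l * bessel_K (real l) (2 * sqrt (D * A)))"
proof -
  have "(A / D) powr (real l / 2) = ((A / D) powr (1 / 2)) powr real l" by (simp add: powr_powr)
  also have "\<dots> = sqrt (A / D) ^ l" using assms by (simp add: powr_half_sqrt powr_realpow)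
  finally show ?thesis
    unfolding integral_bessel_kernel[OF assms]
    by (simp add: real_sqrt_divide power_divide mult.commute[of D A])
qed

lemma bessel_integral_dual:
  assumes "C > 0" "D > 0"
  shows "(\<integral>u. bessel_kernel (k + real l) C D u \<partial>lborel) =
    2 * C powr (k / 2) * sqrt C ^ l * (D powr (- (real l + k) / 2) * bessel_K (real l + k) (2 * sqrt (C * D)))"
proof -
  have "C powr ((k + real l) / 2) = C powr (k / 2) * (C powr (1 / 2)) powr real l"
    by (simp add: powr_powr powr_add[symmetric] add_divide_distrib)
  also have "\<dots> = C powr (k / 2) * sqrt C ^ l" using assms by (simp add: powr_half_sqrt powr_realpow)
  finally have c: "C powr ((k + real l) / 2) = C powr (k / 2) * sqrt C ^ l" .
  have d: "D powr (- (real l + k) / 2) = inverse (D powr ((k + real l) / 2))"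
  proof -
    have "- (real l + k) / 2 = - ((k + real l) / 2)" by (simp add: field_simps)
    then show ?thesis by (simp only: powr_minus)
  qed
  have cd: "(C / D) powr ((k + real l) / 2) = C powr (k / 2) * sqrt C ^ l * inverse (D powr ((k + real l) / 2))"
    by (simp only: powr_divide c) (simp only: divide_inverse)
  show ?thesis
    unfolding integral_bessel_kernel[OF assms] d cd by (simp only: add.commute[of "real l" k] mult_ac)
qed

lemma summable_infsum_cmult:
  fixes f g :: "int \<Rightarrow> complex"
  assumes f: "f summable_on S" and eq: "\<And>j. j \<in> S \<Longrightarrow> f j = w * g j" and w: "w \<noteq> 0"
  shows "g summable_on S" "infsum f S = w * infsum g S"
proof -
  have "(\<lambda>j. w * g j) summable_on S" using f eq by (simp cong: summable_on_cong)
  then show "g summable_on S" using w by (simp add: summable_on_cmult_right')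
  show "infsum f S = w * infsum g S"
    using infsum_cong[OF eq] by (simp add: infsum_cmult_right')
qed

text \<open>Summability of every series is part of the conclusion, since \<open>infsum\<close> is 0
  by default for a family that is not summable.\<close>

theorem theorem3p3:
  fixes k C C\<^sub>f :: real and N n\<^sub>0 :: nat and chi :: "int \<Rightarrow> complex"
    and f :: "complex \<Rightarrow> complex" and cp cm dp dm :: "int \<Rightarrow> complex" and D :: "int \<Rightarrow> real"
  assumes weight: "2 * k \<in> \<int>"
    and level: "N > 0" "k \<notin> \<int> \<Longrightarrow> 4 dvd N"
    and character: "dirichlet_character N chi"
    and form: "harmonic_maass_form k N chi f"
    and expansion_f: "has_maass_expansion k 1 n\<^sub>0 cp cm f"
    and expansion_g: "has_maass_expansion k 1 n\<^sub>0 dp dm (fricke k N f)"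
    and "C\<^sub>f > 0"
    and growth_f: "(\<lambda>n::nat. norm (cp (int n))) \<in> O(\<lambda>n. exp (C\<^sub>f * sqrt (real n)))"
    and growth_g: "(\<lambda>n::nat. norm (dp (int n))) \<in> O(\<lambda>n. exp (C\<^sub>f * sqrt (real n)))"
    and C: "C > max (C\<^sub>f\<^sup>2 * sqrt (real N) / (8 * pi)) (2 * pi * real n\<^sub>0 / sqrt (real N))"
    and D: "\<And>n. D n = C + 2 * pi * of_int n / sqrt (real N)"
  shows "(\<forall>m::nat. k = - real m \<longrightarrow> (\<forall>X>0.
      let cp_term = (\<lambda>n. cp n * of_real (bessel_K 0 (2 * sqrt (D n * (C + sqrt (real N) * X)))));
          cm_term = (\<lambda>l n. cm n * of_real ((of_int n / sqrt (D n)) ^ l *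
                       bessel_K (real l) (2 * sqrt (D n * (C + sqrt (real N) * X)))));
          dp_term = (\<lambda>n. dp n * of_real ((sqrt (real N) * X + D n) powr (- k / 2) *
                       bessel_K k (2 * sqrt (C * (D n + sqrt (real N) * X)))));
          dm_term = (\<lambda>l n. dm n * of_real (of_int n ^ l *
                       (D n + sqrt (real N) * X) powr (- (real l + k) / 2) *
                       bessel_K (real l + k) (2 * sqrt (C * (D n + sqrt (real N) * X)))))
      in cp_term summable_on {- int n\<^sub>0..} \<and> (\<forall>l\<le>m. cm_term l summable_on {1..}) \<and>
         dp_term summable_on {- int n\<^sub>0..} \<and> (\<forall>l\<le>m. dm_term l summable_on {1..}) \<and>
         (\<Sum>\<^sub>\<infinity>n\<in>{- int n\<^sub>0..}. cp_term n) +
         (\<Sum>l=0..m. of_real (fact m / fact l *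
            (4 * pi * sqrt C / sqrt (real N) * sqrt (1 + sqrt (real N) * X / C)) ^ l) *
            (\<Sum>\<^sub>\<infinity>n\<in>{1..}. cm_term l n)) =
         \<i> powr of_real k * of_real (C powr (k / 2)) * (\<Sum>\<^sub>\<infinity>n\<in>{- int n\<^sub>0..}. dp_term n) +
         \<i> powr of_real k * of_real (C powr (k / 2)) *
         (\<Sum>l=0..m. of_real (fact m / fact l * (4 * pi * sqrt C / sqrt (real N)) ^ l) *
            (\<Sum>\<^sub>\<infinity>n\<in>{1..}. dm_term l n))))
    \<and> (weakly_holomorphic_form k N chi f \<longrightarrow> (\<forall>X>0.
      let cp_term = (\<lambda>n. cp n * of_real (bessel_K 0 (2 * sqrt (D n * (C + sqrt (real N) * X)))));
          dp_term = (\<lambda>n. dp n * of_real ((sqrt (real N) * X + D n) powr (- k / 2) *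
                       bessel_K k (2 * sqrt (C * (D n + sqrt (real N) * X)))))
      in cp_term summable_on {- int n\<^sub>0..} \<and> dp_term summable_on {- int n\<^sub>0..} \<and>
         (\<Sum>\<^sub>\<infinity>n\<in>{- int n\<^sub>0..}. cp_term n) =
         \<i> powr of_real k * of_real (C powr (k / 2)) * (\<Sum>\<^sub>\<infinity>n\<in>{- int n\<^sub>0..}. dp_term n)))"
proof -
  define s where "s = sqrt (real N)"
  have s: "s > 0" using level(1) by (simp add: s_def)
  have C1: "C\<^sub>f\<^sup>2 * s / (8 * pi) < C" and C2: "2 * pi * real n\<^sub>0 / s < C" using C by (simp_all add: s_def)
  have "0 \<le> 2 * pi * real n\<^sub>0 / s" using s by simp
  then have C0: "C > 0" using C2 by linarith
  have Cf: "C\<^sub>f\<^sup>2 < 8 * pi * C / s" using C1 s by (simp add: field_simps)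
  have Dn: "D n > 0" if "n \<ge> - int n\<^sub>0" for n
  proof -
    have "- real n\<^sub>0 \<le> of_int n" using that by linarith
    then have "2 * pi * (- real n\<^sub>0) / s \<le> 2 * pi * of_int n / s"
      using s by (intro divide_right_mono mult_left_mono) auto
    then show ?thesis using C2 by (simp add: D s_def[symmetric])
  qed
  have Dn1: "D n > 0" if "n \<ge> 1" for n using Dn[of n] that by simp
  have main: "
      cp_term summable_on {- int n\<^sub>0..} \<and> (\<forall>l. cm_term l summable_on {1..}) \<and>
      dp_term summable_on {- int n\<^sub>0..} \<and> (\<forall>l. dm_term l summable_on {1..}) \<and>
      (\<Sum>\<^sub>\<infinity>n\<in>{- int n\<^sub>0..}. cp_term n) +
         (\<Sum>l\<in>L. of_real (w l * (4 * pi * sqrt C / s * sqrt (1 + s * X / C)) ^ l) * (\<Sum>\<^sub>\<infinity>n\<in>{1..}. cm_term l n)) =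
         \<i> powr of_real k * of_real (C powr (k / 2)) * (\<Sum>\<^sub>\<infinity>n\<in>{- int n\<^sub>0..}. dp_term n) +
         \<i> powr of_real k * of_real (C powr (k / 2)) *
         (\<Sum>l\<in>L. of_real (w l * (4 * pi * sqrt C / s) ^ l) * (\<Sum>\<^sub>\<infinity>n\<in>{1..}. dm_term l n))"
    if X: "X > 0"
      and cm: "(\<lambda>n. norm (cm (int n))) \<in> O(\<lambda>n. exp (C\<^sub>f * sqrt (real n)))"
      and dm: "(\<lambda>n. norm (dm (int n))) \<in> O(\<lambda>n. exp (C\<^sub>f * sqrt (real n)))"
      and f_exp: "\<And>u. f (\<i> * of_real (exp u / s)) =
        (\<Sum>\<^sub>\<infinity>j\<in>{- int n\<^sub>0..}. cp j * of_real (exp (- (2 * pi * exp u / s * of_int j)))) +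
        (\<Sum>l\<in>L. of_real (w l * (4 * pi / s) ^ l) * of_real (exp u ^ l) *
          (\<Sum>\<^sub>\<infinity>j\<in>{1..}. cm j * of_int j ^ l * of_real (exp (- (2 * pi * exp u / s * of_int j)))))"
      and g_exp: "\<And>u. fricke k N f (\<i> * of_real (exp u / s)) =
        (\<Sum>\<^sub>\<infinity>j\<in>{- int n\<^sub>0..}. dp j * of_real (exp (- (2 * pi * exp u / s * of_int j)))) +
        (\<Sum>l\<in>L. of_real (w l * (4 * pi / s) ^ l) * of_real (exp u ^ l) *
          (\<Sum>\<^sub>\<infinity>j\<in>{1..}. dm j * of_int j ^ l * of_real (exp (- (2 * pi * exp u / s * of_int j)))))"
      and cp_term: "cp_term = (\<lambda>n. cp n * of_real (bessel_K 0 (2 * sqrt (D n * (C + s * X)))))"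
      and cm_term: "cm_term = (\<lambda>l n. cm n * of_real ((of_int n / sqrt (D n)) ^ l *
                       bessel_K (real l) (2 * sqrt (D n * (C + s * X)))))"
      and dp_term: "dp_term = (\<lambda>n. dp n * of_real ((s * X + D n) powr (- k / 2) *
                       bessel_K k (2 * sqrt (C * (D n + s * X)))))"
      and dm_term: "dm_term = (\<lambda>l n. dm n * of_real (of_int n ^ l *
                       (D n + s * X) powr (- (real l + k) / 2) *
                       bessel_K (real l + k) (2 * sqrt (C * (D n + s * X)))))"
    for X :: real and L :: "nat set" and w :: "nat \<Rightarrow> real"
      and cp_term dp_term :: "int \<Rightarrow> complex" and cm_term dm_term :: "nat \<Rightarrow> int \<Rightarrow> complex"
  proof -
    have sX: "s * X > 0" using s X by simp
    \<comment> \<open>The pair (A, C) serves as kernel parameters for \<open>f\<close> and (C, A)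
      for the Fricke image. Shifting the second parameter by 2 pi n / s gives \<open>D n\<close> in
      one case and \<open>D n + s * X\<close> in the other.\<close>
    define A where "A = C + s * X"
    have A: "A > 0" "C \<le> A" using C0 sX by (auto simp: A_def)
    have CfA: "C\<^sub>f\<^sup>2 < 8 * pi * A / s"
    proof -
      have "8 * pi * C / s \<le> 8 * pi * A / s" using A s by (intro divide_right_mono mult_left_mono) auto
      then show ?thesis using Cf by linarith
    qed
    have nA: "2 * pi * real n\<^sub>0 / s < A" using C2 A by linarith
    have D1: "C + 2 * pi * of_int j / s = D j" for j by (simp add: D s_def)
    have D2: "A + 2 * pi * of_int j / s = D j + s * X" for j by (simp add: D s_def A_def)
    note L = integral_bessel_kernel_maass[OF growth_f cm s A(1) C0 \<open>C\<^sub>f > 0\<close> CfA C2 f_exp, where \<nu> = 0, unfolded D1 add_0]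
    note R = integral_bessel_kernel_maass[OF growth_g dm s C0 A(1) \<open>C\<^sub>f > 0\<close> Cf nA g_exp, where \<nu> = k, unfolded D2]
    let ?ck = "complex_of_real (C powr (k / 2))"
    have cp1: "cp j * of_real (\<integral>u. bessel_kernel 0 A (D j) u \<partial>lborel) = 2 * cp_term j" if "j \<in> {- int n\<^sub>0..}" for j
      using bessel_integral_plus[OF A(1) Dn[of j]] that by (simp add: cp_term A_def)
    have cm1: "cm j * of_int j ^ l * of_real (\<integral>u. bessel_kernel (real l) A (D j) u \<partial>lborel) =
        (2 * of_real (sqrt A ^ l)) * cm_term l j" if "j \<in> {1..}" for j l
    proof -
      have "cm j * of_int j ^ l * of_real (\<integral>u. bessel_kernel (real l) A (D j) u \<partial>lborel) =
          cm j * of_real (of_int j ^ l * (\<integral>u. bessel_kernel (real l) A (D j) u \<partial>lborel))" by simp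
      also have "\<dots> = (2 * of_real (sqrt A ^ l)) * cm_term l j"
        unfolding bessel_integral_minus[OF A(1) Dn1[OF that[simplified]]] cm_term A_def[symmetric] by simp
      finally show ?thesis .
    qed
    have dp1: "dp j * of_real (\<integral>u. bessel_kernel k C (D j + s * X) u \<partial>lborel) = (2 * ?ck) * dp_term j"
      if "j \<in> {- int n\<^sub>0..}" for j
    proof -
      have "D j + s * X > 0" using Dn[of j] that sX by simp
      from bessel_integral_dual[OF C0 this, of k 0] show ?thesis by (simp add: dp_term add.commute)
    qed
    have dm1: "dm j * of_int j ^ l * of_real (\<integral>u. bessel_kernel (k + real l) C (D j + s * X) u \<partial>lborel) =
        (2 * ?ck * of_real (sqrt C ^ l)) * dm_term l j"
      if "j \<in> {1..}" for j l
    proof -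
      have "D j + s * X > 0" using Dn1[of j] that sX by simp
      from bessel_integral_dual[OF C0 this, of k l] show ?thesis by (simp add: dm_term)
    qed
    have nz: "?ck \<noteq> 0" "sqrt A ^ l \<noteq> 0" "sqrt C ^ l \<noteq> 0" for l using C0 A by simp_all
    note cpS = summable_infsum_cmult[OF L(1) cp1]
    note cmS = summable_infsum_cmult[OF L(2) cm1]
    note dpS = summable_infsum_cmult[OF R(1) dp1]
    note dmS = summable_infsum_cmult[OF R(2) dm1]
    \<comment> \<open>The weight sqrt A is written relative to sqrt C, which explains the factor
      sqrt(1 + sX/C) on only one side of the identity.\<close>
    have sqA: "sqrt C * sqrt (1 + s * X / C) = sqrt A"
      using C0 by (simp add: A_def field_simps flip: real_sqrt_mult)
    have wA: "of_real (w l * (4 * pi / s) ^ l) * (2 * of_real (sqrt A ^ l) * x) =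
        2 * (of_real (w l * (4 * pi * sqrt C / s * sqrt (1 + s * X / C)) ^ l) * x)" for l and x :: complex
    proof -
      have "4 * pi * sqrt C / s * sqrt (1 + s * X / C) = 4 * pi / s * sqrt A"
        unfolding sqA[symmetric] by simp
      then show ?thesis by (simp only: power_mult_distrib of_real_mult) (simp only: mult_ac)
    qed
    have wC: "of_real (w l * (4 * pi / s) ^ l) * (2 * ?ck * of_real (sqrt C ^ l) * x) =
        2 * ?ck * (of_real (w l * (4 * pi * sqrt C / s) ^ l) * x)" for l and x :: complex
    proof -
      have "4 * pi * sqrt C / s = 4 * pi / s * sqrt C" by simp
      then show ?thesis by (simp only: power_mult_distrib of_real_mult) (simp only: mult_ac)
    qed
    have "2 * (infsum cp_term {- int n\<^sub>0..} + (\<Sum>l\<in>L. of_real (w l * (4 * pi * sqrt C / s * sqrt (1 + s * X / C)) ^ l) * infsum (cm_term l) {1..})) =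
       (\<integral>u. f (\<i> * of_real (exp u / s)) * of_real (bessel_kernel 0 A C u) \<partial>lborel)"
      unfolding L(3) using cpS(2) cmS(2) nz by (simp only: distrib_left sum_distrib_left) (simp add: wA del: of_real_mult of_real_power)
    also have "\<dots> = \<i> powr of_real k * (\<integral>u. fricke k N f (\<i> * of_real (exp u / s)) * of_real (bessel_kernel k C A u) \<partial>lborel)"
      unfolding s_def by (rule fricke_bessel_integral[OF level(1)])
    also have "(\<integral>u. fricke k N f (\<i> * of_real (exp u / s)) * of_real (bessel_kernel k C A u) \<partial>lborel) =
       2 * ?ck * (infsum dp_term {- int n\<^sub>0..} + (\<Sum>l\<in>L. of_real (w l * (4 * pi * sqrt C / s) ^ l) * infsum (dm_term l) {1..}))"
      unfolding R(3) using dpS(2) dmS(2) nz by (simp only: distrib_left sum_distrib_left) (simp add: wC del: of_real_mult of_real_power)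
    finally have "2 * (infsum cp_term {- int n\<^sub>0..} + (\<Sum>l\<in>L. of_real (w l * (4 * pi * sqrt C / s * sqrt (1 + s * X / C)) ^ l) * infsum (cm_term l) {1..})) =
      2 * (\<i> powr of_real k * ?ck * infsum dp_term {- int n\<^sub>0..} +
      \<i> powr of_real k * ?ck * (\<Sum>l\<in>L. of_real (w l * (4 * pi * sqrt C / s) ^ l) * infsum (dm_term l) {1..}))"
      by (simp only: distrib_left mult_ac)
    then have eq: "infsum cp_term {- int n\<^sub>0..} + (\<Sum>l\<in>L. of_real (w l * (4 * pi * sqrt C / s * sqrt (1 + s * X / C)) ^ l) * infsum (cm_term l) {1..}) =
      \<i> powr of_real k * ?ck * infsum dp_term {- int n\<^sub>0..} +
      \<i> powr of_real k * ?ck * (\<Sum>l\<in>L. of_real (w l * (4 * pi * sqrt C / s) ^ l) * infsum (dm_term l) {1..})"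
      by (simp only: mult_cancel_left) simp
    show ?thesis
      using cpS(1) cmS(1) dpS(1) dmS(1) nz eq by simp
  qed
  have bounded_growth: "(\<lambda>n. norm (b (int n))) \<in> O(\<lambda>n. exp (C\<^sub>f * sqrt (real n)))" if "\<exists>B. \<forall>n\<ge>1. norm (b n) \<le> B" for b :: "int \<Rightarrow> complex"
  proof -
    obtain B where B: "\<And>n. n \<ge> 1 \<Longrightarrow> norm (b n) \<le> B" using \<open>\<exists>B. _\<close> by blast
    show ?thesis
    proof (rule bigoI[of _ "\<bar>B\<bar>"])
      show "eventually (\<lambda>n. norm (norm (b (int n))) \<le> \<bar>B\<bar> * norm (exp (C\<^sub>f * sqrt (real n)))) sequentially"
        using eventually_ge_at_top[of "1::nat"]
      proof eventually_elim
        case (elim n)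
        have "norm (b (int n)) \<le> \<bar>B\<bar> * 1" using B[of "int n"] elim by simp
        also have "\<dots> \<le> \<bar>B\<bar> * exp (C\<^sub>f * sqrt (real n))"
          using \<open>C\<^sub>f > 0\<close> by (intro mult_left_mono) auto
        finally show ?case by simp
      qed
    qed
  qed
  show ?thesis
  proof (intro conjI allI impI)
    fix m X assume k: "k = - real m" and X: "(0::real) < X"
    have near: "near_holomorphic m f"
      using harmonic_maass_form_near_holomorphic[OF level(1) character] form k by simp
    have cm: "\<exists>B. \<forall>n\<ge>1. norm (cm n) \<le> B"
      using minus_coefficients_bounded[OF _ near] expansion_f k by blast
    have dm: "\<exists>B. \<forall>n\<ge>1. norm (dm n) \<le> B"
      using minus_coefficients_bounded[OF _ near_holomorphic_fricke[OF level(1) near]] expansion_g k by blast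
    have f_exp: "has_maass_expansion (- real m) 1 n\<^sub>0 cp cm f"
      and g_exp: "has_maass_expansion (- real m) 1 n\<^sub>0 dp dm (fricke k N f)"
      using expansion_f expansion_g k by simp_all
    \<comment> \<open>Matching the two expansions instantiates \<open>L\<close> with
      \<open>{..m}\<close> and \<open>w l\<close> with \<open>fact m / fact l\<close>.\<close>
    note T = main[OF X bounded_growth[OF cm] bounded_growth[OF dm]
        has_maass_expansion_imaginary_nat_weight[OF f_exp s, unfolded of_real_mult[of "fact m / fact _", symmetric]]
        has_maass_expansion_imaginary_nat_weight[OF g_exp s, unfolded of_real_mult[of "fact m / fact _", symmetric]]
        refl refl refl refl]
    show "let cp_term = (\<lambda>n. cp n * of_real (bessel_K 0 (2 * sqrt (D n * (C + sqrt (real N) * X)))));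
          cm_term = (\<lambda>l n. cm n * of_real ((of_int n / sqrt (D n)) ^ l *
                       bessel_K (real l) (2 * sqrt (D n * (C + sqrt (real N) * X)))));
          dp_term = (\<lambda>n. dp n * of_real ((sqrt (real N) * X + D n) powr (- k / 2) *
                       bessel_K k (2 * sqrt (C * (D n + sqrt (real N) * X)))));
          dm_term = (\<lambda>l n. dm n * of_real (of_int n ^ l *
                       (D n + sqrt (real N) * X) powr (- (real l + k) / 2) *
                       bessel_K (real l + k) (2 * sqrt (C * (D n + sqrt (real N) * X)))))
      in cp_term summable_on {- int n\<^sub>0..} \<and> (\<forall>l\<le>m. cm_term l summable_on {1..}) \<and>
         dp_term summable_on {- int n\<^sub>0..} \<and> (\<forall>l\<le>m. dm_term l summable_on {1..}) \<and>
         (\<Sum>\<^sub>\<infinity>n\<in>{- int n\<^sub>0..}. cp_term n) +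
         (\<Sum>l=0..m. of_real (fact m / fact l *
            (4 * pi * sqrt C / sqrt (real N) * sqrt (1 + sqrt (real N) * X / C)) ^ l) *
            (\<Sum>\<^sub>\<infinity>n\<in>{1..}. cm_term l n)) =
         \<i> powr of_real k * of_real (C powr (k / 2)) * (\<Sum>\<^sub>\<infinity>n\<in>{- int n\<^sub>0..}. dp_term n) +
         \<i> powr of_real k * of_real (C powr (k / 2)) *
         (\<Sum>l=0..m. of_real (fact m / fact l * (4 * pi * sqrt C / sqrt (real N)) ^ l) *
            (\<Sum>\<^sub>\<infinity>n\<in>{1..}. dm_term l n))"
      unfolding Let_def s_def[symmetric] atLeast0AtMost using T by blast
  next
    fix X assume W: "weakly_holomorphic_form k N chi f" and X: "(0::real) < X"
    have cm: "cm n = 0" and dm: "dm n = 0" if "n \<ge> 1" for n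
      using weakly_holomorphic_minus_coefficients[OF level(1) W that] expansion_f expansion_g by blast+
    have exp0: "F (\<i> * of_real (exp u / s)) =
        (\<Sum>\<^sub>\<infinity>j\<in>{- int n\<^sub>0..}. a j * of_real (exp (- (2 * pi * exp u / s * of_int j))))"
      if E: "has_maass_expansion k 1 n\<^sub>0 a b F" and b: "\<And>n. n \<ge> 1 \<Longrightarrow> b n = 0" for F a b u
    proof -
      have z: "\<i> * of_real (exp u / s) \<in> upper_half_plane" using s by (simp add: upper_half_plane_def)
      have "(\<Sum>\<^sub>\<infinity>n\<in>{1..}. b n * of_real (inc_Gamma (1 - k) (4 * pi * of_int n * Im (\<i> * of_real (exp u / s)) / real 1)) *
          qpow (- of_int n / real 1) (\<i> * of_real (exp u / s))) = 0"
        by (rule infsum_0) (use b in auto)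
      with E[unfolded has_maass_expansion_def, rule_format, OF z]
      have "F (\<i> * of_real (exp u / s)) = (\<Sum>\<^sub>\<infinity>n\<in>{- int n\<^sub>0..}. a n * qpow (of_int n / real 1) (\<i> * of_real (exp u / s)))"
        by (simp only: add_0_right)
      then show ?thesis unfolding qpow_imaginary by simp
    qed
    have "\<exists>B. \<forall>n\<ge>1. norm (cm n) \<le> B" "\<exists>B. \<forall>n\<ge>1. norm (dm n) \<le> B"
      using cm dm by (auto intro!: exI[of _ 0])
    note B = bounded_growth[OF this(1)] bounded_growth[OF this(2)]
    \<comment> \<open>With \<open>L\<close> empty both sums over l vanish, and the weight k may be
      arbitrary because the closed form of the incomplete gamma function never enters.\<close>
    note T = main[where L = "{}", OF X B, unfolded sum.empty add_0_right mult_zero_right,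
        OF exp0[OF expansion_f cm] exp0[OF expansion_g dm] refl refl refl refl]
    show "let cp_term = (\<lambda>n. cp n * of_real (bessel_K 0 (2 * sqrt (D n * (C + sqrt (real N) * X)))));
          dp_term = (\<lambda>n. dp n * of_real ((sqrt (real N) * X + D n) powr (- k / 2) *
                       bessel_K k (2 * sqrt (C * (D n + sqrt (real N) * X)))))
      in cp_term summable_on {- int n\<^sub>0..} \<and> dp_term summable_on {- int n\<^sub>0..} \<and>
         (\<Sum>\<^sub>\<infinity>n\<in>{- int n\<^sub>0..}. cp_term n) =
         \<i> powr of_real k * of_real (C powr (k / 2)) * (\<Sum>\<^sub>\<infinity>n\<in>{- int n\<^sub>0..}. dp_term n)"
      unfolding Let_def s_def[symmetric] using T by blast
  qed
qed

end
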